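(* Let $\mathbb{K}$ be a local field of characteristic $p>0$, let $G$ be a (finite-dimensional) $C^1$-Lie group over $\mathbb{K}$, and suppose that $G$ admits a contractive $C^1$-automorphism $\alpha\colon G\to G$. Then $G$ is a torsion group of finite exponent and $G$ is solvable. Furthermore, there exists a series $$\{1\}=G_0\,\triangleleft\,G_1\,\triangleleft\,\cdots\,\triangleleft\,G_n=G$$ of closed subgroups $G_j$ of $G$ which are $\alpha$-stable (i.e. $\alpha(G_j)=G_j$), such that for each $j\in\{1,\ldots,n\}$ the contraction group $G_j/G_{j-1}$ (with the automorphism induced by $\alpha$) is isomorphic, as a contraction group, to $C_p^{(-\mathbb{N})}\times C_p^{\mathbb{N}_0}$ with the right shift.
   Context: A local field is a totally disconnected, non-discrete, locally compact topological field; its topology is defined by an ultrametric absolute value $|.|$, which we fix. All manifolds and Lie groups are finite-dimensional. $C^1$-maps: for finite-dimensional $\mathbb{K}$-vector spaces $E,F$ and $U\subseteq E$ open, let $U^{[1]}:=\{(x,y,t)\in U\times E\times\mathbb{K}: x+ty\in U\}$. A map $f\colon U\to F$ is $C^1$ if it is continuous and there is a continuous map $f^{[1]}\colon U^{[1]}\to F$ with $f^{[1]}(x,y,t)=\frac{f(x+ty)-f(x)}{t}$ for all $(x,y,t)\in U^{[1]}$ with $t\neq 0$. (Equivalently, $f$ is strictly differentiable at each point.) $C^1$-manifolds are defined via charts in the usual way, and a $C^1$-Lie group is a group with a $C^1$-manifold structure for which multiplication and inversion are $C^1$. A $C^1$-automorphism is a group automorphism which is $C^1$ together with its inverse. An automorphism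 $\alpha$ of a topological group $G$ is contractive if $\alpha^n(x)\to 1$ as $n\to\infty$ for each $x\in G$. A contraction group is a pair $(G,\alpha)$ of a topological group $G$ and a contractive bicontinuous automorphism $\alpha$. A morphism of contraction groups $(G_1,\alpha_1)\to(G_2,\alpha_2)$ is a continuous homomorphism $\phi\colon G_1\to G_2$ with $\alpha_2\circ\phi=\phi\circ\alpha_1$; isomorphisms are the invertible morphisms. $C_p$ is the cyclic group of order $p$, and $\mathbb{N}=\{1,2,\ldots\}$, $\mathbb{N}_0=\mathbb{N}\cup\{0\}$. $C_p^{(-\mathbb{N})}\times C_p^{\mathbb{N}_0}$ denotes the restricted product of all functions $f\colon\mathbb{Z}\to C_p$ such that $f(n)=1$ for all $n$ below some $n_0$ (depending on $f$), with the infinite power $C_p^{\mathbb{N}_0}$ (product topology) as a compact open subgroup. The right shift $\sigma$ is given by $\sigma(f)(n):=f(n-1)$. *)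

theory Defs
  imports "HOL-Analysis.Analysis" "HOL-Algebra.Elementary_Groups"
    "HOL-Algebra.Solvable_Groups"
begin

section \<open>Local fields\<close>

text \<open>
  The type classes make addition, negation and multiplication continuous; continuity of inversion
  is what remains to be required of a topological field. The absolute value defining
  the topology is part of the data.
\<close>

locale local_field =
  fixes absval :: "'k::{field, topological_ab_group_add, topological_monoid_mult} \<Rightarrow> real"
  assumes continuous_inverse: "continuous_on (- {0}) (inverse :: 'k \<Rightarrow> 'k)"
    and totally_disconnected: "\<And>S :: 'k set. connected S \<Longrightarrow> \<exists>x. S \<subseteq> {x}"
    and non_discrete: "\<exists>S :: 'k set. \<not> open S"
    and locally_compact: "locally_compact_space (euclidean :: 'k topology)"
    and absval_nonneg: "absval x \<ge> 0"
    and absval_eq_0_iff: "absval x = 0 \<longleftrightarrow> x = 0"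
    and absval_mult: "absval (x * y) = absval x * absval y"
    and absval_ultrametric: "absval (x + y) \<le> max (absval x) (absval y)"
    and open_iff_absval:
      "open S \<longleftrightarrow> (\<forall>x\<in>S. \<exists>\<epsilon>>0. \<forall>y. absval (y - x) < \<epsilon> \<longrightarrow> y \<in> S)"


section \<open>Continuously differentiable maps and manifolds\<close>

text \<open>
  Over a local field, a finite-dimensional vector space carries exactly one Hausdorff vector
  space topology; this is the topology intended on every finite-dimensional space.
\<close>

definition fin_dim_tvs ::
    "('k::{field, topological_space} \<Rightarrow> 'e::{topological_ab_group_add, t2_space} \<Rightarrow> 'e) \<Rightarrow> bool" where
  "fin_dim_tvs sE \<longleftrightarrow>
     (\<exists>B. finite_dimensional_vector_space sE B) \<and>
     continuous_on UNIV (\<lambda>(t, x). sE t x)"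

definition C1_on ::
    "('k::{field, topological_space} \<Rightarrow> 'e::{ab_group_add, topological_space} \<Rightarrow> 'e) \<Rightarrow>
     ('k \<Rightarrow> 'f::{ab_group_add, topological_space} \<Rightarrow> 'f) \<Rightarrow> 'e set \<Rightarrow> ('e \<Rightarrow> 'f) \<Rightarrow> bool" where
  "C1_on sE sF U f \<longleftrightarrow>
     open U \<and> continuous_on U f \<and>
     (\<exists>f1 :: 'e \<times> 'e \<times> 'k \<Rightarrow> 'f.
        continuous_on {(x, y, t). x \<in> U \<and> x + sE t y \<in> U} f1 \<and>
        (\<forall>x y t. x \<in> U \<longrightarrow> x + sE t y \<in> U \<longrightarrow> t \<noteq> 0 \<longrightarrow>
           f1 (x, y, t) = sF (1 / t) (f (x + sE t y) - f x)))"

text \<open>A chart is a pair of its domain and its coordinate map.\<close>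

type_synonym ('g, 'e) chart = "'g set \<times> ('g \<Rightarrow> 'e)"

definition C1_manifold ::
    "('k::{field, topological_space} \<Rightarrow> 'e::{ab_group_add, topological_space} \<Rightarrow> 'e) \<Rightarrow>
     'g topology \<Rightarrow> ('g, 'e) chart set \<Rightarrow> bool" where
  "C1_manifold sE T A \<longleftrightarrow>
     Hausdorff_space T \<and>
     (\<Union>(U, \<phi>)\<in>A. U) = topspace T \<and>
     (\<forall>(U, \<phi>)\<in>A. openin T U \<and> open (\<phi> ` U) \<and>
        homeomorphic_map (subtopology T U) (top_of_set (\<phi> ` U)) \<phi>) \<and>
     (\<forall>(U, \<phi>)\<in>A. \<forall>(V, \<psi>)\<in>A. C1_on sE sE (\<phi> ` (U \<inter> V)) (\<psi> \<circ> inv_into U \<phi>))"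

definition C1_map ::
    "('k::{field, topological_space} \<Rightarrow> 'e::{ab_group_add, topological_space} \<Rightarrow> 'e) \<Rightarrow>
     'g topology \<Rightarrow> ('g, 'e) chart set \<Rightarrow>
     ('k \<Rightarrow> 'f::{ab_group_add, topological_space} \<Rightarrow> 'f) \<Rightarrow>
     'h topology \<Rightarrow> ('h, 'f) chart set \<Rightarrow> ('g \<Rightarrow> 'h) \<Rightarrow> bool" where
  "C1_map sE T A sF T' A' f \<longleftrightarrow>
     continuous_map T T' f \<and>
     (\<forall>(U, \<phi>)\<in>A. \<forall>(V, \<psi>)\<in>A'.
        C1_on sE sF (\<phi> ` {x \<in> U. f x \<in> V}) (\<psi> \<circ> f \<circ> inv_into U \<phi>))"

definition prod_scale :: "('k \<Rightarrow> 'e \<Rightarrow> 'e) \<Rightarrow> ('k \<Rightarrow> 'f \<Rightarrow> 'f) \<Rightarrow> 'k \<Rightarrow> 'e \<times> 'f \<Rightarrow> 'e \<times> 'f" where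
  "prod_scale sE sF t = map_prod (sE t) (sF t)"

definition prod_atlas :: "('g, 'e) chart set \<Rightarrow> ('h, 'f) chart set \<Rightarrow> ('g \<times> 'h, 'e \<times> 'f) chart set" where
  "prod_atlas A A' = {(U \<times> V, map_prod \<phi> \<psi>) | U \<phi> V \<psi>. (U, \<phi>) \<in> A \<and> (V, \<psi>) \<in> A'}"

definition C1_Lie_group ::
    "('k::{field, topological_space} \<Rightarrow> 'e::{topological_ab_group_add, t2_space} \<Rightarrow> 'e) \<Rightarrow>
     ('g, 'm) monoid_scheme \<Rightarrow> 'g topology \<Rightarrow> ('g, 'e) chart set \<Rightarrow> bool" where
  "C1_Lie_group sE G T A \<longleftrightarrow>
     fin_dim_tvs sE \<and> group G \<and> topspace T = carrier G \<and> C1_manifold sE T A \<and>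
     C1_map (prod_scale sE sE) (prod_topology T T) (prod_atlas A A) sE T A (\<lambda>(x, y). x \<otimes>\<^bsub>G\<^esub> y) \<and>
     C1_map sE T A sE T A (\<lambda>x. inv\<^bsub>G\<^esub> x)"

definition C1_automorphism ::
    "('k::{field, topological_space} \<Rightarrow> 'e::{ab_group_add, topological_space} \<Rightarrow> 'e) \<Rightarrow>
     ('g, 'm) monoid_scheme \<Rightarrow> 'g topology \<Rightarrow> ('g, 'e) chart set \<Rightarrow> ('g \<Rightarrow> 'g) \<Rightarrow> bool" where
  "C1_automorphism sE G T A \<alpha> \<longleftrightarrow>
     \<alpha> \<in> iso G G \<and> C1_map sE T A sE T A \<alpha> \<and> C1_map sE T A sE T A (inv_into (carrier G) \<alpha>)"


section \<open>Contraction groups\<close>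

definition topological_group :: "('g, 'm) monoid_scheme \<Rightarrow> 'g topology \<Rightarrow> bool" where
  "topological_group G T \<longleftrightarrow>
     group G \<and> topspace T = carrier G \<and>
     continuous_map (prod_topology T T) T (\<lambda>(x, y). x \<otimes>\<^bsub>G\<^esub> y) \<and>
     continuous_map T T (\<lambda>x. inv\<^bsub>G\<^esub> x)"

definition contractive :: "('g, 'm) monoid_scheme \<Rightarrow> 'g topology \<Rightarrow> ('g \<Rightarrow> 'g) \<Rightarrow> bool" where
  "contractive G T \<alpha> \<longleftrightarrow>
     (\<forall>x\<in>carrier G. limitin T (\<lambda>n. (\<alpha> ^^ n) x) \<one>\<^bsub>G\<^esub> sequentially)"

definition contraction_group :: "('g, 'm) monoid_scheme \<Rightarrow> 'g topology \<Rightarrow> ('g \<Rightarrow> 'g) \<Rightarrow> bool" where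
  "contraction_group G T \<alpha> \<longleftrightarrow>
     topological_group G T \<and> \<alpha> \<in> iso G G \<and> homeomorphic_map T T \<alpha> \<and> contractive G T \<alpha>"

definition contraction_morphism ::
    "('g, 'm) monoid_scheme \<Rightarrow> 'g topology \<Rightarrow> ('g \<Rightarrow> 'g) \<Rightarrow>
     ('h, 'n) monoid_scheme \<Rightarrow> 'h topology \<Rightarrow> ('h \<Rightarrow> 'h) \<Rightarrow> ('g \<Rightarrow> 'h) \<Rightarrow> bool" where
  "contraction_morphism G T \<alpha> H S \<beta> \<phi> \<longleftrightarrow>
     \<phi> \<in> hom G H \<and> continuous_map T S \<phi> \<and> (\<forall>x\<in>carrier G. \<beta> (\<phi> x) = \<phi> (\<alpha> x))"

definition contraction_isomorphic ::
    "('g, 'm) monoid_scheme \<Rightarrow> 'g topology \<Rightarrow> ('g \<Rightarrow> 'g) \<Rightarrow>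
     ('h, 'n) monoid_scheme \<Rightarrow> 'h topology \<Rightarrow> ('h \<Rightarrow> 'h) \<Rightarrow> bool" where
  "contraction_isomorphic G T \<alpha> H S \<beta> \<longleftrightarrow>
     contraction_group G T \<alpha> \<and> contraction_group H S \<beta> \<and>
     (\<exists>\<phi> \<psi>. contraction_morphism G T \<alpha> H S \<beta> \<phi> \<and> contraction_morphism H S \<beta> G T \<alpha> \<psi> \<and>
        (\<forall>x\<in>carrier G. \<psi> (\<phi> x) = x) \<and> (\<forall>y\<in>carrier H. \<phi> (\<psi> y) = y))"

definition torsion_group :: "('g, 'm) monoid_scheme \<Rightarrow> bool" where
  "torsion_group G \<longleftrightarrow> (\<forall>x\<in>carrier G. \<exists>n::nat. n > 0 \<and> x [^]\<^bsub>G\<^esub> n = \<one>\<^bsub>G\<^esub>)"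

definition finite_exponent :: "('g, 'm) monoid_scheme \<Rightarrow> bool" where
  "finite_exponent G \<longleftrightarrow> (\<exists>n::nat. n > 0 \<and> (\<forall>x\<in>carrier G. x [^]\<^bsub>G\<^esub> n = \<one>\<^bsub>G\<^esub>))"


section \<open>Quotient topology\<close>

definition quotient_topology :: "'a topology \<Rightarrow> ('a \<Rightarrow> 'b) \<Rightarrow> 'b topology" where
  "quotient_topology X q =
     topology (\<lambda>V. V \<subseteq> q ` topspace X \<and> openin X {x \<in> topspace X. q x \<in> V})"

lemma openin_quotient_topology:
  "openin (quotient_topology X q) V \<longleftrightarrow>
     V \<subseteq> q ` topspace X \<and> openin X {x \<in> topspace X. q x \<in> V}"
proof -
  have "istopology (\<lambda>V. V \<subseteq> q ` topspace X \<and> openin X {x \<in> topspace X. q x \<in> V})"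
    unfolding istopology_def
  proof (intro conjI allI impI)
    fix V W
    assume V: "V \<subseteq> q ` topspace X \<and> openin X {x \<in> topspace X. q x \<in> V}"
      and W: "W \<subseteq> q ` topspace X \<and> openin X {x \<in> topspace X. q x \<in> W}"
    have "{x \<in> topspace X. q x \<in> V \<inter> W} =
        {x \<in> topspace X. q x \<in> V} \<inter> {x \<in> topspace X. q x \<in> W}"
      by blast
    with V W show "openin X {x \<in> topspace X. q x \<in> V \<inter> W}"
      by (simp only: openin_Int)
    show "V \<inter> W \<subseteq> q ` topspace X"
      using V by blast
  next
    fix \<K>
    assume K: "\<forall>V\<in>\<K>. V \<subseteq> q ` topspace X \<and> openin X {x \<in> topspace X. q x \<in> V}"
    have "{x \<in> topspace X. q x \<in> \<Union>\<K>} = (\<Union>V\<in>\<K>. {x \<in> topspace X. q x \<in> V})"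
      by blast
    moreover have "openin X (\<Union>V\<in>\<K>. {x \<in> topspace X. q x \<in> V})"
      using K by (intro openin_Union) blast
    ultimately show "openin X {x \<in> topspace X. q x \<in> \<Union>\<K>}"
      by (simp only:)
    show "\<Union>\<K> \<subseteq> q ` topspace X"
      using K by blast
  qed
  then show ?thesis
    by (simp add: quotient_topology_def topology_inverse')
qed

lemma topspace_quotient_topology: "topspace (quotient_topology X q) = q ` topspace X"
proof -
  have "{x \<in> topspace X. q x \<in> q ` topspace X} = topspace X"
    by blast
  then have "openin (quotient_topology X q) (q ` topspace X)"
    by (simp add: openin_quotient_topology)
  moreover have "topspace (quotient_topology X q) \<subseteq> q ` topspace X"
    using openin_topspace[of "quotient_topology X q"] unfolding openin_quotient_topology by (rule conjunct1)
  ultimately show ?thesis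
    by (intro equalityI openin_subset)
qed

lemma quotient_map_quotient_topology: "quotient_map X (quotient_topology X q) q"
  by (auto simp: quotient_map_def topspace_quotient_topology openin_quotient_topology)


section \<open>The restricted product with the right shift\<close>

definition shift_group :: "('c, 'm) monoid_scheme \<Rightarrow> (int \<Rightarrow> 'c) monoid" where
  "shift_group F =
     \<lparr>carrier = {f. (\<forall>n. f n \<in> carrier F) \<and> (\<exists>n0. \<forall>n<n0. f n = \<one>\<^bsub>F\<^esub>)},
      monoid.mult = (\<lambda>f g n. f n \<otimes>\<^bsub>F\<^esub> g n),
      one = (\<lambda>n. \<one>\<^bsub>F\<^esub>)\<rparr>"

text \<open>
  The compact group of all maps from the non-negative integers to \<open>F\<close>, each extended by the
  neutral element at the negative integers. The ambient product over all integers
  induces the product topology on it.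
\<close>

definition shift_compact_subgroup :: "('c, 'm) monoid_scheme \<Rightarrow> (int \<Rightarrow> 'c) set" where
  "shift_compact_subgroup F = {f. (\<forall>n. f n \<in> carrier F) \<and> (\<forall>n<0. f n = \<one>\<^bsub>F\<^esub>)}"

definition shift_compact_topology :: "('c, 'm) monoid_scheme \<Rightarrow> (int \<Rightarrow> 'c) topology" where
  "shift_compact_topology F =
     subtopology (product_topology (\<lambda>_. discrete_topology (carrier F)) UNIV) (shift_compact_subgroup F)"

text \<open>
  The group topology making the compact subgroup, with its product topology, open: a set is
  open iff each of its translates meets the compact subgroup in a relatively open set.
\<close>

definition shift_topology :: "('c, 'm) monoid_scheme \<Rightarrow> (int \<Rightarrow> 'c) topology" where
  "shift_topology F =
     topology (\<lambda>U. U \<subseteq> carrier (shift_group F) \<and>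
       (\<forall>f\<in>carrier (shift_group F).
          openin (shift_compact_topology F)
            {g \<in> shift_compact_subgroup F. f \<otimes>\<^bsub>shift_group F\<^esub> g \<in> U}))"

definition right_shift :: "(int \<Rightarrow> 'c) \<Rightarrow> int \<Rightarrow> 'c" where
  "right_shift f n = f (n - 1)"

lemma openin_shift_topology:
  "openin (shift_topology F) U \<longleftrightarrow>
     U \<subseteq> carrier (shift_group F) \<and>
       (\<forall>f\<in>carrier (shift_group F).
          openin (shift_compact_topology F)
            {g \<in> shift_compact_subgroup F. f \<otimes>\<^bsub>shift_group F\<^esub> g \<in> U})"
proof -
  let ?S = "\<lambda>f U. {g \<in> shift_compact_subgroup F. f \<otimes>\<^bsub>shift_group F\<^esub> g \<in> U}"
  let ?P = "\<lambda>U. U \<subseteq> carrier (shift_group F) \<and>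
       (\<forall>f\<in>carrier (shift_group F). openin (shift_compact_topology F) (?S f U))"
  have "istopology ?P"
    unfolding istopology_def
  proof (intro conjI allI impI ballI)
    fix V W f
    assume V: "?P V" and W: "?P W" and f: "f \<in> carrier (shift_group F)"
    have "?S f (V \<inter> W) = ?S f V \<inter> ?S f W"
      by blast
    moreover have "openin (shift_compact_topology F) (?S f V)" "openin (shift_compact_topology F) (?S f W)"
      using V W f by blast+
    ultimately show "openin (shift_compact_topology F) (?S f (V \<inter> W))"
      by (simp only: openin_Int)
  next
    fix \<K> f
    assume K: "\<forall>V\<in>\<K>. ?P V" and f: "f \<in> carrier (shift_group F)"
    have "?S f (\<Union>\<K>) = (\<Union>V\<in>\<K>. ?S f V)"
      by blast
    moreover have "openin (shift_compact_topology F) (\<Union>V\<in>\<K>. ?S f V)"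
      using K f by (intro openin_Union) blast
    ultimately show "openin (shift_compact_topology F) (?S f (\<Union>\<K>))"
      by (simp only:)
  qed blast+
  then show ?thesis
    unfolding shift_topology_def by (subst topology_inverse') auto
qed

end

theory Submission
  imports Defs "HOL-Algebra.Zassenhaus"
begin

text \<open>
  In a chart around the identity the group law is, up to an error of arbitrarily small relative size,
  addition in a vector space over a field of characteristic \<open>p\<close>. Hence commutators \<open>[g, x]\<close> with \<open>g\<close>
  near the identity, and powers \<open>x\<^sup>p\<close>, are infinitely smaller than \<open>x\<close> as \<open>x\<close> tends to the
  identity, while \<open>\<alpha>\<close> shrinks elements at most by a bounded factor.

  Let \<open>N\<close> be a closed \<open>\<alpha>\<close>-stable normal subgroup, \<open>M\<close> a minimal such subgroup properly containing
  \<open>N\<close>, and \<open>x\<close> in \<open>M\<close>. If \<open>y = [g, x]\<close> or \<open>y = x\<^sup>p\<close> were not in \<open>N\<close>, then \<open>x\<close> would lie in the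
  closed \<open>\<alpha>\<close>-stable normal subgroup generated by \<open>y\<close> and \<open>N\<close>. By a compactness argument only
  the images of \<open>y\<close> under \<open>\<alpha>\<^sup>k\<close> with \<open>k\<close> bounded below are needed for this, which is
  impossible since their distances to \<open>N\<close> are eventually much smaller than those of the orbit of \<open>x\<close>. So \<open>M / N\<close> is
  central of exponent \<open>p\<close>, and it is topologically generated by the orbit of a single element,
  whose powers serve as the digits of an expansion identifying \<open>M / N\<close> with the shift.
  The number of cosets of \<open>\<alpha>(W)\<close> met by a closed stable subgroup within a compact open
  subgroup \<open>W\<close> with \<open>\<alpha>(W) \<subseteq> W\<close> is finite and strictly monotone, so such \<open>M\<close> exist and the series terminates.
\<close>

section \<open>Filtered contraction groups\<close>

text \<open>Two filtrations are needed. The Lie group estimates hold for the balls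
  \<open>B j\<close>, but \<alpha> need not map balls to balls, whereas the finiteness arguments
  require groups that \<alpha> permutes. The groups \<open>F n\<close>, the images of
  \<open>W\<close> under the powers of \<alpha>, have this property, and
  \<open>uniformly_contracts\<close> makes both filtrations define the same topology. No Lie algebra
  is used: all that remains of differentiability is three asymptotic statements about
  \<open>B\<close>. The first, \<open>expansion_bound\<close>, allows a loss of c levels at each
  application of \<alpha>; going back k1 steps costs c k1 levels, and this is what the arbitrary
  gain m in the other two statements has to beat. For the digits the obstacle is that elements of M
  may have digits at negative positions as well. The digit at position 0 is therefore defined on all
  of M through an explicit complement of x, built from its backward orbit and from the closed group
  \<open>P 1\<close> of its later forward orbit.\<close>

context group
begin

lemma inv_mult_cancel:
  assumes "x \<in> carrier G" "y \<in> carrier G"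
  shows "inv x \<otimes> (x \<otimes> y) = y" "x \<otimes> (inv x \<otimes> y) = y"
  using assms by (simp_all add: m_assoc[symmetric])

lemmas group_normalize = m_assoc inv_mult_group inv_mult_cancel

lemma subgroup_inv_mult:
  assumes "subgroup H G" "x \<in> H" "y \<in> H"
  shows "inv x \<otimes> y \<in> H"
  using assms by (simp add: subgroup.m_closed subgroup.m_inv_closed)

lemma subgroup_inv_mult_trans:
  assumes "subgroup H G" "x \<in> carrier G" "y \<in> carrier G" "z \<in> carrier G"
    "inv x \<otimes> y \<in> H" "inv y \<otimes> z \<in> H"
  shows "inv x \<otimes> z \<in> H"
proof -
  have "inv x \<otimes> z = (inv x \<otimes> y) \<otimes> (inv y \<otimes> z)"
    using assms by (simp add: group_normalize)
  then show ?thesis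
    using assms by (simp add: subgroup.m_closed)
qed

lemma subgroup_inv_mult_sym:
  assumes "subgroup H G" "x \<in> carrier G" "y \<in> carrier G" "inv x \<otimes> y \<in> H"
  shows "inv y \<otimes> x \<in> H"
proof -
  have "inv y \<otimes> x = inv (inv x \<otimes> y)"
    using assms by (simp add: group_normalize)
  then show ?thesis
    using assms by (simp add: subgroup.m_inv_closed)
qed

lemma subgroup_mult_iff_left:
  assumes "subgroup H G" "h \<in> H" "y \<in> carrier G"
  shows "h \<otimes> y \<in> H \<longleftrightarrow> y \<in> H"
proof
  assume "h \<otimes> y \<in> H"
  then have "inv h \<otimes> (h \<otimes> y) \<in> H"
    using assms by (intro subgroup_inv_mult)
  then show "y \<in> H"
    using assms by (simp add: inv_mult_cancel subgroup.mem_carrier)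
qed (use assms in \<open>simp add: subgroup.m_closed\<close>)

end

text \<open>The groups \<open>B j\<close> play the role of small balls. The last three axioms hold in a chart of a Lie group
  in characteristic \<open>p\<close> since \<open>\<alpha>\<^sup>-\<^sup>1\<close> is Lipschitz and since commutators and \<open>p\<close>-th powers have
  vanishing derivative.\<close>

locale contraction_filtration = group G for G (structure) +
  fixes \<alpha> :: "'a \<Rightarrow> 'a" and B :: "nat \<Rightarrow> 'a set" and p :: nat
  assumes prime_p: "prime p"
    and iso: "\<alpha> \<in> iso G G"
    and subgroup_B: "subgroup (B j) G"
    and B_Suc: "B (Suc j) \<subseteq> B j"
    and B_separated: "(\<Inter>j. B j) \<subseteq> {\<one>}"
    and B_finite_index: "\<exists>R. finite R \<and> R \<subseteq> carrier G \<and> (\<forall>x\<in>B i. \<exists>r\<in>R. inv r \<otimes> x \<in> B j)"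
    and B_complete: "(\<And>n. u n \<in> carrier G) \<Longrightarrow> (\<And>n. inv (u n) \<otimes> u (Suc n) \<in> B n) \<Longrightarrow>
      \<exists>v\<in>carrier G. \<forall>n. inv (u n) \<otimes> v \<in> B n"
    and contracts: "x \<in> carrier G \<Longrightarrow> \<exists>n. \<forall>k\<ge>n. (\<alpha> ^^ k) x \<in> B j"
    and continuous: "\<exists>l. \<alpha> ` B l \<subseteq> B j"
    and expansion_bound: "\<exists>c J. \<forall>j\<ge>J. B (j + c) \<subseteq> \<alpha> ` B j"
    and commutator_B: "\<exists>J. \<forall>j\<ge>J. \<forall>g\<in>B J. \<forall>x\<in>B j. g \<otimes> x \<otimes> inv g \<otimes> inv x \<in> B (j + m)"
    and power_B: "\<exists>J. \<forall>j\<ge>J. \<forall>x\<in>B j. x [^] p \<in> B (j + m)"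
begin

section \<open>Integer powers of the automorphism\<close>

lemma B_antimono: "i \<le> j \<Longrightarrow> B j \<subseteq> B i"
  by (rule lift_Suc_antimono_le[of B]) (simp_all add: B_Suc)

lemma B_carrier: "x \<in> B j \<Longrightarrow> x \<in> carrier G"
  by (rule subgroup.mem_carrier[OF subgroup_B])

lemma bij_alpha: "bij_betw \<alpha> (carrier G) (carrier G)"
  using iso by (simp add: iso_def)

lemma alpha_closed [simp]: "x \<in> carrier G \<Longrightarrow> \<alpha> x \<in> carrier G"
  using bij_alpha by (rule bij_betw_apply)

lemma alpha_mult: "x \<in> carrier G \<Longrightarrow> y \<in> carrier G \<Longrightarrow> \<alpha> (x \<otimes> y) = \<alpha> x \<otimes> \<alpha> y"
  using iso by (simp add: iso_def hom_mult)

definition alpha_inv :: "'a \<Rightarrow> 'a" where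
  "alpha_inv = inv_into (carrier G) \<alpha>"

lemma alpha_inv_closed [simp]: "x \<in> carrier G \<Longrightarrow> alpha_inv x \<in> carrier G"
  unfolding alpha_inv_def by (metis bij_alpha bij_betw_imp_surj_on inv_into_into)

lemma alpha_alpha_inv [simp]: "x \<in> carrier G \<Longrightarrow> \<alpha> (alpha_inv x) = x"
  unfolding alpha_inv_def by (metis bij_alpha bij_betw_inv_into_right)

lemma alpha_inv_alpha [simp]: "x \<in> carrier G \<Longrightarrow> alpha_inv (\<alpha> x) = x"
  unfolding alpha_inv_def by (metis bij_alpha bij_betw_inv_into_left)

definition ap :: "int \<Rightarrow> 'a \<Rightarrow> 'a" where
  "ap k = (if 0 \<le> k then \<alpha> ^^ nat k else alpha_inv ^^ nat (- k))"

lemma funpow_alpha_closed: "x \<in> carrier G \<Longrightarrow> (\<alpha> ^^ k) x \<in> carrier G"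
  by (induction k) auto

lemma funpow_alpha_inv_closed: "x \<in> carrier G \<Longrightarrow> (alpha_inv ^^ k) x \<in> carrier G"
  by (induction k) auto

lemma ap_closed [simp]: "x \<in> carrier G \<Longrightarrow> ap k x \<in> carrier G"
  by (simp add: ap_def funpow_alpha_closed funpow_alpha_inv_closed)

lemma ap_of_nat: "ap (int k) = \<alpha> ^^ k"
  by (simp add: ap_def)

lemma ap_0 [simp]: "ap 0 x = x"
  by (simp add: ap_def)

lemma ap_1 [simp]: "ap 1 x = \<alpha> x"
  by (simp add: ap_def)

lemma ap_Suc:
  assumes "x \<in> carrier G"
  shows "ap (k + 1) x = \<alpha> (ap k x)"
proof (cases "0 \<le> k")
  case True
  then have "nat (k + 1) = Suc (nat k)"
    by simp
  then show ?thesis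
    using True by (simp add: ap_def)
next
  case False
  then obtain n where n: "nat (- k) = Suc n"
    by (metis not0_implies_Suc nat_0_iff neg_le_0_iff_le)
  then have "k + 1 = - int n"
    using False by linarith
  moreover have "k = - int (Suc n)"
    using n False by linarith
  ultimately show ?thesis
    using assms by (cases n) (auto simp: ap_def nat_add_distrib funpow_alpha_inv_closed)
qed

lemma ap_pred:
  assumes "x \<in> carrier G"
  shows "ap (k - 1) x = alpha_inv (ap k x)"
  using ap_Suc[OF assms, of "k - 1"] assms by simp

lemma ap_add:
  assumes "x \<in> carrier G"
  shows "ap (k + l) x = ap k (ap l x)"
proof (induction k rule: int_induct[where k = 0])
  case base
  then show ?case by simp
next
  case (step1 i)
  have "ap (i + 1 + l) x = \<alpha> (ap (i + l) x)"
    using ap_Suc[OF assms, of "i + l"] by (simp add: algebra_simps)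
  then show ?case
    using step1 assms by (simp add: ap_Suc)
next
  case (step2 i)
  have "ap (i - 1 + l) x = alpha_inv (ap (i + l) x)"
    using ap_pred[OF assms, of "i + l"] by (simp add: algebra_simps)
  then show ?case
    using step2 assms by (simp add: ap_pred)
qed

lemma ap_cancel [simp]:
  assumes "x \<in> carrier G"
  shows "ap k (ap (- k) x) = x" "ap (- k) (ap k x) = x"
  using ap_add[OF assms, of k "- k"] ap_add[OF assms, of "- k" k] by simp_all

lemma alpha_inv_mult:
  assumes "x \<in> carrier G" "y \<in> carrier G"
  shows "alpha_inv (x \<otimes> y) = alpha_inv x \<otimes> alpha_inv y"
  by (metis alpha_alpha_inv alpha_inv_alpha alpha_inv_closed alpha_mult assms m_closed)

lemma ap_mult:
  assumes "x \<in> carrier G" "y \<in> carrier G"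
  shows "ap k (x \<otimes> y) = ap k x \<otimes> ap k y"
proof (induction k rule: int_induct[where k = 0])
  case (step1 i)
  then show ?case using assms by (simp add: ap_Suc alpha_mult)
next
  case (step2 i)
  then show ?case using assms by (simp add: ap_pred alpha_inv_mult)
qed simp

lemma group_hom_ap: "group_hom G G (ap k)"
  by (intro group_hom.intro group_hom_axioms.intro homI) (simp_all add: ap_mult is_group)

lemma ap_inv: "x \<in> carrier G \<Longrightarrow> ap k (inv x) = inv (ap k x)"
  by (simp add: group_hom.hom_inv group_hom_ap)

lemma ap_one [simp]: "ap k \<one> = \<one>"
  using group_hom.hom_one group_hom_ap by blast

lemma ap_nat_pow: "x \<in> carrier G \<Longrightarrow> ap k (x [^] (n::nat)) = ap k x [^] n"
  by (simp add: group_hom.hom_nat_pow group_hom_ap)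

lemma ap_inv_mult:
  "x \<in> carrier G \<Longrightarrow> y \<in> carrier G \<Longrightarrow> ap k (inv x \<otimes> y) = inv (ap k x) \<otimes> ap k y"
  by (simp add: ap_mult ap_inv)

lemma mem_ap_image:
  assumes "H \<subseteq> carrier G" "x \<in> carrier G"
  shows "x \<in> ap k ` H \<longleftrightarrow> ap (- k) x \<in> H"
proof
  assume "x \<in> ap k ` H"
  then show "ap (- k) x \<in> H"
    using assms by auto
next
  assume "ap (- k) x \<in> H"
  moreover have "x = ap k (ap (- k) x)"
    using assms by simp
  ultimately show "x \<in> ap k ` H"
    by blast
qed

text \<open>For negative powers continuity at the identity is read off from
  \<open>expansion_bound\<close>, which says that the inverse of \<alpha> maps
  \<open>B (j + c)\<close> into \<open>B j\<close> once j is large; taking \<open>max J j\<close>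
  covers the remaining j.\<close>

lemma ap_continuous: "\<exists>l. ap k ` B l \<subseteq> B j"
proof (induction k arbitrary: j rule: int_induct[where k = 0])
  case base
  then show ?case by auto
next
  case (step1 i)
  obtain l where l: "\<alpha> ` B l \<subseteq> B j"
    using continuous by blast
  obtain l' where l': "ap i ` B l' \<subseteq> B l"
    using step1 by blast
  have "ap (i + 1) ` B l' \<subseteq> B j"
    using l l' by (auto simp: ap_Suc B_carrier)
  then show ?case by blast
next
  case (step2 i)
  obtain c J where "\<forall>j\<ge>J. B (j + c) \<subseteq> \<alpha> ` B j"
    using expansion_bound by blast
  then have "B (max J j + c) \<subseteq> \<alpha> ` B (max J j)"
    by simp
  then have l: "alpha_inv ` B (max J j + c) \<subseteq> B j"
    using B_antimono[of j "max J j"] B_carrier by fastforce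
  obtain l' where l': "ap i ` B l' \<subseteq> B (max J j + c)"
    using step2 by blast
  have "ap (i - 1) ` B l' \<subseteq> B j"
    using l l' by (auto simp: ap_pred B_carrier)
  then show ?case by blast
qed

lemma B_limit_separated:
  assumes "x \<in> carrier G" "\<And>j. x \<in> B j"
  shows "x = \<one>"
  using assms B_separated by blast

text \<open>A Baire category argument: the subgroups \<open>V m\<close> of those \<open>x\<close> in \<open>B i\<close> whose orbit stays in
  \<open>B j\<close> from time \<open>m\<close> on are closed and cover \<open>B i\<close>.\<close>

lemma uniformly_contracts: "\<exists>m. \<forall>k\<ge>m. (\<alpha> ^^ k) ` B i \<subseteq> B j"
proof -
  define V where "V m = {x \<in> B i. \<forall>k\<ge>m. ap (int k) x \<in> B j}" for m :: nat
  have V_mono: "V m \<subseteq> V m'" if "m \<le> m'" for m m'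
    using that unfolding V_def by auto
  have V_cover: "\<exists>m. x \<in> V m" if "x \<in> B i" for x
    using contracts[OF B_carrier[OF that], of j] that unfolding V_def by (auto simp: ap_of_nat)
  have V_subgroup: "subgroup (V m) G" for m
  proof (rule subgroupI)
    show "V m \<noteq> {}"
      using subgroup.one_closed[OF subgroup_B] unfolding V_def by fastforce
  next
    fix a b assume "a \<in> V m" "b \<in> V m"
    then show "a \<otimes> b \<in> V m"
      unfolding V_def by (auto simp: ap_mult B_carrier subgroup.m_closed[OF subgroup_B])
  next
    fix a assume "a \<in> V m"
    then show "inv a \<in> V m"
      unfolding V_def by (auto simp: ap_inv B_carrier subgroup.m_inv_closed[OF subgroup_B])
  qed (auto simp: V_def B_carrier)
  \<comment> \<open>If no \<open>V m\<close> contained a ball, one could build nested cosets of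
    \<open>B (l n)\<close> through \<open>u n\<close> inside \<open>B i\<close>, the n-th one
    missing \<open>V n\<close>; their common point would lie in no \<open>V n\<close>.\<close>
  have "\<exists>m l. B l \<subseteq> V m"
  proof (rule ccontr)
    assume contra: "\<nexists>m l. B l \<subseteq> V m"
    define Q where "Q m = (\<lambda>(u, l). u \<in> B i \<and> i \<le> l \<and> m \<le> l \<and> (\<forall>b\<in>B l. u \<otimes> b \<notin> V m))" for m
    define S where "S m = (\<lambda>(u, l) (u', l'). inv u \<otimes> u' \<in> B l \<and> l \<le> (l' :: nat))" for m :: nat
    have step: "\<exists>u' l'. Q m (u', l') \<and> inv u \<otimes> u' \<in> B l \<and> l \<le> l'"
      if u: "u \<in> B i" and l: "i \<le> l" for m u l
    proof -
      obtain b0 where b0: "b0 \<in> B l" "b0 \<notin> V m"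
        using contra by blast
      \<comment> \<open>Either u is already outside the subgroup \<open>V m\<close>, or
        multiplication by an element outside \<open>V m\<close> takes it out.\<close>
      define b where "b = (if u \<in> V m then b0 else \<one>)"
      have b: "b \<in> B l"
        unfolding b_def using b0 subgroup.one_closed[OF subgroup_B] by simp
      have uc: "u \<in> carrier G" and bc: "b \<in> carrier G"
        using u b B_carrier by auto
      have ub: "u \<otimes> b \<notin> V m"
        using subgroup_mult_iff_left[OF V_subgroup, of u m b] b0 uc bc unfolding b_def by auto
      have ubi: "u \<otimes> b \<in> B i"
        using u b B_antimono[OF l] by (auto intro: subgroup.m_closed[OF subgroup_B])
      obtain k where k: "m \<le> k" "ap (int k) (u \<otimes> b) \<notin> B j"
        using ub ubi unfolding V_def by blast
      \<comment> \<open>Being outside \<open>B j\<close> at time k is an open condition because the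
        k-th power of \<alpha> is continuous, so it persists on a whole coset of
        \<open>B l'\<close>.\<close>
      obtain l1 where l1: "ap (int k) ` B l1 \<subseteq> B j"
        using ap_continuous by blast
      define l' where "l' = max (max l1 m) l"
      have "u \<otimes> b \<otimes> c \<notin> V m" if "c \<in> B l'" for c
      proof
        assume "u \<otimes> b \<otimes> c \<in> V m"
        then have "ap (int k) (u \<otimes> b \<otimes> c) \<in> B j"
          using k unfolding V_def by blast
        moreover have c: "ap (int k) c \<in> B j"
          using that l1 B_antimono[of l1 l'] unfolding l'_def by fastforce
        have "c \<in> carrier G"
          using that B_carrier by blast
        ultimately have "ap (int k) (u \<otimes> b) \<otimes> ap (int k) c \<otimes> inv (ap (int k) c) \<in> B j"
          using ap_mult[of "u \<otimes> b" c] c uc bc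
            subgroup.m_closed[OF subgroup_B _ subgroup.m_inv_closed[OF subgroup_B]]
          by (metis m_closed)
        then show False
          using k uc bc \<open>c \<in> carrier G\<close> by (simp add: m_assoc)
      qed
      then have "Q m (u \<otimes> b, l')"
        unfolding Q_def using ubi l by (auto simp: l'_def)
      moreover have "inv u \<otimes> (u \<otimes> b) \<in> B l"
        using b uc bc by (simp add: inv_mult_cancel)
      ultimately show ?thesis
        by (metis l'_def max.cobounded2)
    qed
    have "\<exists>s. \<forall>n. Q n (s n) \<and> S n (s n) (s (Suc n))"
    proof (rule dependent_nat_choice)
      show "\<exists>s. Q 0 s"
        using step[of \<one> i 0] subgroup.one_closed[OF subgroup_B] by blast
    next
      fix s n assume "Q n s"
      moreover obtain u l where "s = (u, l)"
        by fastforce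
      ultimately have "u \<in> B i" "i \<le> l"
        unfolding Q_def by auto
      then show "\<exists>t. Q (Suc n) t \<and> S n s t"
        using step[of u l "Suc n"] \<open>s = (u, l)\<close> unfolding S_def by fastforce
    qed
    then obtain s where s: "\<And>n. Q n (s n)" "\<And>n. S n (s n) (s (Suc n))"
      by blast
    define u where "u n = fst (s n)" for n
    define l where "l n = snd (s n)" for n
    have uB: "u n \<in> B i" and l_ge: "i \<le> l n" "n \<le> l n"
      and not_V: "\<And>b. b \<in> B (l n) \<Longrightarrow> u n \<otimes> b \<notin> V n" for n
      using s(1)[of n] by (auto simp: Q_def u_def l_def split: prod.splits)
    have u_step: "inv (u n) \<otimes> u (Suc n) \<in> B (l n)" and l_mono: "l n \<le> l (Suc n)" for n
      using s(2)[of n] by (auto simp: S_def u_def l_def split: prod.splits)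
    have uc: "u n \<in> carrier G" for n
      using uB B_carrier by blast
    have l_le: "l n \<le> l (n + d)" for n d
      by (rule lift_Suc_mono_le[of l]) (simp_all add: l_mono)
    have u_diff: "inv (u n) \<otimes> u (n + d) \<in> B (l n)" for n d
    proof (induction d)
      case 0
      then show ?case using uc subgroup.one_closed[OF subgroup_B] by simp
    next
      case (Suc d)
      have "inv (u (n + d)) \<otimes> u (Suc (n + d)) \<in> B (l n)"
        using u_step[of "n + d"] B_antimono[OF l_le] by blast
      then show ?case
        using subgroup_inv_mult_trans[OF subgroup_B uc uc uc Suc] by simp
    qed
    have "inv (u n) \<otimes> u (Suc n) \<in> B n" for n
      using u_step B_antimono[OF l_ge(2)] by blast
    then obtain v where v: "v \<in> carrier G" "\<And>n. inv (u n) \<otimes> v \<in> B n"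
      using B_complete[of u] uc by blast
    have lim: "inv (u n) \<otimes> v \<in> B (l n)" for n
    proof -
      have "inv (u (n + l n)) \<otimes> v \<in> B (l n)"
        using v(2)[of "n + l n"] B_antimono[of "l n" "n + l n"] by auto
      then show ?thesis
        using subgroup_inv_mult_trans[OF subgroup_B uc uc v(1) u_diff] by blast
    qed
    have "v = u n \<otimes> (inv (u n) \<otimes> v)" for n
      using uc v(1) by (simp add: inv_mult_cancel)
    then have "v \<notin> V n" for n
      using not_V lim by metis
    moreover have "v \<in> B i"
    proof -
      have "u 0 \<otimes> (inv (u 0) \<otimes> v) \<in> B i"
        using lim[of 0] B_antimono[OF l_ge(1)[of 0]]
        by (blast intro: subgroup.m_closed[OF subgroup_B uB])
      then show ?thesis
        using uc v(1) by (simp add: inv_mult_cancel)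
    qed
    ultimately show False
      using V_cover by blast
  qed
  then obtain m l where ml: "B l \<subseteq> V m"
    by blast
  \<comment> \<open>From a ball inside \<open>V m\<close> to all of \<open>B i\<close>: each of the
    finitely many cosets of \<open>B (max i l)\<close> that meets \<open>B i\<close> has a point in
    some \<open>V k\<close>, hence lies in \<open>V (max k m)\<close>.\<close>
  obtain R where R: "finite R" "R \<subseteq> carrier G" "\<And>x. x \<in> B i \<Longrightarrow> \<exists>r\<in>R. inv r \<otimes> x \<in> B (max i l)"
    using B_finite_index[of i "max i l"] by blast
  have "\<exists>k. \<forall>x\<in>B i. inv r \<otimes> x \<in> B (max i l) \<longrightarrow> x \<in> V k" if r: "r \<in> carrier G" for r
  proof (cases "\<exists>x\<in>B i. inv r \<otimes> x \<in> B (max i l)")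
    case True
    then obtain x0 where x0: "x0 \<in> B i" "inv r \<otimes> x0 \<in> B (max i l)"
      by blast
    obtain k where "x0 \<in> V k"
      using V_cover x0 by blast
    have "x \<in> V (max k m)" if x: "x \<in> B i" "inv r \<otimes> x \<in> B (max i l)" for x
    proof -
      have "inv x0 \<otimes> x \<in> B (max i l)"
        using x0 x r B_carrier subgroup_inv_mult_sym[OF subgroup_B] subgroup_inv_mult_trans[OF subgroup_B]
        by meson
      then have "inv x0 \<otimes> x \<in> V (max k m)"
        using ml B_antimono[of l "max i l"] V_mono[of m "max k m"] by auto
      then have "x0 \<otimes> (inv x0 \<otimes> x) \<in> V (max k m)"
        using \<open>x0 \<in> V k\<close> V_mono[of k "max k m"] subgroup.m_closed[OF V_subgroup] by auto
      then show ?thesis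
        using x x0 B_carrier by (simp add: inv_mult_cancel)
    qed
    then show ?thesis by blast
  qed blast
  then obtain k where k: "\<And>r x. r \<in> carrier G \<Longrightarrow> x \<in> B i \<Longrightarrow> inv r \<otimes> x \<in> B (max i l) \<Longrightarrow> x \<in> V (k r)"
    by metis
  define M where "M = Max (insert 0 (k ` R))"
  have "x \<in> V M" if x: "x \<in> B i" for x
  proof -
    obtain r where r: "r \<in> R" "inv r \<otimes> x \<in> B (max i l)"
      using R(3) x by blast
    then have "x \<in> V (k r)"
      using k x R(2) by blast
    moreover have "k r \<le> M"
      unfolding M_def using R(1) r(1) by (intro Max_ge) auto
    ultimately show ?thesis
      using V_mono by blast
  qed
  then show ?thesis
    unfolding V_def by (intro exI[of _ M]) (auto simp: ap_of_nat)
qed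

lemma uniformly_contracts_ap: "\<exists>m. \<forall>k\<ge>m. ap (int k) ` B i \<subseteq> B j"
  unfolding ap_of_nat by (rule uniformly_contracts)

section \<open>A filtration that the automorphism shifts\<close>

lemma ap_int_add: "x \<in> carrier G \<Longrightarrow> ap (k + int d) x = ap (int d) (ap k x)"
  by (metis add.commute ap_add)

lemma ap_image_invariant:
  assumes "H \<subseteq> carrier G" "\<alpha> ` H = H" "x \<in> carrier G"
  shows "ap k x \<in> H \<longleftrightarrow> x \<in> H"
proof -
  have step: "\<alpha> x \<in> H \<longleftrightarrow> x \<in> H" if "x \<in> carrier G" for x
    using mem_ap_image[of H "\<alpha> x" 1] ap_cancel(2)[of x 1] that assms by (auto simp del: ap_cancel)
  show ?thesis
  proof (induction k rule: int_induct[where k = 0])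
    case (step1 i)
    then show ?case using step assms(3) by (simp add: ap_Suc)
  next
    case (step2 i)
    then show ?case using step[of "alpha_inv (ap i x)"] assms(3) by (simp add: ap_pred)
  qed simp
qed

text \<open>The largest subset of \<open>B 0\<close> that \<alpha> maps into itself. A ball
  \<open>B j\<close> need not have this invariance.\<close>

definition W :: "'a set" where
  "W = {x \<in> carrier G. \<forall>k. ap (int k) x \<in> B 0}"

text \<open>\<open>F n\<close> is the image of \<open>W\<close> under the n-th power of \<alpha>, so
  \<alpha> raises the index by exactly one (\<open>ap_F\<close>). The index is an integer because
  the groups with negative index exhaust G.\<close>

definition F :: "int \<Rightarrow> 'a set" where
  "F n = {x \<in> carrier G. ap (- n) x \<in> W}"

lemma F_carrier: "x \<in> F n \<Longrightarrow> x \<in> carrier G"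
  by (simp add: F_def)

lemma subgroup_W: "subgroup W G"
proof (rule subgroupI)
  show "W \<noteq> {}"
    using subgroup.one_closed[OF subgroup_B] unfolding W_def by fastforce
qed (auto simp: W_def ap_mult ap_inv subgroup.m_closed[OF subgroup_B]
    subgroup.m_inv_closed[OF subgroup_B])

lemma W_ap: "x \<in> W \<Longrightarrow> ap (int k) x \<in> W"
  unfolding W_def by (auto simp: ap_int_add[symmetric] simp flip: of_nat_add)

lemma subgroup_F: "subgroup (F n) G"
proof (rule subgroupI)
  show "F n \<noteq> {}"
    using subgroup.one_closed[OF subgroup_W] unfolding F_def by fastforce
qed (auto simp: F_def ap_mult ap_inv subgroup.m_closed[OF subgroup_W]
    subgroup.m_inv_closed[OF subgroup_W])

lemma F_antimono:
  assumes "m \<le> n"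
  shows "F n \<subseteq> F m"
proof
  fix x assume x: "x \<in> F n"
  obtain d where "n = m + int d"
    using assms zle_iff_zadd by auto
  then have "ap (- m) x = ap (int d) (ap (- n) x)"
    using ap_int_add[of x "- n" d] F_carrier[OF x] by simp
  then show "x \<in> F m"
    using x W_ap unfolding F_def by simp
qed

lemma ap_F: "x \<in> carrier G \<Longrightarrow> ap k x \<in> F n \<longleftrightarrow> x \<in> F (n - k)"
  unfolding F_def by (simp add: ap_add[symmetric])

lemma F_exhaust:
  assumes "x \<in> carrier G"
  shows "\<exists>k::nat. x \<in> F (- int k)"
proof -
  obtain n where "\<forall>k\<ge>n. ap (int k) x \<in> B 0"
    using contracts[OF assms] by (auto simp: ap_of_nat)
  then have "\<forall>k. ap (int n + int k) x \<in> B 0"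
    by (simp flip: of_nat_add)
  then have "x \<in> F (- int n)"
    using assms by (simp add: F_def W_def ap_int_add)
  then show ?thesis ..
qed

text \<open>An element of \<open>F m\<close> is the image under the m-th power of \<alpha> of an
  element of \<open>B 0\<close>, so uniform contraction of \<open>B 0\<close> provides the
  index.\<close>

lemma F_subset_B: "\<exists>n::nat. F (int n) \<subseteq> B j"
proof -
  obtain m where m: "\<forall>k\<ge>m. ap (int k) ` B 0 \<subseteq> B j"
    using uniformly_contracts_ap by blast
  have "x \<in> B j" if "x \<in> F (int m)" for x
  proof -
    have "ap (- int m) x \<in> B 0"
      using that unfolding F_def W_def by (auto dest: spec[of _ 0])
    then have "ap (int m) (ap (- int m) x) \<in> B j"
      using m by blast
    then show ?thesis
      using F_carrier[OF that] by simp
  qed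
  then show ?thesis by blast
qed

text \<open>Membership in \<open>W\<close> is an infinite condition, but from some time on uniform
  contraction of \<open>B 0\<close> fulfils it; the finitely many earlier times are handled by
  continuity.\<close>

lemma B_subset_W: "\<exists>l. B l \<subseteq> W"
proof -
  obtain m where m: "\<forall>k\<ge>m. ap (int k) ` B 0 \<subseteq> B 0"
    using uniformly_contracts_ap by blast
  have "\<forall>k. \<exists>l. ap (int k) ` B l \<subseteq> B 0"
    using ap_continuous by blast
  then obtain l where l: "\<And>k. ap (int k) ` B (l k) \<subseteq> B 0"
    by metis
  define L where "L = Max (insert 0 (l ` {..<m}))"
  have "ap (int k) x \<in> B 0" if x: "x \<in> B L" for x k
  proof (cases "k < m")
    case True
    then have "l k \<le> L"
      unfolding L_def by (intro Max_ge) auto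
    then show ?thesis
      using x l B_antimono by blast
  next
    case False
    then show ?thesis
      using m x B_antimono[of 0 L] by (auto simp: not_less)
  qed
  then show ?thesis
    unfolding W_def using B_carrier by blast
qed

lemma B_subset_F: "\<exists>j. B j \<subseteq> F n"
proof -
  obtain l where l: "B l \<subseteq> W"
    using B_subset_W by blast
  obtain j where "ap (- n) ` B j \<subseteq> B l"
    using ap_continuous by blast
  then have "B j \<subseteq> F n"
    using l B_carrier unfolding F_def by blast
  then show ?thesis ..
qed

lemma eventually_in_B:
  assumes "x \<in> carrier G"
  shows "\<exists>K. \<forall>k\<ge>K. ap (int k) x \<in> B j"
  using contracts[OF assms] by (auto simp: ap_of_nat)

text \<open>The commutator estimate speaks only of g near the identity. A power of \<alpha> brings g
  there, and since it shifts the groups \<open>F n\<close>, the result can be carried back to the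
  original g.\<close>

lemma F_conj:
  assumes "g \<in> carrier G"
  shows "\<exists>m. \<forall>x\<in>F m. g \<otimes> x \<otimes> inv g \<in> F n"
proof -
  obtain J where J: "\<And>j g x. j \<ge> J \<Longrightarrow> g \<in> B J \<Longrightarrow> x \<in> B j \<Longrightarrow> g \<otimes> x \<otimes> inv g \<otimes> inv x \<in> B j"
    using commutator_B[of 0] by auto
  obtain k where k: "ap (int k) g \<in> B J"
    using eventually_in_B[OF assms] by blast
  obtain j0 where j0: "B j0 \<subseteq> F (n + int k)"
    using B_subset_F by blast
  define j where "j = max j0 J"
  obtain m where m: "F (int m) \<subseteq> B j"
    using F_subset_B by blast
  have "g \<otimes> x \<otimes> inv g \<in> F n" if x: "x \<in> F (int m - int k)" for x
  proof -
    have xc: "x \<in> carrier G"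
      using x F_carrier by blast
    have gc: "ap (int k) g \<in> carrier G" and xc': "ap (int k) x \<in> carrier G"
      using assms xc by auto
    have x': "ap (int k) x \<in> B j"
      using ap_F[OF xc] x m by auto
    have "ap (int k) g \<otimes> ap (int k) x \<otimes> inv (ap (int k) g) \<otimes> inv (ap (int k) x) \<otimes> ap (int k) x \<in> B j"
      using J[OF _ k x'] x' subgroup.m_closed[OF subgroup_B] by (simp add: j_def)
    then have "ap (int k) (g \<otimes> x \<otimes> inv g) \<in> B j"
      using assms xc gc xc' by (simp add: ap_mult ap_inv m_assoc)
    then have "ap (int k) (g \<otimes> x \<otimes> inv g) \<in> F (n + int k)"
      using j0 B_antimono[of j0 j] by (auto simp: j_def)
    then show ?thesis
      using assms xc by (simp add: ap_F)
  qed
  then show ?thesis by blast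
qed

lemma F_separated:
  assumes "\<And>n. x \<in> F n"
  shows "x = \<one>"
proof -
  have "x \<in> B j" for j
    using F_subset_B assms by blast
  then show ?thesis
    using B_limit_separated B_carrier by blast
qed

text \<open>\<open>B_complete\<close> wants the n-th step to lie in \<open>B n\<close>. It is
  applied along a subsequence \<open>t\<close> growing so fast that \<open>F (t n + c)\<close> lies
  in \<open>B n\<close>; as each group \<open>F\<close> contains a ball, the limit obeys the
  original estimates.\<close>

lemma F_complete:
  assumes u: "\<And>n. u n \<in> carrier G" "\<And>n. inv (u n) \<otimes> u (Suc n) \<in> F (int n + c)"
  shows "\<exists>v\<in>carrier G. \<forall>n. inv (u n) \<otimes> v \<in> F (int n + c)"
proof -
  have diff: "inv (u n) \<otimes> u (n + d) \<in> F (int n + c)" for n d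
  proof (induction d)
    case 0
    then show ?case using u subgroup.one_closed[OF subgroup_F] by simp
  next
    case (Suc d)
    have "inv (u (n + d)) \<otimes> u (Suc (n + d)) \<in> F (int n + c)"
      using u(2)[of "n + d"] F_antimono[of "int n + c" "int (n + d) + c"] by auto
    then show ?case
      using subgroup_inv_mult_trans[OF subgroup_F u(1) u(1) u(1) Suc] by simp
  qed
  have "\<exists>t. \<forall>n. (F (int (t n) + c) \<subseteq> B n \<and> n \<le> t n) \<and> t n \<le> t (Suc n)"
  proof (rule dependent_nat_choice)
    have ex: "\<exists>t. F (int t + c) \<subseteq> B n \<and> s \<le> t" for n s
    proof -
      obtain m where m: "F (int m) \<subseteq> B n"
        using F_subset_B by blast
      have "F (int (nat (int m - c) + s) + c) \<subseteq> F (int m)"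
        by (rule F_antimono) linarith
      then show ?thesis
        using m by (intro exI[of _ "nat (int m - c) + s"]) auto
    qed
    show "\<exists>t. F (int t + c) \<subseteq> B 0 \<and> 0 \<le> t"
      using ex by blast
    show "\<exists>t'. (F (int t' + c) \<subseteq> B (Suc n) \<and> Suc n \<le> t') \<and> t \<le> t'" for t n
      using ex[of "Suc n" "max t (Suc n)"] by auto
  qed
  then obtain t where t: "\<And>n. F (int (t n) + c) \<subseteq> B n" "\<And>n. t n \<le> t (Suc n)" "\<And>n. n \<le> t n"
    by blast
  have "inv (u (t n)) \<otimes> u (t (Suc n)) \<in> B n" for n
    using diff[of "t n" "t (Suc n) - t n"] t[of n] by auto
  then obtain v where v: "v \<in> carrier G" "\<And>n. inv (u (t n)) \<otimes> v \<in> B n"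
    using B_complete[of "\<lambda>n. u (t n)"] u(1) by auto
  have "inv (u n) \<otimes> v \<in> F (int n + c)" for n
  proof -
    obtain N where N: "B N \<subseteq> F (int n + c)"
      using B_subset_F by blast
    have lim: "inv (u (t (max N n))) \<otimes> v \<in> F (int n + c)"
      using v(2)[of "max N n"] B_antimono[of N "max N n"] N by auto
    have "n \<le> t (max N n)"
      using t(3)[of "max N n"] by linarith
    then show ?thesis
      using diff[of n "t (max N n) - n"] lim
        subgroup_inv_mult_trans[OF subgroup_F u(1) u(1) v(1)] by auto
  qed
  then show ?thesis
    using v(1) by blast
qed

section \<open>Closures and stable subgroups\<close>

definition F_coset :: "'a \<Rightarrow> 'a set" where
  "F_coset x = {y \<in> carrier G. inv x \<otimes> y \<in> F 1}"

lemma F_coset_eq_iff: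
  assumes "x \<in> carrier G" "y \<in> carrier G"
  shows "F_coset x = F_coset y \<longleftrightarrow> inv x \<otimes> y \<in> F 1"
proof
  assume "F_coset x = F_coset y"
  moreover have "y \<in> F_coset y"
    using assms subgroup.one_closed[OF subgroup_F] by (simp add: F_coset_def)
  ultimately show "inv x \<otimes> y \<in> F 1"
    unfolding F_coset_def by blast
next
  assume "inv x \<otimes> y \<in> F 1"
  then have "inv x \<otimes> z \<in> F 1 \<longleftrightarrow> inv y \<otimes> z \<in> F 1" if "z \<in> carrier G" for z
    using assms that subgroup_inv_mult_trans[OF subgroup_F] subgroup_inv_mult_sym[OF subgroup_F]
    by meson
  then show "F_coset x = F_coset y"
    unfolding F_coset_def by blast
qed

lemma finite_F_coset: "finite (F_coset ` F 0)"
proof -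
  obtain j where j: "B j \<subseteq> F 1"
    using B_subset_F by blast
  obtain R where R: "finite R" "R \<subseteq> carrier G" "\<And>x. x \<in> B 0 \<Longrightarrow> \<exists>r\<in>R. inv r \<otimes> x \<in> B j"
    using B_finite_index[of 0 j] by blast
  have "F_coset ` F 0 \<subseteq> F_coset ` R"
  proof
    fix C assume "C \<in> F_coset ` F 0"
    then obtain x where x: "x \<in> F 0" "C = F_coset x"
      by blast
    then have "x \<in> B 0"
      unfolding F_def W_def by (auto dest: spec[of _ 0])
    then obtain r where "r \<in> R" "inv r \<otimes> x \<in> B j"
      using R(3) by blast
    then show "C \<in> F_coset ` R"
      using x R(2) j F_coset_eq_iff[of r x] F_carrier[OF x(1)] by blast
  qed
  then show ?thesis
    using R(1) finite_subset by blast
qed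

text \<open>Closure with respect to the left cosets of the groups \<open>F n\<close>. The locale has
  no topology yet; \<open>stable_closedin\<close> later shows that stable subgroups are closed in
  the actual one.\<close>

definition cl :: "'a set \<Rightarrow> 'a set" where
  "cl H = {x \<in> carrier G. \<forall>n. \<exists>h\<in>H. inv h \<otimes> x \<in> F n}"

lemma cl_carrier: "cl H \<subseteq> carrier G"
  by (auto simp: cl_def)

lemma cl_mono: "H \<subseteq> K \<Longrightarrow> cl H \<subseteq> cl K"
  unfolding cl_def by blast

lemma subset_cl:
  assumes "H \<subseteq> carrier G"
  shows "H \<subseteq> cl H"
proof
  fix x assume "x \<in> H"
  moreover from this have "inv x \<otimes> x \<in> F n" for n
    using assms subgroup.one_closed[OF subgroup_F] by auto
  ultimately show "x \<in> cl H"
    using assms unfolding cl_def by blast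
qed

lemma cl_cl: 
  assumes "H \<subseteq> carrier G"
  shows "cl (cl H) \<subseteq> cl H"
proof
  fix x assume x: "x \<in> cl (cl H)"
  have "\<exists>h\<in>H. inv h \<otimes> x \<in> F n" for n
  proof -
    obtain y where y: "y \<in> cl H" "inv y \<otimes> x \<in> F n"
      using x unfolding cl_def by blast
    obtain h where h: "h \<in> H" "inv h \<otimes> y \<in> F n"
      using y(1) unfolding cl_def by blast
    have "inv h \<otimes> x \<in> F n"
      by (rule subgroup_inv_mult_trans[OF subgroup_F _ _ _ h(2) y(2)])
        (use h y x assms cl_carrier in auto)
    then show ?thesis using h by blast
  qed
  then show "x \<in> cl H"
    using x unfolding cl_def by blast
qed

text \<open>Approximation is by left cosets, while inversion and multiplication leave the error on
  the wrong side of a group element. Conjugation moves it across, and \<open>F_conj\<close> says how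
  small the error must be beforehand.\<close>

lemma subgroup_cl:
  assumes "subgroup H G"
  shows "subgroup (cl H) G"
proof (rule subgroupI)
  show "cl H \<subseteq> carrier G"
    by (rule cl_carrier)
  show "cl H \<noteq> {}"
    using subset_cl[OF subgroup.subset[OF assms]] subgroup.one_closed[OF assms] by blast
next
  fix x assume x: "x \<in> cl H"
  then have xc: "x \<in> carrier G"
    using cl_carrier by blast
  have "\<exists>h\<in>H. inv h \<otimes> inv x \<in> F n" for n
  proof -
    obtain m where m: "\<forall>z\<in>F m. x \<otimes> z \<otimes> inv x \<in> F n"
      using F_conj[OF xc] by blast
    obtain h where h: "h \<in> H" "inv h \<otimes> x \<in> F m"
      using x unfolding cl_def by blast
    have hc: "h \<in> carrier G"
      using h(1) subgroup.mem_carrier[OF assms] by blast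
    have "x \<otimes> inv (inv h \<otimes> x) \<otimes> inv x \<in> F n"
      using m subgroup.m_inv_closed[OF subgroup_F h(2)] by blast
    then have "inv (inv h) \<otimes> inv x \<in> F n"
      using xc hc by (simp add: group_normalize)
    then show ?thesis
      using h(1) subgroup.m_inv_closed[OF assms] by blast
  qed
  then show "inv x \<in> cl H"
    using xc unfolding cl_def by simp
next
  fix x y assume x: "x \<in> cl H" and y: "y \<in> cl H"
  then have xc: "x \<in> carrier G" and yc: "y \<in> carrier G"
    using cl_carrier by auto
  have "\<exists>h\<in>H. inv h \<otimes> (x \<otimes> y) \<in> F n" for n
  proof -
    obtain h2 where h2: "h2 \<in> H" "inv h2 \<otimes> y \<in> F n"
      using y unfolding cl_def by blast
    have h2c: "h2 \<in> carrier G"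
      using h2(1) subgroup.mem_carrier[OF assms] by blast
    obtain m where m: "\<forall>z\<in>F m. inv h2 \<otimes> z \<otimes> inv (inv h2) \<in> F n"
      using F_conj[of "inv h2"] h2c by blast
    obtain h1 where h1: "h1 \<in> H" "inv h1 \<otimes> x \<in> F m"
      using x unfolding cl_def by blast
    have h1c: "h1 \<in> carrier G"
      using h1(1) subgroup.mem_carrier[OF assms] by blast
    have "inv h2 \<otimes> (inv h1 \<otimes> x) \<otimes> inv (inv h2) \<otimes> (inv h2 \<otimes> y) \<in> F n"
      using m h1 h2 subgroup.m_closed[OF subgroup_F] by blast
    then have "inv (h1 \<otimes> h2) \<otimes> (x \<otimes> y) \<in> F n"
      using xc yc h1c h2c by (simp add: group_normalize)
    then show ?thesis
      using h1(1) h2(1) subgroup.m_closed[OF assms] by blast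
  qed
  then show "x \<otimes> y \<in> cl H"
    using xc yc unfolding cl_def by simp
qed

lemma normal_cl:
  assumes "H \<lhd> G"
  shows "cl H \<lhd> G"
proof (rule normal_invI)
  have H: "subgroup H G"
    using assms normal_imp_subgroup by blast
  show "subgroup (cl H) G"
    using H by (rule subgroup_cl)
  fix g x assume g: "g \<in> carrier G" and x: "x \<in> cl H"
  then have xc: "x \<in> carrier G"
    using cl_carrier by blast
  have "\<exists>h\<in>H. inv h \<otimes> (g \<otimes> x \<otimes> inv g) \<in> F n" for n
  proof -
    obtain m where m: "\<forall>z\<in>F m. g \<otimes> z \<otimes> inv g \<in> F n"
      using F_conj[OF g] by blast
    obtain h where h: "h \<in> H" "inv h \<otimes> x \<in> F m"
      using x unfolding cl_def by blast
    have hc: "h \<in> carrier G"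
      using h(1) subgroup.mem_carrier[OF H] by blast
    have "g \<otimes> (inv h \<otimes> x) \<otimes> inv g \<in> F n"
      using m h by blast
    then have "inv (g \<otimes> h \<otimes> inv g) \<otimes> (g \<otimes> x \<otimes> inv g) \<in> F n"
      using xc hc g by (simp add: group_normalize)
    then show ?thesis
      using h(1) g normal_invE(2)[OF assms] by blast
  qed
  then show "g \<otimes> x \<otimes> inv g \<in> cl H"
    using xc g unfolding cl_def by simp
qed

lemma ap_mem_cl:
  assumes "H \<subseteq> carrier G" "ap k ` H \<subseteq> K" "x \<in> cl H"
  shows "ap k x \<in> cl K"
proof -
  have xc: "x \<in> carrier G"
    using assms cl_carrier by blast
  have "\<exists>h\<in>K. inv h \<otimes> ap k x \<in> F n" for n
  proof -
    obtain h where h: "h \<in> H" "inv h \<otimes> x \<in> F (n - k)"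
      using assms(3) unfolding cl_def by blast
    then have "inv (ap k h) \<otimes> ap k x \<in> F n"
      using assms(1) xc ap_F[of "inv h \<otimes> x" k n] by (auto simp: ap_mult ap_inv)
    then show ?thesis
      using h(1) assms(2) by blast
  qed
  then show ?thesis
    unfolding cl_def using xc by simp
qed

definition stable :: "'a set \<Rightarrow> bool" where
  "stable H \<longleftrightarrow> subgroup H G \<and> cl H \<subseteq> H \<and> \<alpha> ` H = H"

lemma stable_subgroup: "stable H \<Longrightarrow> subgroup H G"
  by (simp add: stable_def)

lemma stable_carrier: "stable H \<Longrightarrow> x \<in> H \<Longrightarrow> x \<in> carrier G"
  by (rule subgroup.mem_carrier[OF stable_subgroup])

lemma stable_ap: "stable H \<Longrightarrow> x \<in> carrier G \<Longrightarrow> ap k x \<in> H \<longleftrightarrow> x \<in> H"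
  by (rule ap_image_invariant) (auto simp: stable_def subgroup.subset)

lemma stable_whole: "stable (carrier G)"
  unfolding stable_def using subgroup_self cl_carrier bij_betw_imp_surj_on[OF bij_alpha] by blast

lemma stable_trivial: "stable {\<one>}"
proof -
  have "x = \<one>" if "x \<in> cl {\<one>}" for x
    using that F_separated[of x] unfolding cl_def by auto
  moreover have "\<alpha> \<one> = \<one>"
    by (metis ap_1 ap_one)
  ultimately show ?thesis
    unfolding stable_def using triv_subgroup by auto
qed

text \<open>Each round approximates x up to an error which the inverse of \<alpha> takes into S
  again. An approximation of this rescaled error is scaled back by \<alpha>, whence the condition
  that \<alpha> maps T into T, and every round improves the precision by one index of
  \<open>F\<close>.\<close>

lemma successive_approximation:
  assumes S: "S \<subseteq> F 0" and T: "subgroup T G" "\<alpha> ` T \<subseteq> T"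
    and step: "\<And>x. x \<in> S \<Longrightarrow> \<exists>y\<in>T. ap (- 1) (inv y \<otimes> x) \<in> S"
    and x: "x \<in> S"
  shows "\<exists>y\<in>T. inv y \<otimes> x \<in> F n"
proof -
  have "\<exists>y\<in>T. inv y \<otimes> x \<in> F (int k)" for k
    using x
  proof (induction k arbitrary: x)
    case 0
    then show ?case
      using S subgroup.one_closed[OF T(1)] F_carrier by (intro bexI[of _ \<one>]) auto
  next
    case (Suc k)
    have xc: "x \<in> carrier G"
      using Suc.prems S F_carrier by blast
    obtain y where y: "y \<in> T" "ap (- 1) (inv y \<otimes> x) \<in> S"
      using step Suc.prems by blast
    obtain y' where y': "y' \<in> T" "inv y' \<otimes> ap (- 1) (inv y \<otimes> x) \<in> F (int k)"
      using Suc.IH[OF y(2)] by blast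
    have c: "y \<in> carrier G" "y' \<in> carrier G"
      using y y' subgroup.mem_carrier[OF T(1)] by auto
    have "ap 1 (inv y' \<otimes> ap (- 1) (inv y \<otimes> x)) = inv (\<alpha> y') \<otimes> (inv y \<otimes> x)"
      using c xc ap_inv_mult[of y' "ap (- 1) (inv y \<otimes> x)" 1] ap_cancel(1)[of "inv y \<otimes> x" 1] by simp
    moreover have "ap 1 (inv y' \<otimes> ap (- 1) (inv y \<otimes> x)) \<in> F (int (Suc k))"
      using y'(2) c xc by (subst ap_F) auto
    ultimately have "inv (y \<otimes> \<alpha> y') \<otimes> x \<in> F (int (Suc k))"
      using c xc by (simp add: inv_mult_group m_assoc)
    moreover have "y \<otimes> \<alpha> y' \<in> T"
      using y(1) y'(1) T by (intro subgroup.m_closed[OF T(1)]) auto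
    ultimately show ?case by blast
  qed
  then obtain y where "y \<in> T" "inv y \<otimes> x \<in> F (int (nat n))"
    by blast
  moreover have "F (int (nat n)) \<subseteq> F n"
    by (rule F_antimono) simp
  ultimately show ?thesis
    by blast
qed

text \<open>For a subgroup H this is the index of \<open>H \<inter> F 1\<close> in
  \<open>H \<inter> F 0\<close>.\<close>

definition iota :: "'a set \<Rightarrow> nat" where
  "iota H = card (F_coset ` (H \<inter> F 0))"

lemma iota_bound: "iota H \<le> card (F_coset ` F 0)"
  unfolding iota_def by (intro card_mono finite_F_coset image_mono) simp

text \<open>Equal counts mean that N meets every coset of \<open>F 1\<close> that
  \<open>M \<inter> F 0\<close> meets, which is the step required by
  \<open>successive_approximation\<close>. As N is closed, it contains
  \<open>M \<inter> F 0\<close>, and powers of \<alpha> carry every element of M into that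
  set.\<close>

lemma stable_eqI:
  assumes N: "stable N" and M: "stable M" and "N \<subseteq> M" and "iota M \<le> iota N"
  shows "M = N"
proof
  have eq: "F_coset ` (N \<inter> F 0) = F_coset ` (M \<inter> F 0)"
  proof (rule card_seteq)
    show "finite (F_coset ` (M \<inter> F 0))"
      by (rule finite_subset[OF _ finite_F_coset]) blast
  qed (use assms in \<open>auto simp: iota_def\<close>)
  have core: "M \<inter> F 0 \<subseteq> N"
  proof
    fix x assume x: "x \<in> M \<inter> F 0"
    have "\<exists>y\<in>N. inv y \<otimes> x \<in> F n" for n
    proof (rule successive_approximation[where S = "M \<inter> F 0"])
      show "subgroup N G" "\<alpha> ` N \<subseteq> N"
        using N by (auto simp: stable_def)
      fix x assume x: "x \<in> M \<inter> F 0"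
      have "F_coset x \<in> F_coset ` (N \<inter> F 0)"
        using x eq by blast
      then obtain y where y: "y \<in> N" "F_coset y = F_coset x"
        by force
      have c: "x \<in> carrier G" "y \<in> carrier G"
        using x y F_carrier stable_carrier[OF N] by auto
      have "inv y \<otimes> x \<in> F 1"
        using y c F_coset_eq_iff by blast
      moreover have "inv y \<otimes> x \<in> M"
        using x y \<open>N \<subseteq> M\<close> by (intro subgroup_inv_mult stable_subgroup[OF M]) auto
      ultimately have "ap (- 1) (inv y \<otimes> x) \<in> M \<inter> F 0"
        using c stable_ap[OF M] ap_F[of "inv y \<otimes> x" "- 1" 0] by simp
      then show "\<exists>y\<in>N. ap (- 1) (inv y \<otimes> x) \<in> M \<inter> F 0"
        using y by blast
    qed (use x in auto)
    then have "x \<in> cl N"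
      using x F_carrier unfolding cl_def by blast
    then show "x \<in> N"
      using N by (auto simp: stable_def)
  qed
  show "M \<subseteq> N"
  proof
    fix x assume x: "x \<in> M"
    then have xc: "x \<in> carrier G"
      using stable_carrier[OF M] by blast
    obtain k where "x \<in> F (- int k)"
      using F_exhaust[OF xc] by blast
    then have "ap (int k) x \<in> M \<inter> F 0"
      using x xc stable_ap[OF M] by (simp add: ap_F)
    then show "x \<in> N"
      using core stable_ap[OF N xc] by blast
  qed
qed fact

text \<open>Since \<open>F 0\<close> meets only finitely many cosets of \<open>F 1\<close>, the increasing union of the
  preimages of \<open>Y\<close> under the iterates of \<open>\<alpha>\<close> becomes stationary near the identity, up to closure.\<close>

lemma closure_of_preimages:
  fixes Y :: "'a set"
  defines "U \<equiv> \<lambda>k::nat. {x \<in> carrier G. ap (int k) x \<in> Y}"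
  assumes Y: "subgroup Y G" "\<alpha> ` Y \<subseteq> Y"
  shows "subgroup (U k) G" and "k \<le> l \<Longrightarrow> U k \<subseteq> U l" and "subgroup (\<Union>k. U k) G"
    and "stable (cl (\<Union>k. U k))"
    and "\<exists>k. \<forall>x\<in>cl (\<Union>k. U k) \<inter> F 0. \<forall>n. \<exists>y\<in>U k. inv y \<otimes> x \<in> F n"
proof -
  have sub: "subgroup (U k) G" for k
  proof (rule subgroupI)
    show "U k \<noteq> {}"
      using subgroup.one_closed[OF Y(1)] unfolding U_def by fastforce
  qed (auto simp: U_def ap_mult ap_inv subgroup.m_closed[OF Y(1)] subgroup.m_inv_closed[OF Y(1)])
  then show "subgroup (U k) G" .
  have mono: "U k \<subseteq> U l" if "k \<le> l" for k l
  proof (rule lift_Suc_mono_le[OF _ that])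
    show "U n \<subseteq> U (Suc n)" for n
      unfolding U_def ap_of_nat using Y(2) by auto
  qed
  then show "k \<le> l \<Longrightarrow> U k \<subseteq> U l" .
  have U_carrier: "U k \<subseteq> carrier G" for k
    unfolding U_def by blast
  have ap_U: "ap 1 x \<in> U k \<longleftrightarrow> x \<in> U (Suc k)" if "x \<in> carrier G" for x k
    unfolding U_def using that ap_add[of x "int k" 1] by (simp add: add.commute)
  have U_alpha: "\<alpha> ` U k \<subseteq> U k" for k
  proof (rule image_subsetI)
    fix x assume "x \<in> U k"
    then have "x \<in> U (Suc k)" "x \<in> carrier G"
      using mono[of k "Suc k"] U_carrier[of k] by auto
    then show "\<alpha> x \<in> U k"
      using ap_U by simp
  qed
  show Un: "subgroup (\<Union>k. U k) G"
  proof (rule subgroupI)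
    fix a b assume "a \<in> (\<Union>k. U k)" "b \<in> (\<Union>k. U k)"
    then obtain k l where "a \<in> U k" "b \<in> U l"
      by blast
    then have "a \<in> U (max k l)" "b \<in> U (max k l)"
      using mono[of k "max k l"] mono[of l "max k l"] by auto
    then have "a \<otimes> b \<in> U (max k l)"
      by (rule subgroup.m_closed[OF sub])
    then show "a \<otimes> b \<in> (\<Union>k. U k)"
      by (rule UN_I[OF UNIV_I])
  next
    fix a assume "a \<in> (\<Union>k. U k)"
    then obtain k where "a \<in> U k"
      by blast
    then have "inv a \<in> U k"
      by (rule subgroup.m_inv_closed[OF sub])
    then show "inv a \<in> (\<Union>k. U k)"
      by (rule UN_I[OF UNIV_I])
  next
    show "(\<Union>k. U k) \<noteq> {}"
      using subgroup.one_closed[OF sub[of 0]] by blast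
  qed (use U_carrier in blast)
  have ap_Un: "ap 1 ` (\<Union>k. U k) \<subseteq> (\<Union>k. U k)" "ap (- 1) ` (\<Union>k. U k) \<subseteq> (\<Union>k. U k)"
  proof -
    show "ap 1 ` (\<Union>k. U k) \<subseteq> (\<Union>k. U k)"
      using U_alpha by auto
    have "ap (- 1) x \<in> U (Suc k)" if "x \<in> U k" for x k
      using ap_U[of "ap (- 1) x" k] that subsetD[OF U_carrier that] ap_cancel(1)[of x 1] by simp
    then show "ap (- 1) ` (\<Union>k. U k) \<subseteq> (\<Union>k. U k)"
      by blast
  qed
  have Un_carrier: "(\<Union>k. U k) \<subseteq> carrier G"
    using U_carrier by blast
  show st: "stable (cl (\<Union>k. U k))"
    unfolding stable_def
  proof (intro conjI subgroup_cl Un cl_cl Un_carrier equalityI subsetI)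
    show "y \<in> cl (\<Union>k. U k)" if "y \<in> \<alpha> ` cl (\<Union>k. U k)" for y
      using that ap_mem_cl[OF Un_carrier ap_Un(1)] by auto
    show "y \<in> \<alpha> ` cl (\<Union>k. U k)" if y: "y \<in> cl (\<Union>k. U k)" for y
    proof -
      have "ap (- 1) y \<in> cl (\<Union>k. U k)"
        using ap_mem_cl[OF Un_carrier ap_Un(2) y] .
      moreover have "y = \<alpha> (ap (- 1) y)"
        using ap_cancel(1)[of y 1] subsetD[OF cl_carrier y] by simp
      ultimately show ?thesis by blast
    qed
  qed
  have "\<exists>k0. \<forall>k. F_coset ` (U k \<inter> F 0) \<subseteq> F_coset ` (U k0 \<inter> F 0)"
  proof -
    have fin: "finite (F_coset ` (U k \<inter> F 0))" for k
      by (rule finite_subset[OF _ finite_F_coset]) blast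
    define c where "c k = card (F_coset ` (U k \<inter> F 0))" for k
    have "c k \<le> card (F_coset ` F 0)" for k
      unfolding c_def by (intro card_mono finite_F_coset) blast
    then have "\<exists>k0. \<forall>k. c k \<le> c k0"
      using ex_has_greatest_nat[of "\<lambda>_. True" _ c "Suc (card (F_coset ` F 0))"]
      by (auto simp: less_Suc_eq_le)
    then obtain k0 where k0: "\<And>k. c k \<le> c k0"
      by blast
    have "F_coset ` (U k \<inter> F 0) \<subseteq> F_coset ` (U k0 \<inter> F 0)" for k
    proof -
      have "F_coset ` (U k0 \<inter> F 0) = F_coset ` (U (max k k0) \<inter> F 0)"
        by (rule card_seteq[OF fin]) (use k0[of "max k k0"] mono[of k0 "max k k0"] in \<open>auto simp: c_def\<close>)
      then show ?thesis
        using mono[of k "max k k0"] by auto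
    qed
    then show ?thesis by blast
  qed
  then obtain k0 where k0: "\<And>k. F_coset ` (U k \<inter> F 0) \<subseteq> F_coset ` (U k0 \<inter> F 0)"
    by blast
  \<comment> \<open>No \<open>U k\<close> meets a coset of \<open>F 1\<close> within
    \<open>F 0\<close> that \<open>U k0\<close> does not meet, so elements of \<open>U k0\<close>
    serve for the approximation step on the whole union, and hence for every precision.\<close>
  have approx: "\<exists>y\<in>U k0. inv y \<otimes> x \<in> F n" if x: "x \<in> (\<Union>k. U k) \<inter> F 0" for x n
  proof (rule successive_approximation[OF _ sub U_alpha _ x])
    fix x assume x: "x \<in> (\<Union>k. U k) \<inter> F 0"
    then obtain y where y: "y \<in> U k0" "F_coset y = F_coset x"
      using k0 by force
    have c: "x \<in> carrier G" "y \<in> carrier G"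
      using x y U_carrier F_carrier by auto
    have "inv y \<otimes> x \<in> F 1"
      using y c F_coset_eq_iff by blast
    then have "ap (- 1) (inv y \<otimes> x) \<in> F 0"
      using c by (simp add: ap_F)
    moreover have "inv y \<otimes> x \<in> (\<Union>k. U k)"
      using x y by (intro subgroup_inv_mult[OF Un]) auto
    then have "ap (- 1) (inv y \<otimes> x) \<in> (\<Union>k. U k)"
      by (rule subsetD[OF ap_Un(2) imageI])
    ultimately have "ap (- 1) (inv y \<otimes> x) \<in> (\<Union>k. U k) \<inter> F 0"
      by blast
    then show "\<exists>y\<in>U k0. ap (- 1) (inv y \<otimes> x) \<in> (\<Union>k. U k) \<inter> F 0"
      using y by blast
  qed auto
  have approx_cl: "\<exists>y\<in>U k0. inv y \<otimes> x \<in> F n" if x: "x \<in> cl (\<Union>k. U k)" "x \<in> F 0" for x n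
  proof -
    \<comment> \<open>Precision at least \<open>F 0\<close> forces h itself into \<open>F 0\<close>,
      where \<open>approx\<close> applies.\<close>
    obtain h where h: "h \<in> (\<Union>k. U k)" "inv h \<otimes> x \<in> F (max n 0)"
      using x unfolding cl_def by blast
    have c: "x \<in> carrier G" "h \<in> carrier G"
      using x h U_carrier F_carrier by auto
    have hx: "inv h \<otimes> x \<in> F n" "inv h \<otimes> x \<in> F 0"
      using h(2) F_antimono[of n "max n 0"] F_antimono[of 0 "max n 0"] by auto
    have "x \<otimes> inv (inv h \<otimes> x) \<in> F 0"
      by (rule subgroup.m_closed[OF subgroup_F x(2) subgroup.m_inv_closed[OF subgroup_F hx(2)]])
    then have "h \<in> F 0"
      using c by (simp add: group_normalize)
    then obtain y where y: "y \<in> U k0" "inv y \<otimes> h \<in> F n"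
      using approx h by blast
    then show ?thesis
      using c hx subgroup_inv_mult_trans[OF subgroup_F _ c(2) c(1)] U_carrier by blast
  qed
  then show "\<exists>k. \<forall>x\<in>cl (\<Union>k. U k) \<inter> F 0. \<forall>n. \<exists>y\<in>U k. inv y \<otimes> x \<in> F n"
    by blast
qed

subsection \<open>Minimal closed stable normal subgroups\<close>

definition minimal_over :: "'a set \<Rightarrow> 'a set \<Rightarrow> bool" where
  "minimal_over N M \<longleftrightarrow> stable M \<and> M \<lhd> G \<and> N \<subset> M \<and>
     (\<forall>H. stable H \<longrightarrow> H \<lhd> G \<longrightarrow> N \<subset> H \<longrightarrow> H \<subseteq> M \<longrightarrow> H = M)"

text \<open>Invariance of Y under conjugation by \<open>F 0\<close> is enough: every g is carried
  into \<open>F 0\<close> by a power of \<alpha>, so the union of the preimages of Y is normal in G.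
  By minimality its closure is M, and \<open>closure_of_preimages\<close> then provides one k for
  all of \<open>M \<inter> F 0\<close>.\<close>

lemma minimal_over_uniform_approx:
  assumes N: "stable N" "N \<lhd> G" and M: "minimal_over N M"
    and Y: "subgroup Y G" "\<alpha> ` Y \<subseteq> Y" "N \<subseteq> Y" "Y \<subseteq> M" "\<not> Y \<subseteq> N"
    and conj: "\<And>g y. g \<in> F 0 \<Longrightarrow> y \<in> Y \<Longrightarrow> g \<otimes> y \<otimes> inv g \<in> Y"
  shows "\<exists>k::nat. \<forall>x\<in>M \<inter> F 0. \<forall>n. \<exists>z\<in>carrier G. ap (int k) z \<in> Y \<and> inv z \<otimes> x \<in> F n"
proof -
  define U where "U k = {x \<in> carrier G. ap (int k) x \<in> Y}" for k :: nat
  note U = closure_of_preimages[OF Y(1,2), folded U_def]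
  have stM: "stable M"
    using M by (simp add: minimal_over_def)
  have "(\<Union>k. U k) \<lhd> G"
  proof (rule normal_invI[OF U(3)])
    fix g h assume g: "g \<in> carrier G" and "h \<in> (\<Union>k. U k)"
    then obtain k where k: "h \<in> U k"
      by blast
    obtain l where l: "g \<in> F (- int l)"
      using F_exhaust[OF g] by blast
    define m where "m = max k l"
    have h: "h \<in> carrier G" "ap (int m) h \<in> Y"
      using U(2)[of k m] k by (auto simp: m_def U_def)
    have "F (- int l) \<subseteq> F (- int m)"
      by (rule F_antimono) (simp add: m_def)
    then have "ap (int m) g \<in> F 0"
      using g l ap_F[of g "int m" 0] by auto
    then have "ap (int m) (g \<otimes> h \<otimes> inv g) \<in> Y"
      using conj[OF _ h(2)] g h(1) by (simp add: ap_mult ap_inv)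
    then show "g \<otimes> h \<otimes> inv g \<in> (\<Union>k. U k)"
      using g h(1) unfolding U_def by blast
  qed
  then have normal: "cl (\<Union>k. U k) \<lhd> G"
    by (rule normal_cl)
  have "U 0 \<subseteq> (\<Union>k. U k)" "(\<Union>k. U k) \<subseteq> cl (\<Union>k. U k)"
    using subset_cl[OF subgroup.subset[OF U(3)]] by auto
  moreover have "U 0 = Y"
    using subgroup.subset[OF Y(1)] by (auto simp: U_def)
  ultimately have "Y \<subseteq> cl (\<Union>k. U k)"
    by blast
  then have "N \<subset> cl (\<Union>k. U k)"
    using Y(3,5) by blast
  moreover have "cl (\<Union>k. U k) \<subseteq> M"
  proof -
    have "(\<Union>k. U k) \<subseteq> M"
      using stable_ap[OF stM] Y(4) unfolding U_def by blast
    then show ?thesis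
      using cl_mono[of "\<Union>k. U k" M] stM unfolding stable_def by blast
  qed
  ultimately have "cl (\<Union>k. U k) = M"
    using M U(4) normal unfolding minimal_over_def by blast
  then obtain k where k: "\<And>x n. x \<in> M \<inter> F 0 \<Longrightarrow> \<exists>y\<in>U k. inv y \<otimes> x \<in> F n"
    using U(5) by metis
  have "\<exists>z\<in>carrier G. ap (int k) z \<in> Y \<and> inv z \<otimes> x \<in> F n" if "x \<in> M \<inter> F 0" for x n
    using k[OF that] unfolding U_def by blast
  then show ?thesis by blast
qed

text \<open>Moving x into \<open>F 0\<close> by the l-th power of \<alpha> removes the restriction
  to \<open>F 0\<close>, at the price of a bound \<open>k + l\<close> that depends on x.\<close>

lemma minimal_over_approx:
  assumes N: "stable N" "N \<lhd> G" and M: "minimal_over N M"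
    and Y: "subgroup Y G" "\<alpha> ` Y \<subseteq> Y" "N \<subseteq> Y" "Y \<subseteq> M" "\<not> Y \<subseteq> N"
    and conj: "\<And>g y. g \<in> F 0 \<Longrightarrow> y \<in> Y \<Longrightarrow> g \<otimes> y \<otimes> inv g \<in> Y"
    and x: "x \<in> M"
  shows "\<exists>k::nat. \<forall>n. \<exists>z\<in>carrier G. ap (int k) z \<in> Y \<and> inv z \<otimes> x \<in> F n"
proof -
  have stM: "stable M"
    using M by (simp add: minimal_over_def)
  have xc: "x \<in> carrier G"
    using x stable_carrier[OF stM] by blast
  obtain k where k: "\<And>x n. x \<in> M \<inter> F 0 \<Longrightarrow>
      \<exists>z\<in>carrier G. ap (int k) z \<in> Y \<and> inv z \<otimes> x \<in> F n"
    using minimal_over_uniform_approx[OF N M Y conj] by blast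
  obtain l where "x \<in> F (- int l)"
    using F_exhaust[OF xc] by blast
  then have l: "ap (int l) x \<in> M \<inter> F 0"
    using xc stable_ap[OF stM] x by (simp add: ap_F)
  have "\<exists>z\<in>carrier G. ap (int (k + l)) z \<in> Y \<and> inv z \<otimes> x \<in> F n" for n
  proof -
    obtain y where y: "y \<in> carrier G" "ap (int k) y \<in> Y" "inv y \<otimes> ap (int l) x \<in> F (n + int l)"
      using k[OF l] by blast
    have "ap (int l) (inv (ap (- int l) y) \<otimes> x) \<in> F (n + int l)"
      using y xc by (simp add: ap_mult ap_inv)
    then have "inv (ap (- int l) y) \<otimes> x \<in> F n"
      using y(1) xc by (simp add: ap_F)
    moreover have "ap (int (k + l)) (ap (- int l) y) \<in> Y"
      using y by (simp add: ap_add[symmetric])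
    ultimately show ?thesis
      using y(1) ap_closed by blast
  qed
  then show ?thesis by blast
qed

section \<open>Comparing distances to a normal subgroup\<close>

lemma subgroup_product_B: "N \<lhd> G \<Longrightarrow> subgroup (N <#> B j) G"
  by (rule mult_norm_subgroup[OF _ subgroup_B])

lemma product_B_antimono: "i \<le> j \<Longrightarrow> N <#> B j \<subseteq> N <#> B i"
  using B_antimono[of i j] unfolding set_mult_def by blast

lemma subset_product_B:
  assumes "subgroup N G"
  shows "N \<subseteq> N <#> B j" "B j \<subseteq> N <#> B j"
proof -
  show "N \<subseteq> N <#> B j"
  proof
    fix x assume x: "x \<in> N"
    then have "x = x \<otimes> \<one>"
      using subgroup.mem_carrier[OF assms] by simp
    then show "x \<in> N <#> B j"
      using x subgroup.one_closed[OF subgroup_B] unfolding set_mult_def by blast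
  qed
  show "B j \<subseteq> N <#> B j"
  proof
    fix x assume x: "x \<in> B j"
    then have "x = \<one> \<otimes> x"
      using B_carrier by simp
    then show "x \<in> N <#> B j"
      using x subgroup.one_closed[OF assms] unfolding set_mult_def by blast
  qed
qed

text \<open>The groups \<open>N <#> B j\<close> measure the distance to N: a factorization
  \<open>u \<otimes> b\<close> exhibits u in N as an approximation of x, so closedness of N
  decides.\<close>

lemma stable_eq_Inter_product_B:
  assumes N: "stable N" and x: "\<And>j. x \<in> N <#> B j"
  shows "x \<in> N"
proof -
  have "\<exists>h\<in>N. inv h \<otimes> x \<in> F n" for n
  proof -
    obtain j where j: "B j \<subseteq> F n"
      using B_subset_F by blast
    obtain u b where ub: "u \<in> N" "b \<in> B j" "x = u \<otimes> b"
      using x[of j] unfolding set_mult_def by blast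
    then have "inv u \<otimes> x = b"
      using stable_carrier[OF N] B_carrier by (simp add: inv_mult_cancel)
    then show ?thesis
      using ub j by blast
  qed
  moreover have "x \<in> carrier G"
    using x[of 0] stable_carrier[OF N] B_carrier unfolding set_mult_def by blast
  ultimately have "x \<in> cl N"
    unfolding cl_def by blast
  then show ?thesis
    using N by (auto simp: stable_def)
qed

text \<open>If the orbit of \<open>y\<close> tends to \<open>N\<close> infinitely faster than the orbit of \<open>x\<close>, then the closed stable
  normal subgroup generated by \<open>y\<close> and \<open>N\<close> does not contain \<open>x\<close>. To see this, compare the two
  orbits at a time after which the orbit of \<open>x\<close> never gets farther away from \<open>N\<close>.\<close>

lemma infinitely_smaller_mem:
  assumes N: "stable N" "N \<lhd> G" and M: "minimal_over N M"
    and x: "x \<in> M" "x \<notin> N" and y: "y \<in> M"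
    and small: "\<And>m. \<exists>K. \<forall>k\<ge>K. \<forall>j\<ge>K. ap (int k) x \<in> N <#> B j \<longrightarrow> ap (int k) y \<in> N <#> B (j + m)"
  shows "y \<in> N"
proof (rule ccontr)
  assume "y \<notin> N"
  have stM: "stable M" and normM: "M \<lhd> G" and NM: "N \<subseteq> M"
    using M by (auto simp: minimal_over_def)
  have Nsub: "subgroup N G" and Msub: "subgroup M G"
    using N stM by (auto simp: stable_def)
  have xc: "x \<in> carrier G" and yc: "y \<in> carrier G"
    using x y stable_carrier[OF stM] by auto
  \<comment> \<open>Only forward images of y and conjugators from \<open>F 0\<close> occur. \<alpha>
    preserves both restrictions, so it maps Y into itself, and late images of Y involve only late
    images of y, conjugators near the identity, and N.\<close>
  define C where "C = {g \<otimes> ap (int k) y \<otimes> inv g | g k. g \<in> F 0}"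
  define Y where "Y = generate G (C \<union> N)"
  have C_carrier: "C \<subseteq> carrier G"
    unfolding C_def using yc F_carrier by auto
  have CN: "C \<union> N \<subseteq> carrier G"
    using C_carrier subgroup.subset[OF Nsub] by blast
  have Y_sub: "subgroup Y G"
    unfolding Y_def by (rule generate_is_subgroup[OF CN])
  have generate_img: "h ` Y \<subseteq> Z" 
    if "group_hom G G h" "subgroup Z G" "h ` (C \<union> N) \<subseteq> Z" for h Z
    unfolding Y_def group_hom.generate_img[OF that(1) CN, symmetric]
    by (rule generate_subgroup_incl[OF that(3,2)])
  have N_Y: "N \<subseteq> Y" and C_Y: "C \<subseteq> Y"
    unfolding Y_def using generate.incl[of _ "C \<union> N" G] by auto
  have Y_alpha: "\<alpha> ` Y \<subseteq> Y"
  proof -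
    have "\<alpha> z \<in> C" if "z \<in> C" for z
    proof -
      obtain g k where gk: "z = g \<otimes> ap (int k) y \<otimes> inv g" "g \<in> F 0"
        using \<open>z \<in> C\<close> unfolding C_def by blast
      have g: "g \<in> carrier G"
        using gk F_carrier by blast
      have "\<alpha> g \<in> F 0"
        using ap_F[OF g, of 1 0] gk(2) F_antimono[of "- 1" 0] by auto
      moreover have "\<alpha> z = \<alpha> g \<otimes> ap (int (Suc k)) y \<otimes> inv (\<alpha> g)"
        using gk g yc ap_mult[of _ _ 1] ap_inv[of g 1] ap_Suc[OF yc, of "int k"]
        by (simp add: add.commute)
      ultimately show ?thesis
        unfolding C_def by blast
    qed
    moreover have "\<alpha> ` N = N"
      using N by (simp add: stable_def)
    ultimately have "ap 1 ` (C \<union> N) \<subseteq> Y"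
      using C_Y N_Y by auto
    then show ?thesis
      using generate_img[OF group_hom_ap[of 1] Y_sub] by auto
  qed
  have Y_M: "Y \<subseteq> M"
  proof -
    have "C \<subseteq> M"
      unfolding C_def using y stable_ap[OF stM yc] normal_invE(2)[OF normM] F_carrier by auto
    then show ?thesis
      unfolding Y_def using NM by (intro generate_subgroup_incl[OF _ Msub]) auto
  qed
  have "y \<in> C"
    unfolding C_def using yc subgroup.one_closed[OF subgroup_F]
    by (auto intro!: exI[of _ "\<one>"] exI[of _ "0::nat"])
  then have Y_N: "\<not> Y \<subseteq> N"
    using C_Y \<open>y \<notin> N\<close> by blast
  have conj: "g \<otimes> z \<otimes> inv g \<in> Y" if g: "g \<in> F 0" and z: "z \<in> Y" for g z
  proof -
    have gc: "g \<in> carrier G"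
      using g F_carrier by blast
    have hom: "group_hom G G (\<lambda>z. g \<otimes> z \<otimes> inv g)"
      by (intro group_hom.intro group_hom_axioms.intro homI is_group) 
        (use gc in \<open>simp_all add: group_normalize\<close>)
    have "g \<otimes> c \<otimes> inv g \<in> C" if "c \<in> C" for c
    proof -
      obtain g' k where gk: "c = g' \<otimes> ap (int k) y \<otimes> inv g'" "g' \<in> F 0"
        using \<open>c \<in> C\<close> unfolding C_def by blast
      have "g \<otimes> g' \<in> F 0"
        using g gk(2) by (rule subgroup.m_closed[OF subgroup_F])
      moreover have "g \<otimes> c \<otimes> inv g = g \<otimes> g' \<otimes> ap (int k) y \<otimes> inv (g \<otimes> g')"
        using gk gc yc F_carrier[of g'] by (simp add: group_normalize)
      ultimately show ?thesis
        unfolding C_def by blast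
    qed
    moreover have "g \<otimes> c \<otimes> inv g \<in> N" if "c \<in> N" for c
      using normal_invE(2)[OF N(2) gc that] .
    ultimately have "(\<lambda>z. g \<otimes> z \<otimes> inv g) ` (C \<union> N) \<subseteq> Y"
      using C_Y N_Y by auto
    then show ?thesis
      using generate_img[OF hom Y_sub] z by blast
  qed
  obtain k1 where k1: "\<And>n. \<exists>z\<in>carrier G. ap (int k1) z \<in> Y \<and> inv z \<otimes> x \<in> F n"
    using minimal_over_approx[OF N M Y_sub Y_alpha N_Y Y_M Y_N conj x(1)] by blast
  \<comment> \<open>\<open>e i\<close> is the first level j at which x at time i is no longer in
    \<open>N <#> B j\<close>; large values mean closeness to N.\<close>
  define e where "e i = (LEAST j. ap (int i) x \<notin> N <#> B j)" for i
  have e_iff: "ap (int i) x \<in> N <#> B j \<longleftrightarrow> j < e i" for i j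
  proof -
    have "ap (int i) x \<notin> N"
      using x(2) stable_ap[OF N(1) xc] by simp
    then have "\<exists>j. ap (int i) x \<notin> N <#> B j"
      using stable_eq_Inter_product_B[OF N(1)] by blast
    then have e: "ap (int i) x \<notin> N <#> B (e i)"
      unfolding e_def by (rule LeastI_ex)
    show ?thesis
    proof
      assume "ap (int i) x \<in> N <#> B j"
      then show "j < e i"
        using e product_B_antimono[of "e i" j N] by (meson not_less subsetD)
    next
      assume "j < e i"
      then show "ap (int i) x \<in> N <#> B j"
        unfolding e_def using not_less_Least by blast
    qed
  qed
  have e_limit: "\<exists>I. \<forall>i\<ge>I. j < e i" for j
    using eventually_in_B[OF xc, of j] subset_product_B(2)[OF Nsub, of j] e_iff by blast
  obtain c Jc where c: "\<And>j. j \<ge> Jc \<Longrightarrow> B (j + c) \<subseteq> \<alpha> ` B j"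
    using expansion_bound by blast
  \<comment> \<open>One application of \<alpha> brings the orbit closer to N by at most c levels: a
    factorization of the image is pulled back through \<alpha> with
    \<open>expansion_bound\<close>.\<close>
  have e_step: "j < e i" if "Jc \<le> j" "j + c < e (Suc i)" for i j
  proof -
    have "ap (int (Suc i)) x \<in> N <#> B (j + c)"
      using that e_iff by blast
    then obtain u b where ub: "u \<in> N" "b \<in> B (j + c)" "ap (int (Suc i)) x = u \<otimes> b"
      unfolding set_mult_def by blast
    obtain b' where b': "b' \<in> B j" "b = \<alpha> b'"
      using c[OF \<open>Jc \<le> j\<close>] ub(2) by blast
    have "u \<in> \<alpha> ` N"
      using N(1) ub(1) by (simp add: stable_def)
    then obtain u' where u': "u' \<in> N" "u = \<alpha> u'"
      by blast
    have cc: "u' \<in> carrier G" "b' \<in> carrier G"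
      using u' b' stable_carrier[OF N(1)] B_carrier by auto
    have "\<alpha> (ap (int i) x) = \<alpha> (u' \<otimes> b')"
      using ub(3) b' u' cc ap_Suc[OF xc, of "int i"] by (simp add: alpha_mult add.commute)
    then have "ap (int i) x = u' \<otimes> b'"
      using cc xc by (metis alpha_inv_alpha ap_closed m_closed)
    then have "ap (int i) x \<in> N <#> B j"
      using u' b' unfolding set_mult_def by blast
    then show ?thesis
      using e_iff by blast
  qed
  have e_steps: "j < e i" if "Jc \<le> j" "j + c * t < e (i + t)" for i j t
    using that
  proof (induction t arbitrary: j)
    case (Suc t)
    have "j + c * t < e (i + t)"
      by (rule e_step) (use Suc.prems in \<open>auto simp: algebra_simps\<close>)
    then show ?case
      using Suc by blast
  qed simp
  \<comment> \<open>Going back k1 steps costs at most \<open>c * k1\<close> levels; one more level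
    makes the comparison with \<open>e i\<close> strict.\<close>
  define m where "m = c * k1 + 1"
  obtain K where K: "\<And>k j. k \<ge> K \<Longrightarrow> j \<ge> K \<Longrightarrow> ap (int k) x \<in> N <#> B j \<Longrightarrow> ap (int k) y \<in> N <#> B (j + m)"
    using small by blast
  obtain J0 where J0: "\<And>j g z. j \<ge> J0 \<Longrightarrow> g \<in> B J0 \<Longrightarrow> z \<in> B j \<Longrightarrow> g \<otimes> z \<otimes> inv g \<otimes> inv z \<in> B j"
    using commutator_B[of 0] by auto
  obtain n0 where n0: "F (int n0) \<subseteq> B J0"
    using F_subset_B by blast
  obtain I1 where I1: "\<And>i. i \<ge> I1 \<Longrightarrow> max Jc (max J0 K) + m < e i"
    using e_limit by blast
  \<comment> \<open>For i from I on, the values of e are large, all times from \<open>i - k1\<close>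
    on are at least K, and the power \<open>i - k1\<close> of \<alpha> maps \<open>F 0\<close> into
    \<open>B J0\<close>.\<close>
  define I where "I = Max {I1, K + k1, n0 + k1}"
  have I: "I1 \<le> I" "K + k1 \<le> I" "n0 + k1 \<le> I"
    unfolding I_def by auto
  \<comment> \<open>Among all times from I on, the orbit of x is farthest from N at time i.\<close>
  obtain i where i: "I \<le> i" "\<And>k. k \<ge> I \<Longrightarrow> e i \<le> e k"
    using ex_has_least_nat[of "\<lambda>k. k \<ge> I" I e] by blast
  define j where "j = e i - m"
  have j: "j + m = e i" "Jc \<le> j" "J0 \<le> j" "K \<le> j"
    using I1[of i] I i unfolding j_def by auto
  \<comment> \<open>From time i on this rests on the minimality of \<open>e i\<close>; at the at
    most k1 earlier times e is smaller by at most \<open>c * k1\<close>. In both cases x is in level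
    \<open>e i - m\<close>, and y gains the missing m levels.\<close>
  have y_small: "ap (int k) y \<in> N <#> B (e i)" if "i - k1 \<le> k" for k
  proof -
    have "j < e k"
    proof (cases "i \<le> k")
      case True
      then show ?thesis
        using i(2)[of k] i(1) j unfolding m_def by simp
    next
      case False
      have "j + c * (i - k) \<le> j + c * k1"
        by (intro add_left_mono mult_le_mono2) (use that in linarith)
      also have "\<dots> < e i"
        using j(1) unfolding m_def by simp
      also have "e i = e (k + (i - k))"
        using False by simp
      finally have "j + c * (i - k) < e (k + (i - k))" .
      then show ?thesis
        using e_steps[OF j(2)] by blast
    qed
    then show ?thesis
      using K[of k j] that I i j e_iff by simp
  qed
  have Nj: "subgroup (N <#> B (e i)) G"
    by (rule subgroup_product_B[OF N(2)])
  have conj_B: "g \<otimes> z \<otimes> inv g \<in> N <#> B (e i)" if g: "g \<in> B J0" and z: "z \<in> N <#> B (e i)" for g z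
  proof -
    obtain u b where ub: "u \<in> N" "b \<in> B (e i)" "z = u \<otimes> b"
      using z unfolding set_mult_def by blast
    have cc: "g \<in> carrier G" "u \<in> carrier G" "b \<in> carrier G"
      using g ub stable_carrier[OF N(1)] B_carrier by auto
    have "g \<otimes> b \<otimes> inv g \<otimes> inv b \<otimes> b \<in> B (e i)"
      using J0[OF _ g ub(2)] j ub(2) by (intro subgroup.m_closed[OF subgroup_B, of _ _ b]) auto
    then have "g \<otimes> b \<otimes> inv g \<in> B (e i)"
      using cc by (simp add: m_assoc)
    moreover have "g \<otimes> u \<otimes> inv g \<in> N"
      using normal_invE(2)[OF N(2) cc(1) ub(1)] .
    moreover have "g \<otimes> z \<otimes> inv g = (g \<otimes> u \<otimes> inv g) \<otimes> (g \<otimes> b \<otimes> inv g)"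
      using cc ub by (simp add: group_normalize)
    ultimately show ?thesis
      unfolding set_mult_def by blast
  qed
  have Y_small: "ap (int (i - k1)) ` Y \<subseteq> N <#> B (e i)"
  proof (rule generate_img[OF group_hom_ap Nj])
    have "ap (int (i - k1)) z \<in> N <#> B (e i)" if "z \<in> C" for z
    proof -
      obtain g k where gk: "z = g \<otimes> ap (int k) y \<otimes> inv g" "g \<in> F 0"
        using \<open>z \<in> C\<close> unfolding C_def by blast
      have g: "g \<in> carrier G"
        using gk F_carrier by blast
      have "ap (int (i - k1)) g \<in> F (int (i - k1))"
        using g gk(2) by (simp add: ap_F)
      then have "ap (int (i - k1)) g \<in> B J0"
        using n0 F_antimono[of "int n0" "int (i - k1)"] I i by auto
      moreover have "ap (int (i - k1)) z =
          ap (int (i - k1)) g \<otimes> ap (int (i - k1 + k)) y \<otimes> inv (ap (int (i - k1)) g)"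
        using gk g yc by (simp add: ap_mult ap_inv ap_add)
      ultimately show ?thesis
        using conj_B[of "ap (int (i - k1)) g" "ap (int (i - k1 + k)) y"] y_small[of "i - k1 + k"]
        by (simp only: le_add1)
    qed
    moreover have "ap (int (i - k1)) z \<in> N" if "z \<in> N" for z
      using that stable_ap[OF N(1)] stable_carrier[OF N(1)] by simp
    ultimately show "ap (int (i - k1)) ` (C \<union> N) \<subseteq> N <#> B (e i)"
      using subset_product_B(1)[OF Nsub] by blast
  qed
  obtain l where l: "F (int l) \<subseteq> B (e i)"
    using F_subset_B by blast
  \<comment> \<open>The precision is chosen so that the i-th power of \<alpha> takes the error
    \<open>inv z \<otimes> x\<close> into \<open>B (e i)\<close>. Then x would be in level
    \<open>e i\<close> at time i, against the definition of e.\<close>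
  obtain z where z: "z \<in> carrier G" "ap (int k1) z \<in> Y" "inv z \<otimes> x \<in> F (int l - int i)"
    using k1 by blast
  have "ap (int (i - k1)) (ap (int k1) z) \<in> N <#> B (e i)"
    using z Y_small by blast
  moreover have "ap (int (i - k1)) (ap (int k1) z) = ap (int i) z"
    using z(1) I i by (simp add: ap_add[symmetric] of_nat_diff)
  ultimately have zi: "ap (int i) z \<in> N <#> B (e i)"
    by simp
  have "ap (int i) (inv z \<otimes> x) \<in> F (int l)"
    using z xc by (simp add: ap_F)
  then have "ap (int i) (inv z \<otimes> x) \<in> N <#> B (e i)"
    using l subset_product_B(2)[OF Nsub] by blast
  then have "ap (int i) z \<otimes> ap (int i) (inv z \<otimes> x) \<in> N <#> B (e i)"
    by (rule subgroup.m_closed[OF Nj zi])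
  then have "ap (int i) x \<in> N <#> B (e i)"
    using z xc by (simp add: ap_mult ap_inv inv_mult_cancel)
  then show False
    using e_iff by blast
qed

text \<open>A large power of \<alpha> takes g into the ball where the commutator estimate holds with
  any prescribed gain m, so modulo N the commutator is infinitely smaller than x.\<close>

lemma minimal_over_central:
  assumes N: "stable N" "N \<lhd> G" and M: "minimal_over N M"
    and x: "x \<in> M" and g: "g \<in> carrier G"
  shows "g \<otimes> x \<otimes> inv g \<otimes> inv x \<in> N"
proof -
  have stM: "stable M" and normM: "M \<lhd> G" and NM: "N \<subseteq> M"
    using M by (auto simp: minimal_over_def)
  have Nsub: "subgroup N G" and Msub: "subgroup M G"
    using N stM by (auto simp: stable_def)
  have xc: "x \<in> carrier G"
    using x stable_carrier[OF stM] by auto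
  show ?thesis
  proof (cases "x \<in> N")
    case True
    show ?thesis
      by (rule subgroup.m_closed[OF Nsub normal_invE(2)[OF N(2) g True]
            subgroup.m_inv_closed[OF Nsub True]])
  next
    case False
    show ?thesis
    proof (rule infinitely_smaller_mem[OF N M x False])
      show "g \<otimes> x \<otimes> inv g \<otimes> inv x \<in> M"
        by (rule subgroup.m_closed[OF Msub normal_invE(2)[OF normM g x]
              subgroup.m_inv_closed[OF Msub x]])
      fix m
      obtain J where J: "\<And>j g x. j \<ge> J \<Longrightarrow> g \<in> B J \<Longrightarrow> x \<in> B j \<Longrightarrow> g \<otimes> x \<otimes> inv g \<otimes> inv x \<in> B (j + m)"
        using commutator_B[of m] by auto
      obtain K where K: "\<And>k. k \<ge> K \<Longrightarrow> ap (int k) g \<in> B J"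
        using eventually_in_B[OF g] by blast
      have "ap (int k) (g \<otimes> x \<otimes> inv g \<otimes> inv x) \<in> N <#> B (j + m)"
        if kj: "max J K \<le> k" "max J K \<le> j" and xk: "ap (int k) x \<in> N <#> B j" for k j
      proof -
        obtain u b where ub: "u \<in> N" "b \<in> B j" "ap (int k) x = u \<otimes> b"
          using xk unfolding set_mult_def by blast
        define h where "h = ap (int k) g"
        have h: "h \<in> B J"
          using K[of k] kj by (simp add: h_def)
        have cc: "h \<in> carrier G" "u \<in> carrier G" "b \<in> carrier G"
          using h ub stable_carrier[OF N(1)] B_carrier by auto
        have 1: "h \<otimes> u \<otimes> inv h \<in> N <#> B (j + m)"
          using normal_invE(2)[OF N(2) cc(1) ub(1)] subset_product_B(1)[OF Nsub] by blast
        have 2: "h \<otimes> b \<otimes> inv h \<otimes> inv b \<in> N <#> B (j + m)"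
          using J[OF _ h ub(2)] kj subset_product_B(2)[OF Nsub] by auto
        have 3: "inv u \<in> N <#> B (j + m)"
          using subgroup.m_inv_closed[OF Nsub ub(1)] subset_product_B(1)[OF Nsub] by blast
        \<comment> \<open>This product is the commutator of h with \<open>u \<otimes> b\<close>. Its
          outer factors are in N, and its middle factor is small.\<close>
        have "h \<otimes> u \<otimes> inv h \<otimes> (h \<otimes> b \<otimes> inv h \<otimes> inv b) \<otimes> inv u \<in> N <#> B (j + m)"
          using 1 2 3 subgroup.m_closed[OF subgroup_product_B[OF N(2)]] by blast
        then show ?thesis
          using cc g xc ub(3) by (simp add: ap_mult ap_inv group_normalize flip: h_def)
      qed
      then show "\<exists>K. \<forall>k\<ge>K. \<forall>j\<ge>K. ap (int k) x \<in> N <#> B j \<longrightarrow>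
          ap (int k) (g \<otimes> x \<otimes> inv g \<otimes> inv x) \<in> N <#> B (j + m)"
        by blast
    qed
  qed
qed

text \<open>Normality of N lets all factors from N in \<open>(u \<otimes> b) [^] p\<close> be
  collected on the left, so modulo N only \<open>b [^] p\<close> remains, to which
  \<open>power_B\<close> applies.\<close>

lemma minimal_over_exponent:
  assumes N: "stable N" "N \<lhd> G" and M: "minimal_over N M" and x: "x \<in> M"
  shows "x [^] p \<in> N"
proof -
  have stM: "stable M" and NM: "N \<subseteq> M"
    using M by (auto simp: minimal_over_def)
  have Nsub: "subgroup N G" and Msub: "subgroup M G"
    using N stM by (auto simp: stable_def)
  have xc: "x \<in> carrier G"
    using x stable_carrier[OF stM] by auto
  have pow_closed: "y [^] (n::nat) \<in> H" if "subgroup H G" "y \<in> H" for y n H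
    by (induction n) (use that in \<open>auto simp: subgroup.one_closed subgroup.m_closed\<close>)
  show ?thesis
  proof (cases "x \<in> N")
    case True
    then show ?thesis
      using pow_closed Nsub by blast
  next
    case False
    show ?thesis
    proof (rule infinitely_smaller_mem[OF N M x False])
      show "x [^] p \<in> M"
        using pow_closed x Msub by blast
      fix m
      obtain J where J: "\<And>j x. j \<ge> J \<Longrightarrow> x \<in> B j \<Longrightarrow> x [^] p \<in> B (j + m)"
        using power_B[of m] by auto
      have "ap (int k) (x [^] p) \<in> N <#> B (j + m)" 
        if j: "J \<le> j" and xk: "ap (int k) x \<in> N <#> B j" for k j
      proof -
        obtain u b where ub: "u \<in> N" "b \<in> B j" "ap (int k) x = u \<otimes> b"
          using xk unfolding set_mult_def by blast
        have cc: "u \<in> carrier G" "b \<in> carrier G"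
          using ub stable_carrier[OF N(1)] B_carrier by auto
        have "\<exists>v\<in>N. (u \<otimes> b) [^] (n::nat) = v \<otimes> b [^] n" for n
        proof (induction n)
          case 0
          then show ?case
            using subgroup.one_closed[OF Nsub] by (intro bexI[of _ \<one>]) auto
        next
          case (Suc n)
          then obtain v where v: "v \<in> N" "(u \<otimes> b) [^] n = v \<otimes> b [^] n"
            by blast
          have vc: "v \<in> carrier G"
            using v stable_carrier[OF N(1)] by blast
          have "b [^] n \<otimes> u \<otimes> inv (b [^] n) \<in> N"
            using normal_invE(2)[OF N(2) _ ub(1)] cc by simp
          then have "v \<otimes> (b [^] n \<otimes> u \<otimes> inv (b [^] n)) \<in> N"
            by (rule subgroup.m_closed[OF Nsub v(1)])
          moreover have "(u \<otimes> b) [^] Suc n = v \<otimes> (b [^] n \<otimes> u \<otimes> inv (b [^] n)) \<otimes> b [^] Suc n"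
            using v(2) vc cc by (simp add: group_normalize)
          ultimately show ?case by blast
        qed
        then obtain v where "v \<in> N" "(u \<otimes> b) [^] p = v \<otimes> b [^] p"
          by blast
        then show ?thesis
          using ub J[OF j ub(2)] xc unfolding set_mult_def by (auto simp: ap_nat_pow)
      qed
      then show "\<exists>K. \<forall>k\<ge>K. \<forall>j\<ge>K. ap (int k) x \<in> N <#> B j \<longrightarrow> ap (int k) (x [^] p) \<in> N <#> B (j + m)"
        by blast
    qed
  qed
qed

section \<open>Existence of chief series\<close>

lemma ex_minimal_over:
  assumes N: "stable N" "N \<noteq> carrier G"
  shows "\<exists>M. minimal_over N M"
proof -
  define P where "P M \<longleftrightarrow> stable M \<and> M \<lhd> G \<and> N \<subset> M" for M
  have "P (carrier G)"
    unfolding P_def using stable_whole stable_subgroup[OF N(1)] N(2)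
    by (auto intro!: normal_invI subgroup_self dest: subgroup.subset)
  then obtain M where M: "P M" "\<And>H. P H \<Longrightarrow> iota M \<le> iota H"
    using ex_has_least_nat[of P "carrier G" iota] by blast
  have "H = M" if "P H" "H \<subseteq> M" for H
    using stable_eqI[of H M] that M unfolding P_def by auto
  then show ?thesis
    using M(1) unfolding minimal_over_def P_def by blast
qed

lemma ex_chief_series:
  assumes "stable N" "N \<lhd> G"
  shows "\<exists>n Gs. Gs 0 = N \<and> Gs n = carrier G \<and> (\<forall>j\<le>n. stable (Gs j) \<and> Gs j \<lhd> G) \<and>
    (\<forall>j<n. minimal_over (Gs j) (Gs (Suc j)))"
  using assms
proof (induction "card (F_coset ` F 0) - iota N" arbitrary: N rule: less_induct)
  case less
  show ?case
  proof (cases "N = carrier G")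
    case True
    then show ?thesis
      using less.prems by (intro exI[of _ "0::nat"] exI[of _ "\<lambda>_. N"]) auto
  next
    case False
    then obtain M where M: "minimal_over N M"
      using ex_minimal_over less.prems by blast
    then have stM: "stable M" "M \<lhd> G" "N \<subset> M"
      by (auto simp: minimal_over_def)
    then have "iota N < iota M"
      using stable_eqI[OF less.prems(1) stM(1)] by (metis not_le psubsetE subset_refl)
    then have "card (F_coset ` F 0) - iota M < card (F_coset ` F 0) - iota N"
      using iota_bound[of M] by linarith
    then obtain n Gs where IH: "Gs 0 = M" "Gs n = carrier G"
        "\<And>j. j \<le> n \<Longrightarrow> stable (Gs j) \<and> Gs j \<lhd> G"
        "\<And>j. j < n \<Longrightarrow> minimal_over (Gs j) (Gs (Suc j))"
      using less.hyps stM by metis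
    define Gs' where "Gs' j = (case j of 0 \<Rightarrow> N | Suc i \<Rightarrow> Gs i)" for j
    have "Gs' 0 = N" "Gs' (Suc n) = carrier G"
      using IH by (auto simp: Gs'_def)
    moreover have "stable (Gs' j) \<and> Gs' j \<lhd> G" if "j \<le> Suc n" for j
      using that IH(3) less.prems by (auto simp: Gs'_def split: nat.split)
    moreover have "minimal_over (Gs' j) (Gs' (Suc j))" if "j < Suc n" for j
      using that IH(1,4) M by (auto simp: Gs'_def split: nat.split)
    ultimately show ?thesis
      by blast
  qed
qed

end

section \<open>Digit expansions in chief factors\<close>

locale minimal_factor = contraction_filtration +
  fixes N M :: "'a set" and x :: 'a
  assumes stable_N: "stable N" and normal_N: "N \<lhd> G" and minimal: "minimal_over N M"
    and x_M: "x \<in> M" and x_N: "x \<notin> N"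
begin

section \<open>Subgroups between N and M\<close>

lemma stable_M: "stable M"
  using minimal by (simp add: minimal_over_def)

lemma N_subset_M: "N \<subseteq> M"
  using minimal by (auto simp: minimal_over_def)

lemma subgroup_N: "subgroup N G"
  by (rule stable_subgroup[OF stable_N])

lemma subgroup_M: "subgroup M G"
  by (rule stable_subgroup[OF stable_M])

lemma M_carrier: "u \<in> M \<Longrightarrow> u \<in> carrier G"
  by (rule stable_carrier[OF stable_M])

lemma x_carrier [simp]: "x \<in> carrier G"
  by (rule M_carrier[OF x_M])

text \<open>Commutators with elements of M fall into N, hence into H. This makes the products of
  subgroups formed below subgroups again, although G need not be abelian.\<close>

lemma intermediate_normal:
  assumes H: "subgroup H G" "N \<subseteq> H" "H \<subseteq> M"
  shows "H \<lhd> G"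
proof (rule normal_invI[OF H(1)])
  fix g h assume g: "g \<in> carrier G" and h: "h \<in> H"
  then have hc: "h \<in> carrier G"
    using subgroup.mem_carrier[OF H(1)] by blast
  have "g \<otimes> h \<otimes> inv g \<otimes> inv h \<in> H"
    using minimal_over_central[OF stable_N normal_N minimal _ g] h H by blast
  then have "g \<otimes> h \<otimes> inv g \<otimes> inv h \<otimes> h \<in> H"
    by (rule subgroup.m_closed[OF H(1) _ h])
  then show "g \<otimes> h \<otimes> inv g \<in> H"
    using g hc by (simp add: m_assoc)
qed

lemma product_subgroup:
  assumes "subgroup H G" "N \<subseteq> H" "H \<subseteq> M" "subgroup K G"
  shows "subgroup (H <#> K) G"
  by (rule mult_norm_subgroup[OF intermediate_normal[OF assms(1-3)] assms(4)])

lemma conj_mem: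
  assumes "subgroup H G" "N \<subseteq> H" "H \<subseteq> M" "g \<in> carrier G" "h \<in> H"
  shows "inv g \<otimes> h \<otimes> g \<in> H"
  using normal_invE(2)[OF intermediate_normal[OF assms(1-3)], of "inv g" h] assms by simp

lemma subset_product:
  assumes "subgroup H G" "subgroup K G"
  shows "H \<subseteq> H <#> K" "K \<subseteq> H <#> K"
proof -
  show "H \<subseteq> H <#> K"
    using subgroup.one_closed[OF assms(2)] subgroup.mem_carrier[OF assms(1)]
    unfolding set_mult_def by (force intro: exI[of _ "\<one>"])
  show "K \<subseteq> H <#> K"
    using subgroup.one_closed[OF assms(1)] subgroup.mem_carrier[OF assms(2)]
    unfolding set_mult_def by (force intro: exI[of _ "\<one>"])
qed

lemma ap_pow: "u \<in> carrier G \<Longrightarrow> ap k (u [^] (e::int)) = ap k u [^] e"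
  using group_hom.hom_int_pow[OF group_hom_ap] .

lemma ap_M: "u \<in> carrier G \<Longrightarrow> ap k u \<in> M \<longleftrightarrow> u \<in> M"
  by (rule stable_ap[OF stable_M])

lemma pow_p_mem: "u \<in> M \<Longrightarrow> u [^] (int p * e) \<in> N"
  using subgroup_int_pow_closed[OF subgroup_N minimal_over_exponent[OF stable_N normal_N minimal], of u e]
    M_carrier[of u] by (simp add: int_pow_pow int_pow_int[symmetric])

section \<open>Expansions with digits from a given position on\<close>

definition Y :: "'a set" where
  "Y = generate G ({ap (int k) x | k. True} \<union> N)"

text \<open>Modulo N, \<open>P i\<close> stands for the expansions in powers of the \<alpha>-images
  of x whose digits vanish before position i; the closure admits infinitely many digits.\<close>

definition P :: "int \<Rightarrow> 'a set" where
  "P i = {u \<in> carrier G. ap (- i) u \<in> cl Y}"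

lemma Y_gens: "{ap (int k) x | k. True} \<union> N \<subseteq> carrier G"
  using subgroup.subset[OF subgroup_N] by auto

lemma subgroup_Y: "subgroup Y G"
  unfolding Y_def by (rule generate_is_subgroup[OF Y_gens])

lemma N_subset_Y: "N \<subseteq> Y"
  unfolding Y_def using generate.incl[of _ _ G] by blast

lemma ap_x_Y: "ap (int k) x \<in> Y"
  unfolding Y_def by (rule generate.incl) blast

lemma x_Y: "x \<in> Y"
  using ap_x_Y[of 0] by simp

lemma Y_subset:
  assumes "subgroup H G" "N \<subseteq> H" "\<And>k. ap (int k) x \<in> H"
  shows "Y \<subseteq> H"
  unfolding Y_def by (rule generate_subgroup_incl[OF _ assms(1)]) (use assms in auto)

lemma Y_subset_M: "Y \<subseteq> M"
  by (rule Y_subset[OF subgroup_M N_subset_M]) (simp add: ap_M x_M)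

lemma alpha_Y: "\<alpha> ` Y \<subseteq> Y"
proof -
  have "ap 1 ` Y \<subseteq> Y"
    unfolding Y_def group_hom.generate_img[OF group_hom_ap Y_gens, symmetric]
  proof (rule generate_subgroup_incl)
    have "ap 1 (ap (int k) x) = ap (int (Suc k)) x" for k
      using ap_add[OF x_carrier, of 1 "int k"] by (simp del: ap_1)
    then have "ap 1 (ap (int k) x) \<in> Y" for k
      by (simp only: ap_x_Y)
    moreover have "ap 1 n \<in> Y" if "n \<in> N" for n
      using that stable_ap[OF stable_N] stable_carrier[OF stable_N] N_subset_Y by blast
    ultimately show "ap 1 ` ({ap (int k) x | k. True} \<union> N) \<subseteq> generate G ({ap (int k) x | k. True} \<union> N)"
      unfolding Y_def[symmetric] by blast
  qed (rule generate_is_subgroup[OF Y_gens])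
  then show ?thesis by simp
qed

lemma subgroup_P: "subgroup (P i) G"
proof (rule subgroupI)
  show "P i \<noteq> {}"
    using subgroup.one_closed[OF subgroup_cl[OF subgroup_Y]] unfolding P_def by fastforce
qed (auto simp: P_def ap_mult ap_inv subgroup.m_closed[OF subgroup_cl[OF subgroup_Y]]
    subgroup.m_inv_closed[OF subgroup_cl[OF subgroup_Y]])

lemma P_carrier: "u \<in> P i \<Longrightarrow> u \<in> carrier G"
  by (simp add: P_def)

lemma ap_P: "u \<in> carrier G \<Longrightarrow> ap k u \<in> P i \<longleftrightarrow> u \<in> P (i - k)"
  unfolding P_def by (simp add: ap_add[symmetric])

lemma P_0: "P 0 = cl Y"
  using cl_carrier unfolding P_def by auto

lemma P_antimono:
  assumes "i \<le> j"
  shows "P j \<subseteq> P i"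
proof -
  have step: "P (k + 1) \<subseteq> P k" for k
  proof
    fix u assume u: "u \<in> P (k + 1)"
    then have uc: "u \<in> carrier G"
      by (rule P_carrier)
    have "ap 1 ` Y \<subseteq> Y"
      using alpha_Y by auto
    moreover have "ap (- (k + 1)) u \<in> cl Y"
      using u unfolding P_def by blast
    ultimately have "ap 1 (ap (- (k + 1)) u) \<in> cl Y"
      by (rule ap_mem_cl[OF subgroup.subset[OF subgroup_Y]])
    then have "ap (1 + - (k + 1)) u \<in> cl Y"
      by (simp only: ap_add[OF uc])
    then show "u \<in> P k"
      using uc unfolding P_def by simp
  qed
  have "P (i + int d) \<subseteq> P i" for d
  proof (induction d)
    case (Suc d)
    then show ?case
      using step[of "i + int d"] by (simp add: add.assoc add.commute[of 1])
  qed simp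
  then show ?thesis
    using assms zle_iff_zadd by auto
qed

lemma P_subset_M: "P i \<subseteq> M"
proof
  fix u assume u: "u \<in> P i"
  have "cl Y \<subseteq> M"
    using cl_mono[OF Y_subset_M] stable_M by (auto simp: stable_def)
  then show "u \<in> M"
    using u ap_M unfolding P_def by blast
qed

lemma N_subset_P: "N \<subseteq> P i"
proof
  fix u assume u: "u \<in> N"
  then have uc: "u \<in> carrier G"
    by (rule stable_carrier[OF stable_N])
  then have "ap (- i) u \<in> Y"
    using u stable_ap[OF stable_N] N_subset_Y by blast
  then show "u \<in> P i"
    using uc subset_cl[OF subgroup.subset[OF subgroup_Y]] unfolding P_def by blast
qed

lemma x_P: "x \<in> P 0"
  using x_Y subset_cl[OF subgroup.subset[OF subgroup_Y]] unfolding P_0 by blast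

lemma ap_x_P: "ap k x \<in> P k"
  using x_P by (simp add: ap_P)

lemma ap_x_M: "ap k x \<in> M"
  by (simp add: ap_M x_M)

text \<open>By \<open>minimal_over_uniform_approx\<close>, applied to Y, some
  \<open>M \<inter> F k0\<close> lies inside \<open>P 0\<close>; since \<alpha> shifts
  \<open>F\<close> and \<open>P\<close> alike, the same k0 serves every i.\<close>

lemma P_open: "\<exists>k0::nat. \<forall>i. M \<inter> F (int k0 + i) \<subseteq> P i"
proof -
  have conj: "g \<otimes> y \<otimes> inv g \<in> Y" if "g \<in> F 0" "y \<in> Y" for g y
    using normal_invE(2)[OF intermediate_normal[OF subgroup_Y N_subset_Y Y_subset_M]] that F_carrier
    by blast
  have "\<not> Y \<subseteq> N"
    using x_Y x_N by blast
  then obtain k where k: "\<And>u n. u \<in> M \<inter> F 0 \<Longrightarrow>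
      \<exists>z\<in>carrier G. ap (int k) z \<in> Y \<and> inv z \<otimes> u \<in> F n"
    using minimal_over_uniform_approx[OF stable_N normal_N minimal subgroup_Y alpha_Y N_subset_Y
      Y_subset_M _ conj] by blast
  have "v \<in> P i" if v: "v \<in> M" "v \<in> F (int k + i)" for v i
  proof -
    have vc: "v \<in> carrier G"
      using v by (simp add: M_carrier)
    define w where "w = ap (- int k - i) v"
    have w: "w \<in> M \<inter> F 0" and wc: "w \<in> carrier G"
      using v vc unfolding w_def by (simp_all add: ap_F ap_M add.commute)
    have "\<exists>h\<in>Y. inv h \<otimes> ap (int k) w \<in> F n" for n
    proof -
      obtain z where z: "z \<in> carrier G" "ap (int k) z \<in> Y" "inv z \<otimes> w \<in> F (n - int k)"
        using k[OF w] by blast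
      have "ap (int k) (inv z \<otimes> w) \<in> F n"
        using z wc by (simp add: ap_F)
      then show ?thesis
        using z wc by (auto simp: ap_mult ap_inv)
    qed
    then have "ap (int k) w \<in> cl Y"
      unfolding cl_def using wc by simp
    then show ?thesis
      using vc unfolding P_def w_def by (simp add: ap_add[symmetric])
  qed
  then show ?thesis by blast
qed

text \<open>The forward orbit of x stays in the \<open>F (- l)\<close> containing x, and
  \<open>N <#> F (- l)\<close> is closed because an approximation up to \<open>F (- l)\<close>
  already differs by an element of this group. Shifting by \<alpha> gives all i.\<close>

lemma P_small: "\<exists>l::nat. (\<forall>k. ap k x \<in> F (k - int l)) \<and> (\<forall>i. P i \<subseteq> N <#> F (i - int l))"
proof -
  obtain l where l: "x \<in> F (- int l)"
    using F_exhaust x_carrier by blast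
  have ap_x: "ap k x \<in> F (k - int l)" for k
    using l by (simp add: ap_F)
  have NF: "subgroup (N <#> F m) G" for m
    by (rule mult_norm_subgroup[OF normal_N subgroup_F])
  have "Y \<subseteq> N <#> F (- int l)"
  proof (rule Y_subset[OF NF subset_product(1)[OF subgroup_N subgroup_F]])
    show "ap (int k) x \<in> N <#> F (- int l)" for k
      using ap_x[of "int k"] F_antimono[of "- int l" "int k - int l"]
        subset_product(2)[OF subgroup_N subgroup_F[of "- int l"]] by auto
  qed
  moreover have "cl (N <#> F (- int l)) \<subseteq> N <#> F (- int l)"
  proof
    fix z assume z: "z \<in> cl (N <#> F (- int l))"
    then obtain h where h: "h \<in> N <#> F (- int l)" "inv h \<otimes> z \<in> F (- int l)"
      unfolding cl_def by blast
    have "inv h \<otimes> z \<in> N <#> F (- int l)"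
      using h(2) subset_product(2)[OF subgroup_N subgroup_F] by blast
    then have "h \<otimes> (inv h \<otimes> z) \<in> N <#> F (- int l)"
      by (rule subgroup.m_closed[OF NF h(1)])
    then show "z \<in> N <#> F (- int l)"
      using subsetD[OF cl_carrier z] subgroup.mem_carrier[OF NF h(1)] by (simp add: inv_mult_cancel)
  qed
  ultimately have cl: "cl Y \<subseteq> N <#> F (- int l)"
    using cl_mono by blast
  have "u \<in> N <#> F (i - int l)" if u: "u \<in> P i" for u i
  proof -
    have uc: "u \<in> carrier G"
      using u by (rule P_carrier)
    obtain n f where nf: "n \<in> N" "f \<in> F (- int l)" "ap (- i) u = n \<otimes> f"
      using u cl unfolding P_def set_mult_def by blast
    have c: "n \<in> carrier G" "f \<in> carrier G"
      using nf stable_carrier[OF stable_N] F_carrier by auto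
    have "u = ap i (ap (- i) u)"
      using uc by simp
    also have "\<dots> = ap i n \<otimes> ap i f"
      using nf c by (simp add: ap_mult)
    finally have "u = ap i n \<otimes> ap i f" .
    moreover have "ap i n \<in> N" "ap i f \<in> F (i - int l)"
      using nf c stable_ap[OF stable_N] by (simp_all add: ap_F)
    ultimately show ?thesis
      unfolding set_mult_def by blast
  qed
  then show ?thesis
    using ap_x by blast
qed

lemma P_exhaust:
  assumes "u \<in> M"
  shows "\<exists>k::nat. u \<in> P (- int k)"
proof -
  obtain k0 :: nat where k0: "\<And>i. M \<inter> F (int k0 + i) \<subseteq> P i"
    using P_open by blast
  obtain k where k: "u \<in> F (- int k)"
    using F_exhaust M_carrier[OF assms] by blast
  have "M \<inter> F (int k0 + (- int (k0 + k))) \<subseteq> P (- int (k0 + k))"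
    by (rule k0)
  then have "u \<in> P (- int (k0 + k))"
    using k assms by auto
  then show ?thesis by blast
qed

lemma P_Inter:
  assumes u: "\<And>i. u \<in> P i"
  shows "u \<in> N"
proof -
  obtain l :: nat where l: "\<And>i. P i \<subseteq> N <#> F (i - int l)"
    using P_small by blast
  have uc: "u \<in> carrier G"
    using u P_carrier by blast
  have "\<exists>h\<in>N. inv h \<otimes> u \<in> F n" for n
  proof -
    have "u \<in> N <#> F (n + int l - int l)"
      using l u by blast
    then obtain h f where hf: "h \<in> N" "f \<in> F n" "u = h \<otimes> f"
      unfolding set_mult_def by auto
    then have "inv h \<otimes> u = f"
      using stable_carrier[OF stable_N] F_carrier by (simp add: inv_mult_cancel)
    then show ?thesis
      using hf by blast
  qed
  then have "u \<in> cl N"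
    using uc unfolding cl_def by blast
  then show ?thesis
    using stable_N by (auto simp: stable_def)
qed

lemma generate_single_subgroup: "u \<in> carrier G \<Longrightarrow> subgroup (generate G {u}) G"
  by (rule generate_is_subgroup) auto

lemma mem_product_generate:
  assumes H: "subgroup H G" "N \<subseteq> H" "H \<subseteq> M" and g: "g \<in> carrier G"
    and u: "u \<in> H <#> generate G {g}"
  shows "\<exists>e::int. inv (g [^] e) \<otimes> u \<in> H"
proof -
  obtain h and e :: int where h: "h \<in> H" "u = h \<otimes> g [^] e"
    using u unfolding set_mult_def generate_pow[OF g] by blast
  then have "inv (g [^] e) \<otimes> h \<otimes> g [^] e \<in> H"
    using g by (intro conj_mem[OF H]) auto
  then show ?thesis
    using h g subgroup.mem_carrier[OF H(1)] by (auto simp: m_assoc)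
qed

text \<open>All generators of Y except x lie in \<open>P 1\<close>, so Y lies in
  \<open>P 1 <#> generate G {x}\<close>; the closure adds only errors that are in \<open>P 1\<close>
  by \<open>P_open\<close>.\<close>

lemma digit_exists:
  assumes u: "u \<in> P 0"
  shows "\<exists>e::int. inv (x [^] e) \<otimes> u \<in> P 1"
proof -
  obtain k0 :: nat where k0: "\<And>i. M \<inter> F (int k0 + i) \<subseteq> P i"
    using P_open by blast
  obtain h where h: "h \<in> Y" "inv h \<otimes> u \<in> F (int k0 + 1)"
    using u unfolding P_0 cl_def by blast
  have uM: "u \<in> M"
    using u P_subset_M by blast
  have hM: "h \<in> M"
    using h Y_subset_M by blast
  have "inv h \<otimes> u \<in> M"
    using hM uM by (rule subgroup_inv_mult[OF subgroup_M])
  then have hu: "inv h \<otimes> u \<in> P 1"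
    using h(2) k0[of 1] by blast
  have N_P: "N \<subseteq> P 1" and P_M: "P 1 \<subseteq> M"
    by (rule N_subset_P, rule P_subset_M)
  have gen: "subgroup (generate G {x}) G"
    by (rule generate_single_subgroup) simp
  have "Y \<subseteq> P 1 <#> generate G {x}"
  proof (rule Y_subset[OF product_subgroup[OF subgroup_P N_P P_M gen]])
    show "N \<subseteq> P 1 <#> generate G {x}"
      using subset_product(1)[OF subgroup_P gen] N_P by blast
    show "ap (int k) x \<in> P 1 <#> generate G {x}" for k
    proof (cases k)
      case 0
      then show ?thesis
        using subset_product(2)[OF subgroup_P gen] generate.incl[of x "{x}" G] by auto
    next
      case (Suc n)
      then have "ap (int k) x \<in> P 1"
        using ap_x_P[of "int k"] P_antimono[of 1 "int k"] by auto
      then show ?thesis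
        using subset_product(1)[OF subgroup_P gen] by blast
    qed
  qed
  then obtain e :: int where e: "inv (x [^] e) \<otimes> h \<in> P 1"
    using mem_product_generate[OF subgroup_P N_P P_M x_carrier] h by blast
  have "inv (x [^] e) \<otimes> h \<otimes> (inv h \<otimes> u) \<in> P 1"
    by (rule subgroup.m_closed[OF subgroup_P e hu])
  then show ?thesis
    using M_carrier[OF uM] M_carrier[OF hM] by (auto simp: group_normalize)
qed

text \<open>Otherwise \<open>digit_exists\<close> gives \<open>P 0 \<subseteq> P 1\<close>, and
  applying \<alpha> repeatedly puts x into every \<open>P i\<close>, hence into N by
  \<open>P_Inter\<close>.\<close>

lemma x_not_P_1: "x \<notin> P 1"
proof
  assume x1: "x \<in> P 1"
  have P01: "P 0 \<subseteq> P 1"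
  proof
    fix u assume u: "u \<in> P 0"
    then obtain e :: int where e: "inv (x [^] e) \<otimes> u \<in> P 1"
      using digit_exists by blast
    have "x [^] e \<otimes> (inv (x [^] e) \<otimes> u) \<in> P 1"
      by (rule subgroup.m_closed[OF subgroup_P subgroup_int_pow_closed[OF subgroup_P x1] e])
    then show "u \<in> P 1"
      using P_carrier[OF u] by (simp add: inv_mult_cancel)
  qed
  have P_step: "P i \<subseteq> P (i + 1)" for i
  proof
    fix u assume u: "u \<in> P i"
    then have uc: "u \<in> carrier G"
      by (rule P_carrier)
    then have "ap (- i) u \<in> P 0"
      using u by (simp add: ap_P)
    then have "ap (- i) u \<in> P 1"
      using P01 by blast
    then show "u \<in> P (i + 1)"
      using uc by (simp add: ap_P add.commute)
  qed
  have "P 0 \<subseteq> P (int n)" for n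
  proof (induction n)
    case (Suc n)
    then show ?case
      using P_step[of "int n"] by (simp add: add.commute)
  qed simp
  then have "x \<in> P (int n)" for n
    using x_P by blast
  then have "x \<in> P i" for i
    using P_antimono[of i "int (nat i)"] by (meson nat_le_iff order_refl subsetD)
  then show False
    using P_Inter x_N by blast
qed

lemma pow_mem_iff_dvd:
  assumes H: "subgroup H G" "N \<subseteq> H" and u: "u \<in> M" "u \<notin> H"
  shows "u [^] (e::int) \<in> H \<longleftrightarrow> int p dvd e"
proof
  assume "int p dvd e"
  then show "u [^] e \<in> H"
    using pow_p_mem[OF u(1)] H(2) by (auto elim!: dvdE)
next
  assume e: "u [^] e \<in> H"
  have uc: "u \<in> carrier G"
    using u M_carrier by blast
  show "int p dvd e"
  proof (rule ccontr)
    assume "\<not> int p dvd e"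
    then have "coprime (int p) e"
      using prime_p by (intro prime_imp_coprime) simp_all
    \<comment> \<open>u is the product of a power with exponent divisible by p, which lies in N, and
      a power of \<open>u [^] e\<close>, so u would be in H.\<close>
    then obtain a b where ab: "int p * a + e * b = 1"
      using bezout_int[of "int p" e] by (auto simp: coprime_iff_gcd_eq_1 mult.commute)
    have "u [^] (int p * a) \<otimes> (u [^] e) [^] b \<in> H"
      using pow_p_mem[OF u(1)] H subgroup_int_pow_closed[OF H(1) e]
      by (intro subgroup.m_closed[OF H(1)]) auto
    then have "u [^] (int p * a + e * b) \<in> H"
      using uc by (simp add: int_pow_pow int_pow_mult)
    then show False
      using ab uc u(2) by simp
  qed
qed

lemma ap_x_pow_P: "ap k x [^] (e::int) \<in> P (k + 1) \<longleftrightarrow> int p dvd e"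
proof (rule pow_mem_iff_dvd[OF subgroup_P N_subset_P ap_x_M])
  show "ap k x \<notin> P (k + 1)"
    using x_not_P_1 by (simp add: ap_P)
qed

section \<open>A complement of x in M modulo N\<close>

lemma dvd_pow_N: "u \<in> M \<Longrightarrow> int p dvd e \<Longrightarrow> u [^] e \<in> N"
  using pow_p_mem by (auto elim!: dvdE)

text \<open>The expansions modulo N whose nonzero digits are at positions -K to -1. They supply what
  is missing between \<open>P 0\<close> and \<open>P (- K)\<close>.\<close>

definition X :: "nat \<Rightarrow> 'a set" where
  "X K = generate G ({ap (- int k) x | k. 1 \<le> k \<and> k \<le> K} \<union> N)"

lemma subgroup_X: "subgroup (X K) G"
  unfolding X_def
  by (rule generate_is_subgroup) (use subgroup.subset[OF subgroup_N] in auto)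

lemma X_subset:
  assumes "subgroup H G" "N \<subseteq> H" "\<And>k. 1 \<le> k \<Longrightarrow> k \<le> K \<Longrightarrow> ap (- int k) x \<in> H"
  shows "X K \<subseteq> H"
  unfolding X_def by (rule generate_subgroup_incl[OF _ assms(1)]) (use assms in auto)

lemma N_subset_X: "N \<subseteq> X K"
  unfolding X_def using generate.incl[of _ _ G] by blast

lemma ap_x_X: "1 \<le> k \<Longrightarrow> k \<le> K \<Longrightarrow> ap (- int k) x \<in> X K"
  unfolding X_def by (rule generate.incl) blast

lemma X_subset_M: "X K \<subseteq> M"
  by (rule X_subset[OF subgroup_M N_subset_M ap_x_M])

lemma X_mono: "K \<le> L \<Longrightarrow> X K \<subseteq> X L"
  by (rule X_subset[OF subgroup_X N_subset_X]) (rule ap_x_X, auto)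

lemma X_0: "X 0 = N"
  using X_subset[OF subgroup_N, of 0] N_subset_X[of 0] by auto

lemma X_subset_P: "X K \<subseteq> P (- int K)"
proof (rule X_subset[OF subgroup_P N_subset_P])
  show "ap (- int k) x \<in> P (- int K)" if "k \<le> K" for k
    using ap_x_P[of "- int k"] P_antimono[of "- int K" "- int k"] that by auto
qed

lemma X_Suc: "X (Suc K) \<subseteq> X K <#> generate G {ap (- int (Suc K)) x}"
proof -
  have gen: "subgroup (generate G {ap (- int (Suc K)) x}) G"
    by (rule generate_single_subgroup) simp
  show ?thesis
  proof (rule X_subset[OF product_subgroup[OF subgroup_X N_subset_X X_subset_M gen]])
    show "N \<subseteq> X K <#> generate G {ap (- int (Suc K)) x}"
      using N_subset_X subset_product(1)[OF subgroup_X gen] by blast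
    show "ap (- int k) x \<in> X K <#> generate G {ap (- int (Suc K)) x}"
      if k: "1 \<le> k" "k \<le> Suc K" for k
    proof (cases "k = Suc K")
      case True
      then show ?thesis
        using generate.incl[of "ap (- int (Suc K)) x" "{ap (- int (Suc K)) x}" G]
          subset_product(2)[OF subgroup_X gen] by blast
    next
      case False
      then have "ap (- int k) x \<in> X K"
        using k by (intro ap_x_X) auto
      then show ?thesis
        using subset_product(1)[OF subgroup_X gen] by blast
    qed
  qed
qed

text \<open>Induction on the first position: a and its part in \<open>X K\<close> both lie in
  \<open>P (- K)\<close>, hence so does the power of the remaining generator. By
  \<open>ap_x_pow_P\<close> its exponent is then divisible by p, which puts the power into
  N.\<close>

lemma X_Int_P: "a \<in> X K \<Longrightarrow> a \<in> P 0 \<Longrightarrow> a \<in> N"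
proof (induction K arbitrary: a)
  case 0
  then show ?case by (simp add: X_0)
next
  case (Suc K)
  define y where "y = ap (- int (Suc K)) x"
  have yc: "y \<in> carrier G"
    by (simp add: y_def)
  obtain e :: int where e: "inv (y [^] e) \<otimes> a \<in> X K"
    using mem_product_generate[OF subgroup_X N_subset_X X_subset_M yc] X_Suc Suc.prems
    unfolding y_def by blast
  have ac: "a \<in> carrier G"
    using Suc.prems P_carrier by blast
  have aP: "a \<in> P (- int K)"
    using Suc.prems P_antimono[of "- int K" 0] by auto
  have "inv (inv (y [^] e) \<otimes> a) \<in> P (- int K)"
    using e X_subset_P subgroup.m_inv_closed[OF subgroup_P] by blast
  then have "a \<otimes> inv (inv (y [^] e) \<otimes> a) \<in> P (- int K)"
    by (rule subgroup.m_closed[OF subgroup_P aP])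
  then have "y [^] e \<in> P (- int (Suc K) + 1)"
    using ac yc by (simp add: group_normalize)
  then have "int p dvd e"
    unfolding y_def ap_x_pow_P .
  then have ye: "y [^] e \<in> N"
    by (rule dvd_pow_N[rotated]) (simp only: y_def ap_x_M)
  then have "inv (y [^] e) \<in> P 0"
    using N_subset_P subgroup.m_inv_closed[OF subgroup_P] by blast
  then have "inv (y [^] e) \<otimes> a \<in> P 0"
    using Suc.prems(2) by (rule subgroup.m_closed[OF subgroup_P])
  then have "inv (y [^] e) \<otimes> a \<in> N"
    using Suc.IH e by blast
  then have "y [^] e \<otimes> (inv (y [^] e) \<otimes> a) \<in> N"
    by (rule subgroup.m_closed[OF subgroup_N ye])
  then show ?case
    using yc ac by (simp add: inv_mult_cancel)
qed

text \<open>Scaling by \<alpha> moves the leading position to 0, where \<open>digit_exists\<close>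
  reads off the digit; after scaling back, the rest begins one position later and the induction
  hypothesis applies.\<close>

lemma P_subset_product_X: "P (- int k) \<subseteq> X k <#> P 0"
proof (induction k)
  case 0
  then show ?case
    using subset_product(2)[OF subgroup_X subgroup_P] by simp
next
  case (Suc k)
  show ?case
  proof
    fix u assume u: "u \<in> P (- int (Suc k))"
    have uc: "u \<in> carrier G"
      using u by (rule P_carrier)
    define y where "y = ap (- int (Suc k)) x"
    have yc: "y \<in> carrier G"
      by (simp add: y_def)
    have "ap (int (Suc k)) u \<in> P 0"
      using u uc by (simp only: ap_P) simp
    then obtain e :: int where e: "inv (x [^] e) \<otimes> ap (int (Suc k)) u \<in> P 1"
      using digit_exists by blast
    define v where "v = inv (x [^] e) \<otimes> ap (int (Suc k)) u"
    have vc: "v \<in> carrier G"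
      using uc by (simp add: v_def)
    have "ap (- int (Suc k)) v \<in> P (- int k)"
      using e vc unfolding v_def[symmetric] by (simp add: ap_P)
    moreover have "ap (- int (Suc k)) v = inv (y [^] e) \<otimes> u"
      unfolding v_def y_def using uc by (simp add: ap_mult ap_inv ap_pow del: of_nat_Suc)
    ultimately obtain a b where ab: "a \<in> X k" "b \<in> P 0" "inv (y [^] e) \<otimes> u = a \<otimes> b"
      using Suc unfolding set_mult_def by fastforce
    have abc: "a \<in> carrier G" "b \<in> carrier G"
      using ab P_carrier subgroup.mem_carrier[OF subgroup_X] by auto
    have "y [^] e \<otimes> a \<in> X (Suc k)"
    proof (rule subgroup.m_closed[OF subgroup_X])
      show "y [^] e \<in> X (Suc k)"
        unfolding y_def by (intro subgroup_int_pow_closed[OF subgroup_X] ap_x_X) auto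
      show "a \<in> X (Suc k)"
        using ab X_mono[of k "Suc k"] by auto
    qed
    moreover have "u = (y [^] e \<otimes> a) \<otimes> b"
    proof -
      have "u = y [^] e \<otimes> (inv (y [^] e) \<otimes> u)"
        using uc yc by (simp add: inv_mult_cancel)
      then show ?thesis
        using ab(3) abc yc by (simp add: m_assoc)
    qed
    ultimately show "u \<in> X (Suc k) <#> P 0"
      using ab(2) unfolding set_mult_def by blast
  qed
qed

text \<open>The expansions whose digit at position 0 vanishes: \<open>X K\<close> provides the
  negative positions, \<open>P 1\<close> the positive ones. The quotient of \<open>P 0\<close> by
  \<open>P 1\<close> alone would give a digit only to elements of \<open>P 0\<close>.\<close>

definition C :: "'a set" where
  "C = (\<Union>K. X K <#> P 1)"

lemma subgroup_C: "subgroup C G"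
proof (rule subgroupI)
  have XP: "subgroup (X K <#> P 1) G" for K
    by (rule product_subgroup[OF subgroup_X N_subset_X X_subset_M subgroup_P])
  show "C \<subseteq> carrier G"
    unfolding C_def using subgroup.subset[OF XP] by blast
  show "C \<noteq> {}"
    unfolding C_def using subgroup.one_closed[OF XP[of 0]] by blast
  show "inv a \<in> C" if "a \<in> C" for a
    using that subgroup.m_inv_closed[OF XP, of a] unfolding C_def by auto
  show "a \<otimes> b \<in> C" if ab: "a \<in> C" "b \<in> C" for a b
  proof -
    obtain K L where KL: "a \<in> X K <#> P 1" "b \<in> X L <#> P 1"
      using ab unfolding C_def by blast
    have "a \<in> X (max K L) <#> P 1" "b \<in> X (max K L) <#> P 1"
      using KL X_mono[of K "max K L"] X_mono[of L "max K L"] unfolding set_mult_def by auto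
    then have "a \<otimes> b \<in> X (max K L) <#> P 1"
      by (rule subgroup.m_closed[OF XP])
    then show ?thesis
      unfolding C_def by (rule UN_I[OF UNIV_I])
  qed
qed

lemma X_subset_C: "X K \<subseteq> C"
  unfolding C_def using subset_product(1)[OF subgroup_X subgroup_P] by blast

lemma N_subset_C: "N \<subseteq> C"
  using N_subset_X X_subset_C by blast

lemma P_1_subset_C: "P 1 \<subseteq> C"
  unfolding C_def using subset_product(2)[OF subgroup_X subgroup_P] by blast

lemma C_subset_M: "C \<subseteq> M"
  unfolding C_def set_mult_def
  using X_subset_M P_subset_M subgroup.m_closed[OF subgroup_M] by blast

text \<open>If x were such a product \<open>a \<otimes> b\<close>, then a would lie in
  \<open>P 0\<close>, hence in N by \<open>X_Int_P\<close>, and x in \<open>P 1\<close>.\<close>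

lemma x_not_C: "x \<notin> C"
proof
  assume "x \<in> C"
  then obtain K a b where ab: "a \<in> X K" "b \<in> P 1" "x = a \<otimes> b"
    unfolding C_def set_mult_def by blast
  have c: "a \<in> carrier G" "b \<in> carrier G"
    using ab P_carrier subgroup.mem_carrier[OF subgroup_X] by auto
  have "b \<in> P 0"
    using ab(2) P_antimono[of 0 1] by auto
  then have "x \<otimes> inv b \<in> P 0"
    using x_P by (blast intro: subgroup.m_closed[OF subgroup_P] subgroup.m_inv_closed[OF subgroup_P])
  then have "a \<in> P 0"
    using ab(3) c by (simp add: m_assoc)
  then have "a \<in> P 1"
    using X_Int_P[OF ab(1)] N_subset_P by blast
  then have "x \<in> P 1"
    using ab(2,3) subgroup.m_closed[OF subgroup_P] by blast
  then show False
    using x_not_P_1 by blast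
qed

lemma x_pow_C: "x [^] (e::int) \<in> C \<longleftrightarrow> int p dvd e"
  by (rule pow_mem_iff_dvd[OF subgroup_C N_subset_C x_M x_not_C])

lemma C_digit_exists:
  assumes u: "u \<in> M"
  shows "\<exists>e::int. inv (x [^] e) \<otimes> u \<in> C"
proof -
  obtain k a b where ab: "a \<in> X k" "b \<in> P 0" "u = a \<otimes> b"
    using P_exhaust[OF u] P_subset_product_X unfolding set_mult_def by blast
  have c: "a \<in> carrier G" "b \<in> carrier G"
    using ab P_carrier subgroup.mem_carrier[OF subgroup_X] by auto
  obtain e :: int where e: "inv (x [^] e) \<otimes> b \<in> P 1"
    using digit_exists[OF ab(2)] by blast
  have "a \<in> C"
    using ab X_subset_C by blast
  then have "inv (x [^] e) \<otimes> a \<otimes> x [^] e \<in> C"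
    by (intro conj_mem[OF subgroup_C N_subset_C C_subset_M]) simp_all
  moreover have "inv (x [^] e) \<otimes> b \<in> C"
    using e P_1_subset_C by blast
  ultimately have "inv (x [^] e) \<otimes> a \<otimes> x [^] e \<otimes> (inv (x [^] e) \<otimes> b) \<in> C"
    by (rule subgroup.m_closed[OF subgroup_C])
  then show ?thesis
    using ab c by (auto simp: group_normalize)
qed

text \<open>\<open>C\<close> is a complement of \<open>x\<close> in \<open>M\<close> modulo \<open>N\<close>; \<open>digit\<close> is the resulting projection of \<open>M\<close> onto the
  integers modulo \<open>p\<close>, and the \<open>n\<close>-th coordinate of \<open>u\<close> is read off \<open>\<alpha>\<^sup>-\<^sup>n u\<close>.\<close>

definition digit :: "'a \<Rightarrow> int" where
  "digit u = (SOME e. inv (x [^] (e::int)) \<otimes> u \<in> C) mod int p"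

definition \<phi> :: "'a \<Rightarrow> int \<Rightarrow> int" where
  "\<phi> u n = digit (ap (- n) u)"

text \<open>The exponent picked in \<open>digit\<close> is determined only modulo p: two powers of x
  agree modulo C exactly when p divides the difference of the exponents, by
  \<open>x_pow_C\<close>.\<close>

lemma digit_iff:
  assumes u: "u \<in> M"
  shows "inv (x [^] (e::int)) \<otimes> u \<in> C \<longleftrightarrow> digit u = e mod int p"
proof -
  define d where "d = (SOME e. inv (x [^] (e::int)) \<otimes> u \<in> C)"
  have d: "inv (x [^] d) \<otimes> u \<in> C"
    unfolding d_def by (rule someI_ex[OF C_digit_exists[OF u]])
  have uc: "u \<in> carrier G"
    using u M_carrier by blast
  have eq: "inv (x [^] e) \<otimes> x [^] d = x [^] (d - e)"
    using int_pow_mult[OF x_carrier, of "- e" d] by (simp add: int_pow_neg)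
  have "inv (x [^] e) \<otimes> u \<in> C \<longleftrightarrow> inv (x [^] e) \<otimes> x [^] d \<in> C"
  proof
    assume "inv (x [^] e) \<otimes> u \<in> C"
    moreover have "inv u \<otimes> x [^] d \<in> C"
      by (rule subgroup_inv_mult_sym[OF subgroup_C _ uc d]) simp
    ultimately show "inv (x [^] e) \<otimes> x [^] d \<in> C"
      by (rule subgroup_inv_mult_trans[OF subgroup_C _ uc, rotated 2]) simp_all
  next
    assume "inv (x [^] e) \<otimes> x [^] d \<in> C"
    then show "inv (x [^] e) \<otimes> u \<in> C"
      using d by (rule subgroup_inv_mult_trans[OF subgroup_C _ _ uc, rotated 2]) simp_all
  qed
  also have "\<dots> \<longleftrightarrow> int p dvd d - e"
    unfolding eq x_pow_C ..
  also have "\<dots> \<longleftrightarrow> digit u = e mod int p"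
    unfolding digit_def d_def[symmetric] mod_eq_dvd_iff ..
  finally show ?thesis .
qed

section \<open>Coordinates of elements of M\<close>

lemma p_pos: "int p > 0"
  using prime_gt_0_nat[OF prime_p] by simp

lemma digit_range: "0 \<le> digit u" "digit u < int p"
  unfolding digit_def using p_pos by simp_all

lemma digit_mult:
  assumes u: "u \<in> M" "v \<in> M"
  shows "digit (u \<otimes> v) = (digit u + digit v) mod int p"
proof -
  have c: "u \<in> carrier G" "v \<in> carrier G"
    using u M_carrier by auto
  have "inv (x [^] digit u) \<otimes> u \<in> C" "inv (x [^] digit v) \<otimes> v \<in> C"
    using u digit_iff digit_range by simp_all
  moreover from this have "inv (x [^] digit v) \<otimes> (inv (x [^] digit u) \<otimes> u) \<otimes> x [^] digit v \<in> C"
    by (intro conj_mem[OF subgroup_C N_subset_C C_subset_M]) simp_all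
  ultimately have "inv (x [^] digit v) \<otimes> (inv (x [^] digit u) \<otimes> u) \<otimes> x [^] digit v \<otimes> (inv (x [^] digit v) \<otimes> v) \<in> C"
    by (blast intro: subgroup.m_closed[OF subgroup_C])
  then have "inv (x [^] (digit u + digit v)) \<otimes> (u \<otimes> v) \<in> C"
    using c by (simp add: int_pow_mult group_normalize)
  then show ?thesis
    using digit_iff subgroup.m_closed[OF subgroup_M u] by simp
qed

lemma digit_C:
  assumes "u \<in> M"
  shows "digit u = 0 \<longleftrightarrow> u \<in> C"
  using digit_iff[OF assms, of 0] M_carrier[OF assms] by simp

lemma phi_mult:
  assumes "u \<in> M" "v \<in> M"
  shows "\<phi> (u \<otimes> v) n = (\<phi> u n + \<phi> v n) mod int p"
  unfolding \<phi>_def using assms M_carrier by (simp add: ap_mult digit_mult ap_M)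

lemma phi_alpha:
  assumes "u \<in> M"
  shows "\<phi> (\<alpha> u) = right_shift (\<phi> u)"
proof
  fix n
  have "ap (- n) (ap 1 u) = ap (- (n - 1)) u"
    using M_carrier[OF assms] by (simp only: ap_add[symmetric]) simp
  then show "\<phi> (\<alpha> u) n = right_shift (\<phi> u) n"
    unfolding \<phi>_def right_shift_def by simp
qed

text \<open>\<open>P_exhaust\<close> gives a starting position; from there a vanishing digit at
  position m moves u from \<open>P m\<close> to \<open>P (m + 1)\<close>, as the exponent found by
  \<open>digit_exists\<close> is then divisible by p.\<close>

lemma phi_zero_iff:
  assumes u: "u \<in> M"
  shows "(\<forall>k<i. \<phi> u k = 0) \<longleftrightarrow> u \<in> P i"
proof
  have uc: "u \<in> carrier G"
    using u M_carrier by blast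
  show "u \<in> P i" if zero: "\<forall>k<i. \<phi> u k = 0"
  proof -
    have step: "u \<in> P (m + 1)" if m: "u \<in> P m" "m < i" for m
    proof -
      have "ap (- m) u \<in> P 0"
        using m uc by (simp add: ap_P)
      then obtain e :: int where e: "inv (x [^] e) \<otimes> ap (- m) u \<in> P 1"
        using digit_exists by blast
      then have "digit (ap (- m) u) = e mod int p"
        using P_1_subset_C digit_iff[of "ap (- m) u" e] u uc ap_M by blast
      moreover have "digit (ap (- m) u) = 0"
        using zero m(2) unfolding \<phi>_def by blast
      ultimately have "int p dvd e"
        by (simp add: mod_eq_0_iff_dvd)
      then have "x [^] e \<in> P 1"
        using dvd_pow_N[OF x_M] N_subset_P by blast
      then have "x [^] e \<otimes> (inv (x [^] e) \<otimes> ap (- m) u) \<in> P 1"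
        using e by (rule subgroup.m_closed[OF subgroup_P])
      then have "ap (- m) u \<in> P 1"
        using uc by (simp add: inv_mult_cancel)
      then show ?thesis
        using uc by (simp add: ap_P add.commute)
    qed
    obtain k where k: "u \<in> P (- int k)"
      using P_exhaust[OF u] by blast
    show ?thesis
    proof (cases "i \<le> - int k")
      case True
      then show ?thesis
        using k P_antimono by blast
    next
      case False
      have "- int k + int d \<le> i \<Longrightarrow> u \<in> P (- int k + int d)" for d
      proof (induction d)
        case (Suc d)
        then show ?case
          using step[of "- int k + int d"] by (simp add: algebra_simps)
      qed (use k in simp)
      from this[of "nat (i + int k)"] show ?thesis
        using False by simp
    qed
  qed
  show "\<forall>k<i. \<phi> u k = 0" if "u \<in> P i"
  proof (intro allI impI)
    fix k assume "k < i"
    then have "ap (- k) u \<in> P 1"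
      using that uc P_antimono[of "1 + k" i] by (auto simp: ap_P)
    then show "\<phi> u k = 0"
      unfolding \<phi>_def using digit_C[of "ap (- k) u"] u uc P_1_subset_C ap_M by blast
  qed
qed

lemma phi_kernel:
  assumes u: "u \<in> M"
  shows "(\<forall>k. \<phi> u k = 0) \<longleftrightarrow> u \<in> N"
proof
  assume "\<forall>k. \<phi> u k = 0"
  then have "u \<in> P i" for i
    using phi_zero_iff[OF u] by blast
  then show "u \<in> N"
    by (rule P_Inter)
next
  assume "u \<in> N"
  then have "u \<in> P (k + 1)" for k
    using N_subset_P by blast
  then show "\<forall>k. \<phi> u k = 0"
    using phi_zero_iff[OF u] zless_add1_eq by blast
qed

lemma phi_range:
  assumes u: "u \<in> M"
  shows "\<phi> u \<in> carrier (shift_group (integer_mod_group p))"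
proof -
  obtain k where "u \<in> P (- int k)"
    using P_exhaust[OF u] by blast
  then have "\<exists>n0. \<forall>n<n0. \<phi> u n = 0"
    using phi_zero_iff[OF u] by blast
  then show ?thesis
    using p_pos digit_range
    by (auto simp: shift_group_def carrier_integer_mod_group \<phi>_def)
qed

lemma phi_x_pow: "n \<le> k \<Longrightarrow> \<phi> (ap k x [^] (e::int)) n = (if n = k then e mod int p else 0)"
proof -
  assume "n \<le> k"
  have M: "ap k x [^] e \<in> M"
    by (rule subgroup_int_pow_closed[OF subgroup_M ap_x_M])
  have "\<phi> (ap k x [^] e) k = e mod int p"
  proof -
    have "ap (- k) (ap k x [^] e) = x [^] e"
      by (simp add: ap_pow)
    moreover have "inv (x [^] e) \<otimes> x [^] e \<in> C"
      using subgroup.one_closed[OF subgroup_C] by simp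
    then have "digit (x [^] e) = e mod int p"
      using digit_iff[OF subgroup_int_pow_closed[OF subgroup_M x_M]] by blast
    ultimately show ?thesis
      unfolding \<phi>_def by simp
  qed
  moreover have "\<phi> (ap k x [^] e) n = 0" if "n < k"
    using phi_zero_iff[OF M] subgroup_int_pow_closed[OF subgroup_P ap_x_P] that by blast
  ultimately show ?thesis
    using \<open>n \<le> k\<close> by auto
qed

lemma phi_surj:
  assumes f: "f \<in> carrier (shift_group (integer_mod_group p))"
  shows "\<exists>u\<in>M. \<phi> u = f"
proof -
  have f_range: "0 \<le> f n" "f n < int p" for n
    using f p_pos by (auto simp: shift_group_def carrier_integer_mod_group split: if_splits)
  obtain n0 where n0: "\<And>n. n < n0 \<Longrightarrow> f n = 0"
    using f by (auto simp: shift_group_def)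
  \<comment> \<open>The correction at position \<open>n0 + m\<close> is the wanted digit minus the
    present one. It leaves earlier digits alone, by \<open>phi_x_pow\<close>; later digits are
    adjusted in later rounds.\<close>
  define e where "e m v = f (n0 + int m) - \<phi> v (n0 + int m)" for m v
  define u where "u = rec_nat \<one> (\<lambda>m v. v \<otimes> ap (n0 + int m) x [^] e m v)"
  have u_0: "u 0 = \<one>" and u_Suc: "u (Suc m) = u m \<otimes> ap (n0 + int m) x [^] e m (u m)" for m
    by (simp_all add: u_def)
  have pow_M: "ap k x [^] (d::int) \<in> M" for k d
    by (rule subgroup_int_pow_closed[OF subgroup_M ap_x_M])
  have u_M: "u m \<in> M" for m
    by (induction m) (simp_all add: u_0 u_Suc subgroup.one_closed[OF subgroup_M]
        subgroup.m_closed[OF subgroup_M] pow_M)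
  have uc: "u m \<in> carrier G" for m
    using u_M M_carrier by blast
  have u_f: "n < n0 + int m \<Longrightarrow> \<phi> (u m) n = f n" for m n
  proof (induction m)
    case 0
    have "\<phi> \<one> n = 0"
      using phi_kernel[OF subgroup.one_closed[OF subgroup_M]] subgroup.one_closed[OF subgroup_N] by blast
    then show ?case
      using 0 n0 by (simp add: u_0)
  next
    case (Suc m)
    have eq: "\<phi> (u (Suc m)) n = (\<phi> (u m) n + \<phi> (ap (n0 + int m) x [^] e m (u m)) n) mod int p"
      unfolding u_Suc by (rule phi_mult[OF u_M pow_M])
    have le: "n \<le> n0 + int m"
      using Suc.prems by simp
    show ?case
    proof (cases "n = n0 + int m")
      case True
      then show ?thesis
        using eq phi_x_pow[OF le] f_range by (simp add: e_def mod_add_right_eq)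
    next
      case False
      then have "n < n0 + int m"
        using le by simp
      then show ?thesis
        using eq phi_x_pow[OF le] f_range Suc.IH False by simp
    qed
  qed
  obtain l :: nat where l: "\<And>k. ap k x \<in> F (k - int l)"
    using P_small by blast
  obtain k0 :: nat where k0: "\<And>i. M \<inter> F (int k0 + i) \<subseteq> P i"
    using P_open by blast
  \<comment> \<open>The m-th correction lies in \<open>F (n0 + m - l)\<close>; this offset makes the
    steps fit \<open>F_complete\<close>.\<close>
  define c where "c = n0 - int l"
  have "inv (u m) \<otimes> u (Suc m) \<in> F (int m + c)" for m
    using subgroup_int_pow_closed[OF subgroup_F l[of "n0 + int m"]] uc[of m]
    by (simp add: u_Suc inv_mult_cancel c_def algebra_simps)
  then obtain v where v: "v \<in> carrier G" "\<And>m. inv (u m) \<otimes> v \<in> F (int m + c)"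
    using F_complete[of u c] uc by blast
  have "\<exists>h\<in>M. inv h \<otimes> v \<in> F n" for n
  proof -
    have "F (int (nat (n - c)) + c) \<subseteq> F n"
      by (rule F_antimono) linarith
    then show ?thesis
      using v(2)[of "nat (n - c)"] u_M by blast
  qed
  then have "v \<in> cl M"
    using v(1) unfolding cl_def by blast
  then have v_M: "v \<in> M"
    using stable_M by (auto simp: stable_def)
  have "\<phi> v n = f n" for n
  proof -
    \<comment> \<open>Large enough that \<open>u m\<close> has the right digit at n and that the
      remainder has digit 0 there, by \<open>P_open\<close>; adding 1 makes both inequalities
      strict.\<close>
    define m where "m = nat (max (n - n0) (n - c + int k0)) + 1"
    have m: "n < n0 + int m" "n < int m + c - int k0"
      unfolding m_def by linarith+
    define w where "w = inv (u m) \<otimes> v"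
    have w_M: "w \<in> M"
      unfolding w_def by (rule subgroup_inv_mult[OF subgroup_M u_M v_M])
    have "w \<in> P (int m + c - int k0)"
      using k0[of "int m + c - int k0"] w_M v(2)[of m] unfolding w_def by auto
    then have w_0: "\<phi> w n = 0"
      using phi_zero_iff[OF w_M] m(2) by blast
    have "v = u m \<otimes> w"
      unfolding w_def using uc v(1) by (simp add: inv_mult_cancel)
    then have "\<phi> v n = (\<phi> (u m) n + \<phi> w n) mod int p"
      using phi_mult[OF u_M w_M] by simp
    then show ?thesis
      using u_f[OF m(1)] w_0 f_range by simp
  qed
  then show ?thesis
    using v_M by blast
qed

lemma phi_continuous: "\<exists>n. \<forall>u\<in>M \<inter> F n. \<forall>k<i. \<phi> u k = 0"
proof -
  obtain k0 :: nat where k0: "\<And>i. M \<inter> F (int k0 + i) \<subseteq> P i"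
    using P_open by blast
  have "\<forall>u\<in>M \<inter> F (int k0 + i). \<forall>k<i. \<phi> u k = 0"
    using k0[of i] phi_zero_iff by blast
  then show ?thesis ..
qed

text \<open>Vanishing early digits mean membership in some \<open>P i\<close>, which is small modulo
  N by \<open>P_small\<close>. Together with \<open>phi_continuous\<close> this yields the
  homeomorphism of M / N with the restricted product.\<close>

lemma phi_open: "\<exists>i. \<forall>u\<in>M. (\<forall>k<i. \<phi> u k = 0) \<longrightarrow> u \<in> N <#> F n"
proof -
  obtain l :: nat where "\<And>i. P i \<subseteq> N <#> F (i - int l)"
    using P_small by blast
  from this[of "n + int l"] have "P (n + int l) \<subseteq> N <#> F n"
    by simp
  then have "\<forall>u\<in>M. (\<forall>k<n + int l. \<phi> u k = 0) \<longrightarrow> u \<in> N <#> F n"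
    using phi_zero_iff by blast
  then show ?thesis ..
qed

end

section \<open>The restricted product with the shift\<close>

lemma continuous_mapI_openin:
  assumes "\<And>x. x \<in> topspace X \<Longrightarrow> f x \<in> topspace Y"
    and "\<And>U x. openin Y U \<Longrightarrow> x \<in> topspace X \<Longrightarrow> f x \<in> U \<Longrightarrow>
      \<exists>V. openin X V \<and> x \<in> V \<and> (\<forall>y\<in>V. f y \<in> U)"
  shows "continuous_map X Y f"
  unfolding continuous_map_def
proof (intro conjI allI impI)
  show "f \<in> topspace X \<rightarrow> topspace Y"
    using assms(1) by blast
  fix U assume U: "openin Y U"
  show "openin X {x \<in> topspace X. f x \<in> U}"
  proof (subst openin_subopen, intro ballI)
    fix x assume "x \<in> {x \<in> topspace X. f x \<in> U}"
    then obtain V where V: "openin X V" "x \<in> V" "\<forall>y\<in>V. f y \<in> U"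
      using assms(2)[OF U] by blast
    then have "V \<subseteq> {x \<in> topspace X. f x \<in> U}"
      using openin_subset by blast
    then show "\<exists>T. openin X T \<and> x \<in> T \<and> T \<subseteq> {x \<in> topspace X. f x \<in> U}"
      using V by blast
  qed
qed

context
  fixes H :: "('c, 'm) monoid_scheme"
  assumes group_H: "group H"
begin

interpretation H: group H
  by (rule group_H)

lemma shift_group_carrier:
  "f \<in> carrier (shift_group H) \<longleftrightarrow> (\<forall>n. f n \<in> carrier H) \<and> (\<exists>n0. \<forall>n<n0. f n = \<one>\<^bsub>H\<^esub>)"
  by (simp add: shift_group_def)

lemma shift_group_mult [simp]: "(f \<otimes>\<^bsub>shift_group H\<^esub> g) n = f n \<otimes>\<^bsub>H\<^esub> g n"
  by (simp add: shift_group_def)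

lemma shift_group_one [simp]: "\<one>\<^bsub>shift_group H\<^esub> n = \<one>\<^bsub>H\<^esub>"
  by (simp add: shift_group_def)

lemma shift_group_mult_closed:
  assumes "f \<in> carrier (shift_group H)" "g \<in> carrier (shift_group H)"
  shows "f \<otimes>\<^bsub>shift_group H\<^esub> g \<in> carrier (shift_group H)"
proof -
  obtain m n where mn: "\<forall>k<m. f k = \<one>\<^bsub>H\<^esub>" "\<forall>k<n. g k = \<one>\<^bsub>H\<^esub>"
    using assms unfolding shift_group_carrier by blast
  have "\<forall>k<min m n. f k \<otimes>\<^bsub>H\<^esub> g k = \<one>\<^bsub>H\<^esub>"
    using mn by simp
  moreover have "f k \<otimes>\<^bsub>H\<^esub> g k \<in> carrier H" for k
    using assms by (simp add: shift_group_carrier)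
  ultimately show ?thesis
    unfolding shift_group_carrier shift_group_mult by blast
qed

lemma shift_group_inv_closed:
  assumes "f \<in> carrier (shift_group H)"
  shows "(\<lambda>n. inv\<^bsub>H\<^esub> f n) \<in> carrier (shift_group H)"
proof -
  obtain m where m: "\<forall>k<m. f k = \<one>\<^bsub>H\<^esub>"
    using assms unfolding shift_group_carrier by blast
  have "\<forall>k<m. inv\<^bsub>H\<^esub> f k = \<one>\<^bsub>H\<^esub>"
    using m by simp
  then show ?thesis
    using assms unfolding shift_group_carrier by auto
qed

lemma shift_group_is_group: "group (shift_group H)"
proof (rule groupI)
  show "\<one>\<^bsub>shift_group H\<^esub> \<in> carrier (shift_group H)"
    by (simp add: shift_group_carrier)
  fix f g h
  assume f: "f \<in> carrier (shift_group H)" and g: "g \<in> carrier (shift_group H)"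
    and h: "h \<in> carrier (shift_group H)"
  show "f \<otimes>\<^bsub>shift_group H\<^esub> g \<otimes>\<^bsub>shift_group H\<^esub> h = f \<otimes>\<^bsub>shift_group H\<^esub> (g \<otimes>\<^bsub>shift_group H\<^esub> h)"
    using f g h by (intro ext) (simp add: shift_group_carrier H.m_assoc)
next
  fix f assume f: "f \<in> carrier (shift_group H)"
  show "\<one>\<^bsub>shift_group H\<^esub> \<otimes>\<^bsub>shift_group H\<^esub> f = f"
    using f by (intro ext) (simp add: shift_group_carrier)
  show "\<exists>g\<in>carrier (shift_group H). g \<otimes>\<^bsub>shift_group H\<^esub> f = \<one>\<^bsub>shift_group H\<^esub>"
    using f shift_group_inv_closed[OF f]
    by (intro bexI[of _ "\<lambda>n. inv\<^bsub>H\<^esub> f n"] ext) (simp_all add: shift_group_carrier)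
qed (rule shift_group_mult_closed)

lemma shift_group_inv:
  assumes f: "f \<in> carrier (shift_group H)"
  shows "inv\<^bsub>shift_group H\<^esub> f = (\<lambda>n. inv\<^bsub>H\<^esub> f n)"
proof (rule group.inv_equality[OF shift_group_is_group _ f shift_group_inv_closed[OF f]])
  show "(\<lambda>n. inv\<^bsub>H\<^esub> f n) \<otimes>\<^bsub>shift_group H\<^esub> f = \<one>\<^bsub>shift_group H\<^esub>"
    using f by (intro ext) (simp add: shift_group_carrier)
qed

text \<open>For f in the group and varying i, a neighbourhood basis at f: the translates by f of the
  subgroups of functions supported at positions from i on.\<close>

definition agree :: "(int \<Rightarrow> 'c) \<Rightarrow> int \<Rightarrow> (int \<Rightarrow> 'c) set" where
  "agree f i = {g \<in> carrier (shift_group H). \<forall>k<i. g k = f k}"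

lemma openin_shift_compact_topology:
  "openin (shift_compact_topology H) V \<longleftrightarrow> V \<subseteq> shift_compact_subgroup H \<and>
    (\<forall>g\<in>V. \<exists>i. agree g i \<inter> shift_compact_subgroup H \<subseteq> V)" (is "?lhs \<longleftrightarrow> ?rhs")
proof
  assume ?lhs
  then obtain S where S: "openin (product_topology (\<lambda>_. discrete_topology (carrier H)) (UNIV :: int set)) S"
      "V = S \<inter> shift_compact_subgroup H"
    unfolding shift_compact_topology_def openin_subtopology by blast
  have "\<exists>i. agree g i \<inter> shift_compact_subgroup H \<subseteq> V" if g: "g \<in> V" for g
  proof -
    obtain U where U: "finite {k :: int. U k \<noteq> carrier H}" "g \<in> Pi\<^sub>E UNIV U" "Pi\<^sub>E UNIV U \<subseteq> S"
      using S g unfolding openin_product_topology_alt by fastforce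
    \<comment> \<open>A position beyond all constrained coordinates; the inserted 0 covers the case
      of no constraint.\<close>
    define i where "i = Max (insert 0 {k. U k \<noteq> carrier H}) + 1"
    have i: "k < i" if "U k \<noteq> carrier H" for k
    proof -
      have "k \<le> Max (insert 0 {k. U k \<noteq> carrier H})"
        using U(1) that by (intro Max_ge) auto
      then show ?thesis
        by (simp add: i_def)
    qed
    have "h \<in> V" if h: "h \<in> agree g i" "h \<in> shift_compact_subgroup H" for h
    proof -
      have "h k \<in> U k" for k
      proof (cases "U k = carrier H")
        case True
        then show ?thesis
          using h by (simp add: shift_compact_subgroup_def)
      next
        case False
        then have "h k = g k"
          using h(1) i unfolding agree_def by blast
        then show ?thesis
          using U(2) by auto
      qed
      then have "h \<in> S"
        using U(3) by auto
      then show ?thesis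
        using S h by blast
    qed
    then show ?thesis by blast
  qed
  then show ?rhs
    using S by blast
next
  assume R: ?rhs
  have "\<exists>S. openin (product_topology (\<lambda>_. discrete_topology (carrier H)) (UNIV :: int set)) S \<and>
      g \<in> S \<and> S \<inter> shift_compact_subgroup H \<subseteq> V" if g: "g \<in> V" for g
  proof -
    obtain i where i: "agree g i \<inter> shift_compact_subgroup H \<subseteq> V"
      using R g by blast
    have gK: "g \<in> shift_compact_subgroup H"
      using R g by blast
    \<comment> \<open>Negative coordinates are left free: elements of the compact subgroup are
      trivial there, so constraining finitely many coordinates suffices.\<close>
    define U where "U k = (if 0 \<le> k \<and> k < i then {g k} else carrier H)" for k
    have "finite {k. U k \<noteq> carrier H}"
      by (rule finite_subset[of _ "{0..<i}"]) (auto simp: U_def)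
    moreover have "openin (discrete_topology (carrier H)) (U k)" for k
      using gK by (auto simp: U_def shift_compact_subgroup_def)
    ultimately have "openin (product_topology (\<lambda>_. discrete_topology (carrier H)) UNIV) (Pi\<^sub>E UNIV U)"
      by (simp add: openin_PiE_gen)
    moreover have "g \<in> Pi\<^sub>E UNIV U"
      using gK by (auto simp: U_def shift_compact_subgroup_def)
    moreover have "Pi\<^sub>E UNIV U \<inter> shift_compact_subgroup H \<subseteq> V"
    proof
      fix h assume h: "h \<in> Pi\<^sub>E UNIV U \<inter> shift_compact_subgroup H"
      have "h k = g k" if "k < i" for k
      proof (cases "0 \<le> k")
        case True
        have "h k \<in> U k"
          using h by (auto simp: PiE_iff)
        then show ?thesis
          using True that by (simp add: U_def)
      qed (use h gK in \<open>simp add: shift_compact_subgroup_def\<close>)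
      moreover have "h \<in> carrier (shift_group H)"
        using h unfolding shift_group_carrier shift_compact_subgroup_def by blast
      ultimately show "h \<in> V"
        using i h unfolding agree_def by blast
    qed
    ultimately show ?thesis by blast
  qed
  then obtain S where S: "\<And>g. g \<in> V \<Longrightarrow>
      openin (product_topology (\<lambda>_. discrete_topology (carrier H)) (UNIV :: int set)) (S g) \<and>
      g \<in> S g \<and> S g \<inter> shift_compact_subgroup H \<subseteq> V"
    by metis
  have "V = (\<Union>g\<in>V. S g) \<inter> shift_compact_subgroup H"
    using S R by blast
  moreover have "openin (product_topology (\<lambda>_. discrete_topology (carrier H)) UNIV) (\<Union>g\<in>V. S g)"
    using S by blast
  ultimately show ?lhs
    unfolding shift_compact_topology_def openin_subtopology by blast
qed

lemma openin_shift_topology_iff: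
  "openin (shift_topology H) U \<longleftrightarrow> U \<subseteq> carrier (shift_group H) \<and> (\<forall>f\<in>U. \<exists>i. agree f i \<subseteq> U)"
  (is "?lhs \<longleftrightarrow> ?rhs")
proof
  assume L: ?lhs
  then have sub: "U \<subseteq> carrier (shift_group H)"
    by (simp add: openin_shift_topology)
  have "\<exists>i. agree f i \<subseteq> U" if f: "f \<in> U" for f
  proof -
    have fc: "f \<in> carrier (shift_group H)"
      using f sub by blast
    have "openin (shift_compact_topology H) {g \<in> shift_compact_subgroup H. f \<otimes>\<^bsub>shift_group H\<^esub> g \<in> U}"
      using L fc by (simp add: openin_shift_topology)
    moreover have "\<one>\<^bsub>shift_group H\<^esub> \<in> {g \<in> shift_compact_subgroup H. f \<otimes>\<^bsub>shift_group H\<^esub> g \<in> U}"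
    proof -
      have "f \<otimes>\<^bsub>shift_group H\<^esub> \<one>\<^bsub>shift_group H\<^esub> = f"
        using fc by (intro ext) (simp add: shift_group_carrier)
      then show ?thesis
        using f by (simp add: shift_compact_subgroup_def)
    qed
    ultimately obtain i where i: "agree \<one>\<^bsub>shift_group H\<^esub> i \<inter> shift_compact_subgroup H \<subseteq>
        {g \<in> shift_compact_subgroup H. f \<otimes>\<^bsub>shift_group H\<^esub> g \<in> U}"
      unfolding openin_shift_compact_topology by blast
    \<comment> \<open>Agreement at all negative positions puts the quotient h of g by f into the
      compact subgroup, to which the openness of U refers.\<close>
    have "g \<in> U" if g: "g \<in> agree f (max i 0)" for g
    proof -
      define h where "h n = inv\<^bsub>H\<^esub> f n \<otimes>\<^bsub>H\<^esub> g n" for n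
      have gc: "g \<in> carrier (shift_group H)" and eq: "\<And>k. k < max i 0 \<Longrightarrow> g k = f k"
        using g by (auto simp: agree_def)
      have hc: "h n \<in> carrier H" for n
        using gc fc by (simp add: h_def shift_group_carrier)
      have h1: "h n = \<one>\<^bsub>H\<^esub>" if "n < max i 0" for n
        using eq[OF that] fc by (simp add: h_def shift_group_carrier)
      have "h \<in> carrier (shift_group H)" "h \<in> shift_compact_subgroup H"
        using hc h1 unfolding shift_group_carrier shift_compact_subgroup_def by auto
      then have "h \<in> agree \<one>\<^bsub>shift_group H\<^esub> i \<inter> shift_compact_subgroup H"
        using h1 by (auto simp: agree_def)
      then have "f \<otimes>\<^bsub>shift_group H\<^esub> h \<in> U"
        using i by blast
      moreover have "f \<otimes>\<^bsub>shift_group H\<^esub> h = g"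
        using fc gc by (intro ext) (simp add: h_def shift_group_carrier H.inv_mult_cancel)
      ultimately show ?thesis by simp
    qed
    then show ?thesis by blast
  qed
  then show ?rhs
    using sub by blast
next
  assume R: ?rhs
  have "openin (shift_compact_topology H) {g \<in> shift_compact_subgroup H. f \<otimes>\<^bsub>shift_group H\<^esub> g \<in> U}"
    if f: "f \<in> carrier (shift_group H)" for f
    unfolding openin_shift_compact_topology
  proof (intro conjI ballI)
    fix g assume "g \<in> {g \<in> shift_compact_subgroup H. f \<otimes>\<^bsub>shift_group H\<^esub> g \<in> U}"
    then obtain i where i: "agree (f \<otimes>\<^bsub>shift_group H\<^esub> g) i \<subseteq> U"
      using R by blast
    have "f \<otimes>\<^bsub>shift_group H\<^esub> h \<in> agree (f \<otimes>\<^bsub>shift_group H\<^esub> g) i" if "h \<in> agree g i" for h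
      using that f shift_group_mult_closed[OF f] by (auto simp: agree_def)
    then show "\<exists>i. agree g i \<inter> shift_compact_subgroup H
        \<subseteq> {g \<in> shift_compact_subgroup H. f \<otimes>\<^bsub>shift_group H\<^esub> g \<in> U}"
      using i by blast
  qed blast
  then show ?lhs
    using R by (simp add: openin_shift_topology)
qed

lemma self_agree: "f \<in> carrier (shift_group H) \<Longrightarrow> f \<in> agree f i"
  by (simp add: agree_def)

lemma openin_agree: "openin (shift_topology H) (agree f i)"
proof -
  have "agree h i \<subseteq> agree f i" if "h \<in> agree f i" for h
    using that by (auto simp: agree_def)
  then show ?thesis
    unfolding openin_shift_topology_iff by (auto simp: agree_def[of f])
qed

lemma topspace_shift_topology: "topspace (shift_topology H) = carrier (shift_group H)"
proof
  show "topspace (shift_topology H) \<subseteq> carrier (shift_group H)"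
    using openin_topspace[of "shift_topology H"] unfolding openin_shift_topology_iff by blast
  have "openin (shift_topology H) (carrier (shift_group H))"
    unfolding openin_shift_topology_iff by (auto simp: agree_def)
  then show "carrier (shift_group H) \<subseteq> topspace (shift_topology H)"
    by (rule openin_subset)
qed

lemma continuous_map_shift_topology:
  assumes "\<And>x. x \<in> topspace X \<Longrightarrow> \<phi> x \<in> carrier (shift_group H)"
    and "\<And>x i. x \<in> topspace X \<Longrightarrow> \<exists>V. openin X V \<and> x \<in> V \<and> (\<forall>y\<in>V. \<forall>k<i. \<phi> y k = \<phi> x k)"
  shows "continuous_map X (shift_topology H) \<phi>"
proof (rule continuous_mapI_openin)
  fix U x assume U: "openin (shift_topology H) U" and x: "x \<in> topspace X" "\<phi> x \<in> U"
  then obtain i where i: "agree (\<phi> x) i \<subseteq> U"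
    unfolding openin_shift_topology_iff by blast
  obtain V where V: "openin X V" "x \<in> V" "\<forall>y\<in>V. \<forall>k<i. \<phi> y k = \<phi> x k"
    using assms(2)[OF x(1)] by blast
  have "\<phi> y \<in> U" if "y \<in> V" for y
    using that V i assms(1) openin_subset[OF V(1)] unfolding agree_def by blast
  then show "\<exists>V. openin X V \<and> x \<in> V \<and> (\<forall>y\<in>V. \<phi> y \<in> U)"
    using V by blast
qed (use assms(1) in \<open>simp add: topspace_shift_topology\<close>)

lemma topological_group_shift: "topological_group (shift_group H) (shift_topology H)"
  unfolding topological_group_def
proof (intro conjI shift_group_is_group topspace_shift_topology)
  show "continuous_map (prod_topology (shift_topology H) (shift_topology H)) (shift_topology H)
      (\<lambda>(x, y). x \<otimes>\<^bsub>shift_group H\<^esub> y)"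
  proof (rule continuous_map_shift_topology)
    fix z i assume "z \<in> topspace (prod_topology (shift_topology H) (shift_topology H))"
    then obtain f g where fg: "z = (f, g)" "f \<in> carrier (shift_group H)" "g \<in> carrier (shift_group H)"
      by (auto simp: topspace_shift_topology)
    have "openin (prod_topology (shift_topology H) (shift_topology H)) (agree f i \<times> agree g i)"
      by (simp add: openin_prod_Times_iff openin_agree)
    moreover have "\<forall>y\<in>agree f i \<times> agree g i. \<forall>k<i.
        (case y of (f, g) \<Rightarrow> f \<otimes>\<^bsub>shift_group H\<^esub> g) k = (case z of (f, g) \<Rightarrow> f \<otimes>\<^bsub>shift_group H\<^esub> g) k"
      by (auto simp: fg agree_def)
    ultimately show "\<exists>V. openin (prod_topology (shift_topology H) (shift_topology H)) V \<and> z \<in> V \<and>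
        (\<forall>y\<in>V. \<forall>k<i. (case y of (f, g) \<Rightarrow> f \<otimes>\<^bsub>shift_group H\<^esub> g) k =
          (case z of (f, g) \<Rightarrow> f \<otimes>\<^bsub>shift_group H\<^esub> g) k)"
      using fg self_agree by blast
  qed (auto simp: topspace_shift_topology shift_group_mult_closed)
  show "continuous_map (shift_topology H) (shift_topology H) (\<lambda>x. inv\<^bsub>shift_group H\<^esub> x)"
  proof (rule continuous_map_shift_topology)
    fix f i assume "f \<in> topspace (shift_topology H)"
    then have f: "f \<in> carrier (shift_group H)"
      by (simp add: topspace_shift_topology)
    have "\<forall>g\<in>agree f i. \<forall>k<i. (inv\<^bsub>shift_group H\<^esub> g) k = (inv\<^bsub>shift_group H\<^esub> f) k"
      using f by (auto simp: agree_def shift_group_inv)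
    then show "\<exists>V. openin (shift_topology H) V \<and> f \<in> V \<and>
        (\<forall>g\<in>V. \<forall>k<i. (inv\<^bsub>shift_group H\<^esub> g) k = (inv\<^bsub>shift_group H\<^esub> f) k)"
      using openin_agree[of f i] self_agree[OF f, of i] by blast
  qed (simp add: topspace_shift_topology shift_group_inv shift_group_inv_closed)
qed

lemma translate_shift_closed:
  assumes f: "f \<in> carrier (shift_group H)"
  shows "(\<lambda>n. f (n + d)) \<in> carrier (shift_group H)"
proof -
  obtain m where m: "\<forall>k<m. f k = \<one>\<^bsub>H\<^esub>"
    using f unfolding shift_group_carrier by blast
  then have "\<forall>k<m - d. f (k + d) = \<one>\<^bsub>H\<^esub>"
    by simp
  then show ?thesis
    using f unfolding shift_group_carrier by blast
qed

lemma continuous_map_translate_shift: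
  "continuous_map (shift_topology H) (shift_topology H) (\<lambda>f n. f (n + d))"
proof (rule continuous_map_shift_topology)
  fix f i assume f: "f \<in> topspace (shift_topology H)"
  have "\<forall>g\<in>agree f (i + d). \<forall>k<i. g (k + d) = f (k + d)"
    by (simp add: agree_def)
  then show "\<exists>V. openin (shift_topology H) V \<and> f \<in> V \<and> (\<forall>g\<in>V. \<forall>k<i. g (k + d) = f (k + d))"
    using openin_agree[of f "i + d"] self_agree[of f "i + d"] f
    unfolding topspace_shift_topology by blast
qed (simp add: topspace_shift_topology translate_shift_closed)

lemma right_shift_funpow: "(right_shift ^^ m) f n = f (n - int m)"
  by (induction m arbitrary: n) (simp_all add: right_shift_def algebra_simps)

lemma contraction_group_shift: "contraction_group (shift_group H) (shift_topology H) right_shift"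
proof -
  have rs: "right_shift = (\<lambda>f n. f (n + - 1))"
    by (intro ext) (simp add: right_shift_def)
  have maps: "homeomorphic_maps (shift_topology H) (shift_topology H) right_shift (\<lambda>f n. f (n + 1))"
    unfolding homeomorphic_maps_def rs
    by (intro conjI continuous_map_translate_shift) simp_all
  have "right_shift \<in> iso (shift_group H) (shift_group H)"
  proof (rule isoI)
    show "right_shift \<in> hom (shift_group H) (shift_group H)"
    proof (rule homI)
      show "right_shift f \<in> carrier (shift_group H)" if "f \<in> carrier (shift_group H)" for f
        unfolding rs by (rule translate_shift_closed[OF that])
    qed (auto simp: rs)
    show "bij_betw right_shift (carrier (shift_group H)) (carrier (shift_group H))"
      by (rule bij_betwI[where g = "\<lambda>f n. f (n + 1)"])
        (auto simp: rs simp del: add_uminus_conv_diff intro!: translate_shift_closed)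
  qed
  moreover have "contractive (shift_group H) (shift_topology H) right_shift"
    unfolding contractive_def limitin_def
  proof (intro ballI conjI allI impI)
    fix f assume f: "f \<in> carrier (shift_group H)"
    show "\<one>\<^bsub>shift_group H\<^esub> \<in> topspace (shift_topology H)"
      by (simp add: topspace_shift_topology shift_group_carrier)
    fix U assume "openin (shift_topology H) U \<and> \<one>\<^bsub>shift_group H\<^esub> \<in> U"
    then obtain i where i: "agree \<one>\<^bsub>shift_group H\<^esub> i \<subseteq> U"
      unfolding openin_shift_topology_iff by blast
    obtain m where m: "\<forall>k<m. f k = \<one>\<^bsub>H\<^esub>"
      using f unfolding shift_group_carrier by blast
    have "(right_shift ^^ n) f \<in> U" if n: "n \<ge> nat (i - m)" for n
    proof -
      have eq: "(right_shift ^^ n) f = (\<lambda>k. f (k + - int n))"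
        by (intro ext) (simp add: right_shift_funpow)
      have "f (k + - int n) = \<one>\<^bsub>H\<^esub>" if "k < i" for k
        using m that n by simp
      then have "(right_shift ^^ n) f \<in> agree \<one>\<^bsub>shift_group H\<^esub> i"
        unfolding eq agree_def using translate_shift_closed[OF f, of "- int n"] by simp
      then show ?thesis
        using i by blast
    qed
    then show "\<forall>\<^sub>F n in sequentially. (right_shift ^^ n) f \<in> U"
      unfolding eventually_sequentially by blast
  qed
  ultimately show ?thesis
    unfolding contraction_group_def
    using topological_group_shift homeomorphic_maps_map[THEN iffD1, OF maps] by blast
qed

end

text \<open>Transport of structure: conjugation by \<phi> turns the operations, the automorphism and
  its contractivity on H into those on Q, so that Q inherits being a contraction group.\<close>

lemma contraction_isomorphicI:
  assumes H: "contraction_group H S \<beta>" and Q: "group Q" and top: "topspace T = carrier Q"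
    and homeo: "homeomorphic_map T S \<phi>" and hom: "\<phi> \<in> hom Q H"
    and a: "\<And>x. x \<in> carrier Q \<Longrightarrow> a x \<in> carrier Q"
    and comm: "\<And>x. x \<in> carrier Q \<Longrightarrow> \<phi> (a x) = \<beta> (\<phi> x)"
  shows "contraction_isomorphic Q T a H S \<beta>"
proof -
  interpret Q: group Q by (rule Q)
  have grH: "group H" and topH: "topspace S = carrier H"
    and multH: "continuous_map (prod_topology S S) S (\<lambda>(x, y). x \<otimes>\<^bsub>H\<^esub> y)"
    and invH: "continuous_map S S (\<lambda>x. inv\<^bsub>H\<^esub> x)"
    and isoH: "\<beta> \<in> iso H H" and homeoH: "homeomorphic_map S S \<beta>" and conH: "contractive H S \<beta>"
    using H by (auto simp: contraction_group_def topological_group_def)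
  interpret H: group H by (rule grH)
  interpret gh: group_hom Q H \<phi>
    by (intro group_hom.intro group_hom_axioms.intro hom Q grH)
  obtain \<psi> where maps: "homeomorphic_maps T S \<phi> \<psi>"
    using homeo homeomorphic_map_maps by blast
  have c\<phi>: "continuous_map T S \<phi>" and c\<psi>: "continuous_map S T \<psi>"
    and \<psi>\<phi>: "\<And>x. x \<in> carrier Q \<Longrightarrow> \<psi> (\<phi> x) = x" and \<phi>\<psi>: "\<And>y. y \<in> carrier H \<Longrightarrow> \<phi> (\<psi> y) = y"
    using maps top topH by (auto simp: homeomorphic_maps_def)
  have \<phi>c: "\<phi> x \<in> carrier H" if "x \<in> carrier Q" for x
    using that by simp
  have \<psi>c: "\<psi> y \<in> carrier Q" if "y \<in> carrier H" for y
    using c\<psi> that top topH by (auto simp: continuous_map_def)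
  have hom\<psi>: "\<psi> \<in> hom H Q"
  proof (rule homI)
    fix y z assume yz: "y \<in> carrier H" "z \<in> carrier H"
    have "\<phi> (\<psi> y \<otimes>\<^bsub>Q\<^esub> \<psi> z) = y \<otimes>\<^bsub>H\<^esub> z"
      using yz by (simp add: \<psi>c \<phi>\<psi>)
    then show "\<psi> (y \<otimes>\<^bsub>H\<^esub> z) = \<psi> y \<otimes>\<^bsub>Q\<^esub> \<psi> z"
      using \<psi>\<phi>[of "\<psi> y \<otimes>\<^bsub>Q\<^esub> \<psi> z"] yz by (simp add: \<psi>c)
  qed (rule \<psi>c)
  have \<beta>c: "\<beta> y \<in> carrier H" if "y \<in> carrier H" for y
    using isoH that by (auto simp: iso_def hom_def)
  have comm\<psi>: "\<psi> (\<beta> y) = a (\<psi> y)" if "y \<in> carrier H" for y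
    using comm[of "\<psi> y"] \<psi>\<phi>[of "a (\<psi> y)"] that by (simp add: \<psi>c \<phi>\<psi> a)
  have a_eq: "(\<psi> \<circ> \<beta> \<circ> \<phi>) x = a x" if "x \<in> carrier Q" for x
    using that by (simp add: comm\<psi> \<psi>\<phi>)
  have homeo\<psi>: "homeomorphic_map S T \<psi>"
    using maps homeomorphic_maps_map homeomorphic_maps_sym by blast
  have "homeomorphic_map T T (\<psi> \<circ> (\<beta> \<circ> \<phi>))"
    by (rule homeomorphic_map_compose[OF homeomorphic_map_compose[OF homeo homeoH] homeo\<psi>])
  then have homeo_a: "homeomorphic_map T T a"
    by (rule homeomorphic_map_eq) (use a_eq top in auto)
  have "bij_betw a (carrier Q) (carrier Q)"
    using homeo_a top unfolding homeomorphic_map_def bij_betw_def quotient_map_def by simp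
  moreover have "a \<in> hom Q Q"
  proof (rule homI)
    fix x y assume xy: "x \<in> carrier Q" "y \<in> carrier Q"
    have "\<phi> (a (x \<otimes>\<^bsub>Q\<^esub> y)) = \<beta> (\<phi> x \<otimes>\<^bsub>H\<^esub> \<phi> y)"
      using xy by (simp add: comm)
    also have "\<dots> = \<beta> (\<phi> x) \<otimes>\<^bsub>H\<^esub> \<beta> (\<phi> y)"
      using isoH xy \<phi>c by (simp add: iso_def hom_mult)
    also have "\<dots> = \<phi> (a x \<otimes>\<^bsub>Q\<^esub> a y)"
      using xy by (simp add: comm a)
    finally show "a (x \<otimes>\<^bsub>Q\<^esub> y) = a x \<otimes>\<^bsub>Q\<^esub> a y"
      using xy a by (metis Q.m_closed \<psi>\<phi>)
  qed (rule a)
  ultimately have iso_a: "a \<in> iso Q Q"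
    by (simp add: iso_def)
  have multQ: "continuous_map (prod_topology T T) T (\<lambda>(x, y). x \<otimes>\<^bsub>Q\<^esub> y)"
  proof (rule continuous_map_eq)
    have "continuous_map (prod_topology T T) (prod_topology S S) (\<lambda>z. (\<phi> (fst z), \<phi> (snd z)))"
      using continuous_map_compose[OF continuous_map_fst c\<phi>] continuous_map_compose[OF continuous_map_snd c\<phi>]
      by (intro continuous_map_pairedI) (simp_all add: o_def)
    then show "continuous_map (prod_topology T T) T
        (\<psi> \<circ> ((\<lambda>(x, y). x \<otimes>\<^bsub>H\<^esub> y) \<circ> (\<lambda>z. (\<phi> (fst z), \<phi> (snd z)))))"
      by (rule continuous_map_compose[OF continuous_map_compose[OF _ multH] c\<psi>])
    show "(\<psi> \<circ> ((\<lambda>(x, y). x \<otimes>\<^bsub>H\<^esub> y) \<circ> (\<lambda>z. (\<phi> (fst z), \<phi> (snd z))))) z = (case z of (x, y) \<Rightarrow> x \<otimes>\<^bsub>Q\<^esub> y)"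
      if "z \<in> topspace (prod_topology T T)" for z
      using that top \<psi>\<phi> by (auto simp flip: gh.hom_mult)
  qed
  have invQ: "continuous_map T T (\<lambda>x. inv\<^bsub>Q\<^esub> x)"
  proof (rule continuous_map_eq)
    show "continuous_map T T (\<psi> \<circ> ((\<lambda>x. inv\<^bsub>H\<^esub> x) \<circ> \<phi>))"
      by (rule continuous_map_compose[OF continuous_map_compose[OF c\<phi> invH] c\<psi>])
    show "(\<psi> \<circ> ((\<lambda>x. inv\<^bsub>H\<^esub> x) \<circ> \<phi>)) z = inv\<^bsub>Q\<^esub> z" if "z \<in> topspace T" for z
      using that top \<psi>\<phi> by (simp flip: gh.hom_inv)
  qed
  have "contractive Q T a"
    unfolding contractive_def
  proof
    fix x assume x: "x \<in> carrier Q"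
    have "limitin S (\<lambda>n. (\<beta> ^^ n) (\<phi> x)) \<one>\<^bsub>H\<^esub> sequentially"
      using conH x \<phi>c by (simp add: contractive_def)
    then have "limitin T (\<psi> \<circ> (\<lambda>n. (\<beta> ^^ n) (\<phi> x))) (\<psi> \<one>\<^bsub>H\<^esub>) sequentially"
      by (rule continuous_map_limit[OF c\<psi>])
    moreover have "\<psi> ((\<beta> ^^ n) (\<phi> x)) = (a ^^ n) x \<and> (\<beta> ^^ n) (\<phi> x) \<in> carrier H" for n
      by (induction n) (use x in \<open>simp_all add: \<psi>\<phi> comm\<psi> \<beta>c\<close>)
    moreover have "\<psi> \<one>\<^bsub>H\<^esub> = \<one>\<^bsub>Q\<^esub>"
      using \<psi>\<phi>[of "\<one>\<^bsub>Q\<^esub>"] by simp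
    ultimately show "limitin T (\<lambda>n. (a ^^ n) x) \<one>\<^bsub>Q\<^esub> sequentially"
      by (simp add: o_def)
  qed
  then have "contraction_group Q T a"
    unfolding contraction_group_def topological_group_def
    using Q top multQ invQ iso_a homeo_a by blast
  moreover have "contraction_morphism Q T a H S \<beta> \<phi>" "contraction_morphism H S \<beta> Q T a \<psi>"
    using hom hom\<psi> c\<phi> c\<psi> comm comm\<psi> by (simp_all add: contraction_morphism_def)
  ultimately show ?thesis
    unfolding contraction_isomorphic_def using H \<psi>\<phi> \<phi>\<psi> by blast
qed

section \<open>Chief factors as topological groups\<close>

locale topologized_filtration = contraction_filtration +
  fixes T :: "'a topology"
  assumes openin_iff_B: "openin T U \<longleftrightarrow> U \<subseteq> carrier G \<and> (\<forall>u\<in>U. \<exists>j. \<forall>b\<in>B j. u \<otimes> b \<in> U)"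
begin

lemma openin_iff: "openin T U \<longleftrightarrow> U \<subseteq> carrier G \<and> (\<forall>u\<in>U. \<exists>n. \<forall>b\<in>F n. u \<otimes> b \<in> U)"
  unfolding openin_iff_B using B_subset_F F_subset_B by (meson subsetD)

lemma topspace_carrier: "topspace T = carrier G"
proof
  show "topspace T \<subseteq> carrier G"
    using openin_topspace[of T] unfolding openin_iff by blast
  have "openin T (carrier G)"
    unfolding openin_iff using F_carrier by blast
  then show "carrier G \<subseteq> topspace T"
    by (rule openin_subset)
qed

lemma stable_closedin:
  assumes "stable H"
  shows "closedin T H"
proof -
  have "\<exists>n. \<forall>b\<in>F n. u \<otimes> b \<in> carrier G - H" if u: "u \<in> carrier G - H" for u
  proof -
    have "u \<notin> cl H"
      using u assms by (auto simp: stable_def)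
    then obtain n where n: "\<And>h. h \<in> H \<Longrightarrow> inv h \<otimes> u \<notin> F n"
      using u unfolding cl_def by blast
    have "u \<otimes> b \<notin> H" if b: "b \<in> F n" for b
    proof
      assume "u \<otimes> b \<in> H"
      moreover have "inv (u \<otimes> b) \<otimes> u = inv b"
        using u F_carrier[OF b] by (simp add: group_normalize)
      ultimately show False
        using n subgroup.m_inv_closed[OF subgroup_F b] by metis
    qed
    then show ?thesis
      using u F_carrier by (intro exI[of _ n]) auto
  qed
  then have "openin T (carrier G - H)"
    unfolding openin_iff by blast
  then show ?thesis
    unfolding closedin_def topspace_carrier using subgroup.subset[OF stable_subgroup[OF assms]] by blast
qed

lemma openin_subgroup_iff:
  assumes M: "subgroup M G"
  shows "openin (subtopology T M) V \<longleftrightarrow> V \<subseteq> M \<and> (\<forall>u\<in>V. \<exists>n. \<forall>b\<in>F n \<inter> M. u \<otimes> b \<in> V)"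
proof
  assume "openin (subtopology T M) V"
  then obtain U where U: "openin T U" "V = U \<inter> M"
    unfolding openin_subtopology by blast
  have "\<exists>n. \<forall>b\<in>F n \<inter> M. u \<otimes> b \<in> V" if u: "u \<in> V" for u
  proof -
    obtain n where "\<forall>b\<in>F n. u \<otimes> b \<in> U"
      using U u unfolding openin_iff by blast
    then have "\<forall>b\<in>F n \<inter> M. u \<otimes> b \<in> V"
      using U u subgroup.m_closed[OF M, of u] by auto
    then show ?thesis ..
  qed
  then show "V \<subseteq> M \<and> (\<forall>u\<in>V. \<exists>n. \<forall>b\<in>F n \<inter> M. u \<otimes> b \<in> V)"
    using U by blast
next
  assume V: "V \<subseteq> M \<and> (\<forall>u\<in>V. \<exists>n. \<forall>b\<in>F n \<inter> M. u \<otimes> b \<in> V)"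
  have Mc: "u \<in> carrier G" if "u \<in> M" for u
    using that by (rule subgroup.mem_carrier[OF M])
  \<comment> \<open>The union of the cosets of \<open>F n\<close> through u, for those u in V and
    those n for which the part of the coset in M stays in V: an open set of the whole group with
    trace V on M.\<close>
  define U where "U = {u \<otimes> b | u b. u \<in> V \<and> (\<exists>n. b \<in> F n \<and> (\<forall>c\<in>F n \<inter> M. u \<otimes> c \<in> V))}"
  have "openin T U"
    unfolding openin_iff
  proof (intro conjI ballI)
    show "U \<subseteq> carrier G"
      unfolding U_def using V Mc F_carrier by auto
    fix w assume "w \<in> U"
    then obtain u b n where w: "w = u \<otimes> b" "u \<in> V" "b \<in> F n" "\<forall>c\<in>F n \<inter> M. u \<otimes> c \<in> V"
      unfolding U_def by blast
    have "w \<otimes> c \<in> U" if c: "c \<in> F n" for c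
    proof -
      have "w \<otimes> c = u \<otimes> (b \<otimes> c)"
        using w c V Mc F_carrier by (auto simp: m_assoc)
      moreover have "b \<otimes> c \<in> F n"
        by (rule subgroup.m_closed[OF subgroup_F w(3) c])
      ultimately show ?thesis
        unfolding U_def using w by blast
    qed
    then show "\<exists>n. \<forall>c\<in>F n. w \<otimes> c \<in> U"
      by blast
  qed
  moreover have "V = U \<inter> M"
  proof
    show "V \<subseteq> U \<inter> M"
    proof
      fix u assume u: "u \<in> V"
      then obtain n where "\<forall>c\<in>F n \<inter> M. u \<otimes> c \<in> V"
        using V by blast
      moreover have "\<one> \<in> F n"
        by (rule subgroup.one_closed[OF subgroup_F])
      moreover have "u = u \<otimes> \<one>"
        using u V Mc by auto
      ultimately show "u \<in> U \<inter> M"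
        unfolding U_def using u V by blast
    qed
    show "U \<inter> M \<subseteq> V"
    proof
      fix w assume w: "w \<in> U \<inter> M"
      then obtain u b n where ub: "w = u \<otimes> b" "u \<in> V" "b \<in> F n" "\<forall>c\<in>F n \<inter> M. u \<otimes> c \<in> V"
        unfolding U_def by blast
      have "u \<in> M"
        using ub V by blast
      then have "b \<in> M"
        using subgroup_mult_iff_left[OF M, of u b] w ub F_carrier by blast
      then show "w \<in> V"
        using ub by blast
    qed
  qed
  ultimately show "openin (subtopology T M) V"
    unfolding openin_subtopology by blast
qed

lemma minimal_factor_isomorphic_shift:
  assumes N: "stable N" "N \<lhd> G" and M: "minimal_over N M"
  shows "contraction_isomorphic (G\<lparr>carrier := M\<rparr> Mod N)
    (quotient_topology (subtopology T M) (\<lambda>x. N #> x)) (\<lambda>C. \<alpha> ` C)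
    (shift_group (integer_mod_group p)) (shift_topology (integer_mod_group p)) right_shift"
proof -
  obtain x where x: "x \<in> M" "x \<notin> N"
    using M by (auto simp: minimal_over_def)
  interpret minimal_factor G \<alpha> B p N M x
    by (intro minimal_factor.intro minimal_factor_axioms.intro contraction_filtration_axioms N M x)
  interpret N: normal N G
    by (rule normal_N)
  let ?Z = "integer_mod_group p"
  let ?S = "shift_group ?Z"
  let ?Q = "G\<lparr>carrier := M\<rparr> Mod N"
  let ?TQ = "quotient_topology (subtopology T M) (\<lambda>x. N #> x)"
  have topM: "topspace (subtopology T M) = M"
    using topspace_carrier subgroup.subset[OF subgroup_M] by (simp add: Int_absorb1)
  have carrierQ: "carrier ?Q = (\<lambda>u. N #> u) ` M"
    by (auto simp: FactGroup_def RCOSETS_def r_coset_def)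
  have topQ: "topspace ?TQ = carrier ?Q"
    by (simp only: topspace_quotient_topology topM carrierQ)
  have phi_diff: "\<phi> (inv u \<otimes> v) k = 0 \<longleftrightarrow> \<phi> v k = \<phi> u k" if uv: "u \<in> M" "v \<in> M" for u v k
  proof -
    have w: "inv u \<otimes> v \<in> M"
      using uv by (rule subgroup_inv_mult[OF subgroup_M])
    have "v = u \<otimes> (inv u \<otimes> v)"
      using uv M_carrier by (simp add: inv_mult_cancel)
    then have "\<phi> v k = (\<phi> u k + \<phi> (inv u \<otimes> v) k) mod int p"
      using phi_mult[OF uv(1) w] by simp
    moreover have range: "0 \<le> \<phi> w k" "\<phi> w k < int p" for w
      using digit_range unfolding \<phi>_def by auto
    ultimately show ?thesis
      using range[of u] range[of "inv u \<otimes> v"]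
      by (smt (verit) mod_pos_pos_trivial mod_add_self2 minus_mod_self2)
  qed
  have coset_eq: "N #> u = N #> v \<longleftrightarrow> \<phi> u = \<phi> v" if uv: "u \<in> M" "v \<in> M" for u v
  proof -
    have w: "inv u \<otimes> v \<in> M"
      using uv by (rule subgroup_inv_mult[OF subgroup_M])
    have c: "u \<in> carrier G" "v \<in> carrier G"
      using uv M_carrier by auto
    show ?thesis
    proof
      assume "N #> u = N #> v"
      then have "u \<in> N #> v"
        using rcos_self[OF c(1) subgroup_N] by simp
      then obtain n where n: "n \<in> N" "u = n \<otimes> v"
        unfolding r_coset_def by blast
      have "\<phi> n k = 0" for k
        using n(1) phi_kernel[of n] N_subset_M by blast
      then show "\<phi> u = \<phi> v"
        unfolding n(2) using phi_mult[of n v] n(1) N_subset_M uv(2) digit_range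
        by (intro ext) (auto simp: \<phi>_def)
    next
      assume "\<phi> u = \<phi> v"
      then have "inv u \<otimes> v \<in> N"
        using phi_kernel[OF w] phi_diff[OF uv] by simp
      then have "u \<otimes> (inv u \<otimes> v) \<otimes> inv u \<in> N"
        by (rule normal_invE(2)[OF normal_N c(1)])
      moreover have "v = u \<otimes> (inv u \<otimes> v) \<otimes> inv u \<otimes> u"
        using c by (simp add: group_normalize)
      ultimately have "v \<in> N #> u"
        unfolding r_coset_def by blast
      then show "N #> u = N #> v"
        by (rule repr_independence[OF _ c(1) subgroup_N])
    qed
  qed
  \<comment> \<open>The map induced on cosets; \<open>coset_eq\<close> makes it injective and
    independent of the representative.\<close>
  define \<Phi> where "\<Phi> D = \<phi> (SOME u. u \<in> M \<and> N #> u = D)" for D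
  have Phi: "\<Phi> (N #> u) = \<phi> u" if u: "u \<in> M" for u
  proof -
    have "(SOME v. v \<in> M \<and> N #> v = N #> u) \<in> M \<and> N #> (SOME v. v \<in> M \<and> N #> v = N #> u) = N #> u"
      using u by (intro someI_ex[of "\<lambda>v. v \<in> M \<and> N #> v = N #> u"]) blast
    then show ?thesis
      using coset_eq u unfolding \<Phi>_def by blast
  qed
  have grZ: "group ?Z"
    by simp
  have normalNM: "N \<lhd> G\<lparr>carrier := M\<rparr>"
    by (rule normal_restrict_supergroup[OF subgroup_M normal_N N_subset_M])
  show ?thesis
  proof (rule contraction_isomorphicI[where \<phi> = \<Phi>])
    show "contraction_group ?S (shift_topology ?Z) right_shift"
      by (rule contraction_group_shift[OF grZ])
    show "group ?Q"
      by (rule normal.factorgroup_is_group[OF normalNM])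
    show "topspace ?TQ = carrier ?Q"
      by (rule topQ)
    show "\<Phi> \<in> hom ?Q ?S"
    proof (rule homI)
      fix D E assume "D \<in> carrier ?Q" "E \<in> carrier ?Q"
      then obtain u v where uv: "D = N #> u" "u \<in> M" "E = N #> v" "v \<in> M"
        unfolding carrierQ by blast
      have "D \<otimes>\<^bsub>?Q\<^esub> E = D <#> E"
        by (simp add: FactGroup_def set_mult_def)
      also have "\<dots> = N #> (u \<otimes> v)"
        using uv M_carrier N.rcos_sum by simp
      finally have "\<Phi> (D \<otimes>\<^bsub>?Q\<^esub> E) = \<phi> (u \<otimes> v)"
        using Phi subgroup.m_closed[OF subgroup_M uv(2,4)] by simp
      then show "\<Phi> (D \<otimes>\<^bsub>?Q\<^esub> E) = \<Phi> D \<otimes>\<^bsub>?S\<^esub> \<Phi> E"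
        using uv Phi phi_mult[OF uv(2,4)] by (intro ext) (simp add: shift_group_mult[OF grZ])
    qed (auto simp: carrierQ Phi phi_range)
    show "\<alpha> ` D \<in> carrier ?Q" "\<Phi> (\<alpha> ` D) = right_shift (\<Phi> D)" if D: "D \<in> carrier ?Q" for D
    proof -
      obtain u where u: "D = N #> u" "u \<in> M"
        using D unfolding carrierQ by blast
      have \<alpha>u: "\<alpha> u \<in> M"
        using u(2) ap_M[OF M_carrier[OF u(2)], of 1] by simp
      have "\<alpha> ` D = (\<lambda>n. \<alpha> n \<otimes> \<alpha> u) ` N"
        unfolding u(1) r_coset_def using M_carrier[OF u(2)] stable_carrier[OF stable_N]
        by (auto simp: alpha_mult image_iff)
      also have "\<dots> = (\<lambda>n. n \<otimes> \<alpha> u) ` (\<alpha> ` N)"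
        by (simp add: image_image)
      also have "\<dots> = N #> \<alpha> u"
        using stable_N by (auto simp: stable_def r_coset_def)
      finally have eq: "\<alpha> ` D = N #> \<alpha> u" .
      then show "\<alpha> ` D \<in> carrier ?Q"
        unfolding carrierQ using \<alpha>u by blast
      show "\<Phi> (\<alpha> ` D) = right_shift (\<Phi> D)"
        unfolding eq using \<alpha>u u Phi phi_alpha by simp
    qed
    show "homeomorphic_map ?TQ (shift_topology ?Z) \<Phi>"
    proof (rule bijective_open_imp_homeomorphic_map)
      show "inj_on \<Phi> (topspace ?TQ)"
        unfolding topQ carrierQ
      proof (rule inj_onI, elim imageE)
        fix D E u v
        assume "\<Phi> D = \<Phi> E" "D = N #> u" "u \<in> M" "E = N #> v" "v \<in> M"
        then show "D = E"
          using coset_eq[of u v] Phi[of u] Phi[of v] by simp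
      qed
      show "\<Phi> ` topspace ?TQ = topspace (shift_topology ?Z)"
        unfolding topQ carrierQ topspace_shift_topology[OF grZ]
        using Phi phi_range phi_surj by (force simp: image_image)
      show "continuous_map ?TQ (shift_topology ?Z) \<Phi>"
      proof (rule continuous_map_shift_topology[OF grZ])
        show "\<Phi> D \<in> carrier ?S" if "D \<in> topspace ?TQ" for D
          using that unfolding topQ carrierQ by (auto simp: Phi phi_range)
        fix D i assume "D \<in> topspace ?TQ"
        then obtain u where u: "D = N #> u" "u \<in> M"
          unfolding topQ carrierQ by blast
        define V where "V = {E \<in> carrier ?Q. \<forall>k<i. \<Phi> E k = \<Phi> D k}"
        have "{v \<in> M. N #> v \<in> V} = {v \<in> M. \<forall>k<i. \<phi> v k = \<phi> u k}"
          using u by (auto simp: V_def carrierQ Phi)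
        moreover have "openin (subtopology T M) {v \<in> M. \<forall>k<i. \<phi> v k = \<phi> u k}"
          unfolding openin_subgroup_iff[OF subgroup_M]
        proof (intro conjI ballI)
          fix v assume v: "v \<in> {v \<in> M. \<forall>k<i. \<phi> v k = \<phi> u k}"
          obtain n where n: "\<forall>b\<in>M \<inter> F n. \<forall>k<i. \<phi> b k = 0"
            using phi_continuous by blast
          have "v \<otimes> b \<in> {v \<in> M. \<forall>k<i. \<phi> v k = \<phi> u k}" if b: "b \<in> F n \<inter> M" for b
          proof -
            have "\<phi> (v \<otimes> b) k = \<phi> u k" if "k < i" for k
              using n b v that phi_mult[of v b] digit_range unfolding \<phi>_def by auto
            then show ?thesis
              using b v subgroup.m_closed[OF subgroup_M] by blast
          qed
          then show "\<exists>n. \<forall>b\<in>F n \<inter> M. v \<otimes> b \<in> {v \<in> M. \<forall>k<i. \<phi> v k = \<phi> u k}"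
            by blast
        qed blast
        ultimately have "openin ?TQ V"
          unfolding openin_quotient_topology topM by (auto simp: V_def carrierQ)
        moreover have "D \<in> V"
          using u by (auto simp: V_def carrierQ)
        ultimately show "\<exists>V. openin ?TQ V \<and> D \<in> V \<and> (\<forall>E\<in>V. \<forall>k<i. \<Phi> E k = \<Phi> D k)"
          by (intro exI[of _ V]) (auto simp: V_def)
      qed
      show "open_map ?TQ (shift_topology ?Z) \<Phi>"
        unfolding open_map_def
      proof (intro allI impI)
        fix V assume V: "openin ?TQ V"
        then have VQ: "V \<subseteq> carrier ?Q"
          using openin_subset topQ by blast
        have VM: "openin (subtopology T M) {u \<in> M. N #> u \<in> V}"
          using V unfolding openin_quotient_topology topM by blast
        show "openin (shift_topology ?Z) (\<Phi> ` V)"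
          unfolding openin_shift_topology_iff[OF grZ]
        proof (intro conjI ballI)
          show "\<Phi> ` V \<subseteq> carrier ?S"
            using VQ unfolding carrierQ by (auto simp: Phi phi_range)
          fix f assume "f \<in> \<Phi> ` V"
          then obtain u where u: "u \<in> M" "N #> u \<in> V" "f = \<phi> u"
            using VQ unfolding carrierQ by (auto simp: Phi)
          obtain n where n: "\<And>b. b \<in> F n \<inter> M \<Longrightarrow> N #> (u \<otimes> b) \<in> V"
            using VM u unfolding openin_subgroup_iff[OF subgroup_M] by blast
          obtain i where i: "\<And>w. w \<in> M \<Longrightarrow> (\<forall>k<i. \<phi> w k = 0) \<Longrightarrow> w \<in> N <#> F n"
            using phi_open by blast
          have "g \<in> \<Phi> ` V" if g: "g \<in> agree ?Z f i" for g
          proof -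
            obtain v where v: "v \<in> M" "\<phi> v = g"
              using phi_surj g unfolding agree_def[OF grZ] by blast
            have w: "inv u \<otimes> v \<in> M"
              using u(1) v(1) by (rule subgroup_inv_mult[OF subgroup_M])
            have "\<forall>k<i. \<phi> (inv u \<otimes> v) k = 0"
              using phi_diff[OF u(1) v(1)] v(2) u(3) g unfolding agree_def[OF grZ] by blast
            then obtain a b where ab: "a \<in> N" "b \<in> F n" "inv u \<otimes> v = a \<otimes> b"
              using i[OF w] unfolding set_mult_def by blast
            have c: "u \<in> carrier G" "v \<in> carrier G" "a \<in> carrier G" "b \<in> carrier G"
              using u v ab M_carrier F_carrier stable_carrier[OF stable_N] by auto
            have "b \<in> M"
              using subgroup_mult_iff_left[OF subgroup_M, of a b] w ab c N_subset_M by auto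
            then have "N #> (u \<otimes> b) \<in> V"
              using n ab by blast
            \<comment> \<open>Normality moves the factor a past u, so v differs from
              \<open>u \<otimes> b\<close> by a left factor in N.\<close>
            moreover have "N #> (u \<otimes> b) = N #> v"
            proof -
              have "v = u \<otimes> (a \<otimes> b)"
                using ab(3) c by (metis inv_mult_cancel(2))
              also have "\<dots> = (u \<otimes> a \<otimes> inv u) \<otimes> (u \<otimes> b)"
                using c by (simp add: group_normalize)
              finally have "v = (u \<otimes> a \<otimes> inv u) \<otimes> (u \<otimes> b)" .
              then have "v \<in> N #> (u \<otimes> b)"
                using normal_invE(2)[OF normal_N c(1) ab(1)] unfolding r_coset_def by blast
              then show ?thesis
                using c by (intro repr_independence subgroup_N) auto
            qed
            ultimately show ?thesis
              using v Phi[OF v(1)] by force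
          qed
          then show "\<exists>i. agree ?Z f i \<subseteq> \<Phi> ` V"
            by blast
        qed
      qed
    qed
  qed
qed

text \<open>The series is a chief series of length n. Its factors have exponent p, which makes
  \<open>p ^ n\<close> an exponent of G, and they are central, which puts the i-th derived subgroup
  into the term with index \<open>n - i\<close>.\<close>

theorem contraction_structure:
  "torsion_group G \<and> finite_exponent G \<and> solvable G \<and>
    (\<exists>(n::nat) (Gs :: nat \<Rightarrow> 'a set).
       Gs 0 = {\<one>} \<and> Gs n = carrier G \<and>
       (\<forall>j\<le>n. subgroup (Gs j) G \<and> closedin T (Gs j) \<and> \<alpha> ` Gs j = Gs j) \<and>
       (\<forall>j\<in>{1..n}.
          Gs (j - 1) \<lhd> G\<lparr>carrier := Gs j\<rparr> \<and>
          contraction_isomorphic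
            (G\<lparr>carrier := Gs j\<rparr> Mod Gs (j - 1))
            (quotient_topology (subtopology T (Gs j)) (\<lambda>x. Gs (j - 1) #> x))
            (\<lambda>C. \<alpha> ` C)
            (shift_group (integer_mod_group p))
            (shift_topology (integer_mod_group p))
            right_shift))"
proof -
  obtain n and Gs :: "nat \<Rightarrow> 'a set" where Gs: "Gs 0 = {\<one>}" "Gs n = carrier G"
      "\<And>j. j \<le> n \<Longrightarrow> stable (Gs j) \<and> Gs j \<lhd> G"
      "\<And>j. j < n \<Longrightarrow> minimal_over (Gs j) (Gs (Suc j))"
    using ex_chief_series[OF stable_trivial one_is_normal] by metis
  have sub: "subgroup (Gs j) G" if "j \<le> n" for j
    using Gs(3)[OF that] stable_subgroup by blast
  have exponent: "u [^] (p ^ j) = \<one>" if "j \<le> n" "u \<in> Gs j" for j u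
    using that
  proof (induction j arbitrary: u)
    case 0
    then show ?case using Gs(1) by simp
  next
    case (Suc j)
    have uc: "u \<in> carrier G"
      using Suc.prems subgroup.mem_carrier[OF sub] by blast
    have "u [^] p \<in> Gs j"
      using minimal_over_exponent[of "Gs j" "Gs (Suc j)" u] Gs(3)[of j] Gs(4)[of j] Suc.prems by simp
    then have "(u [^] p) [^] (p ^ j) = \<one>"
      using Suc by simp
    then show ?case
      using uc by (simp add: nat_pow_pow)
  qed
  have p_power: "p ^ n > 0"
    using prime_gt_0_nat[OF prime_p] by simp
  have expG: "u [^] (p ^ n) = \<one>" if "u \<in> carrier G" for u
    using exponent[of n u] that Gs(2) by simp
  have derived_step: "derived G K \<subseteq> Gs j" if K: "K \<subseteq> Gs (Suc j)" and j: "Suc j \<le> n" for K j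
  proof -
    have "g \<otimes> h \<otimes> inv g \<otimes> inv h \<in> Gs j" if "g \<in> K" "h \<in> K" for g h
      using minimal_over_central[of "Gs j" "Gs (Suc j)" h g] Gs(3)[of j] Gs(4)[of j] that K j
        subgroup.mem_carrier[OF sub[OF j]] by auto
    then show ?thesis
      unfolding derived_def using sub[of j] j by (intro generate_subgroup_incl) auto
  qed
  have "i \<le> n \<Longrightarrow> (derived G ^^ i) (carrier G) \<subseteq> Gs (n - i)" for i
  proof (induction i)
    case 0
    then show ?case using Gs(2) by simp
  next
    case (Suc i)
    then have "(derived G ^^ i) (carrier G) \<subseteq> Gs (Suc (n - Suc i))"
      by (simp add: Suc_diff_Suc)
    then show ?case
      using derived_step[of _ "n - Suc i"] Suc.prems by simp
  qed
  from this[of n] have "(derived G ^^ n) (carrier G) \<subseteq> {\<one>}"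
    using Gs(1) by simp
  moreover have "\<one> \<in> (derived G ^^ n) (carrier G)"
    using subgroup.one_closed[OF exp_of_derived_is_subgroup[OF subgroup_self]] .
  ultimately have "(derived G ^^ n) (carrier G) = {\<one>}"
    by blast
  then have "solvable G"
    using solvable_iff_trivial_derived_seq by blast
  moreover have "torsion_group G"
    unfolding torsion_group_def using expG p_power by blast
  moreover have "finite_exponent G"
    unfolding finite_exponent_def using expG p_power by blast
  moreover have "Gs (j - 1) \<lhd> G\<lparr>carrier := Gs j\<rparr> \<and>
          contraction_isomorphic
            (G\<lparr>carrier := Gs j\<rparr> Mod Gs (j - 1))
            (quotient_topology (subtopology T (Gs j)) (\<lambda>x. Gs (j - 1) #> x))
            (\<lambda>C. \<alpha> ` C)
            (shift_group (integer_mod_group p))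
            (shift_topology (integer_mod_group p))
            right_shift" if j: "j \<in> {1..n}" for j
  proof -
    obtain i where i: "j = Suc i" "i < n"
      using j by (cases j) auto
    have "Gs i \<subseteq> Gs (Suc i)"
      using Gs(4)[OF i(2)] by (auto simp: minimal_over_def)
    then have "Gs i \<lhd> G\<lparr>carrier := Gs (Suc i)\<rparr>"
      using Gs(3)[of i] i(2) sub[of "Suc i"] by (intro normal_restrict_supergroup) auto
    then show ?thesis
      using minimal_factor_isomorphic_shift[of "Gs i" "Gs (Suc i)"] Gs(3)[of i] Gs(4)[OF i(2)] i
      by simp
  qed
  moreover have "subgroup (Gs j) G \<and> closedin T (Gs j) \<and> \<alpha> ` Gs j = Gs j" if "j \<le> n" for j
    using Gs(3)[OF that] stable_closedin by (simp add: stable_def)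
  ultimately show ?thesis
    using Gs(1,2) by blast
qed

end

section \<open>Lattices and strict differentiability\<close>

text \<open>\<open>L\<close> plays the role of the unit ball of a norm; the scaled lattices \<open>E j\<close> are the small balls.\<close>

locale scaled_lattice = vector_space sE
  for sE :: "'k::{field, topological_ab_group_add, topological_monoid_mult} \<Rightarrow> 'e::{topological_ab_group_add, t2_space} \<Rightarrow> 'e" +
  fixes \<pi> :: 'k and L :: "'e set"
  assumes continuous_scale: "continuous_on UNIV (\<lambda>(t, x). sE t x)"
    and pi_nonzero: "\<pi> \<noteq> 0"
    and pi_limit: "(\<lambda>j. \<pi> ^ j) \<longlonglongrightarrow> 0"
    and compact_L: "compact L" and open_L: "open L"
    and L_zero: "0 \<in> L" and L_add: "x \<in> L \<Longrightarrow> y \<in> L \<Longrightarrow> x + y \<in> L"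
    and L_minus: "x \<in> L \<Longrightarrow> - x \<in> L" and L_scale: "x \<in> L \<Longrightarrow> sE \<pi> x \<in> L"
begin

definition E :: "nat \<Rightarrow> 'e set" where
  "E j = {x. sE (inverse \<pi> ^ j) x \<in> L}"

lemma continuous_on_scale [continuous_intros]:
  assumes "continuous_on S f" "continuous_on S g"
  shows "continuous_on S (\<lambda>x. sE (f x) (g x))"
proof -
  have "continuous_on S ((\<lambda>(t, x). sE t x) \<circ> (\<lambda>x. (f x, g x)))"
    using assms
    by (intro continuous_on_compose continuous_on_Pair continuous_on_subset[OF continuous_scale]) auto
  then show ?thesis
    by (simp add: o_def)
qed

lemma scale_inverse_cancel [simp]:
  "sE (\<pi> ^ j) (sE (inverse \<pi> ^ j) x) = x" "sE (inverse \<pi> ^ j) (sE (\<pi> ^ j) x) = x"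
  using pi_nonzero by (simp_all flip: power_mult_distrib)

lemma E_0: "E 0 = L"
  by (simp add: E_def)

lemma E_zero [simp]: "0 \<in> E j"
  by (simp add: E_def L_zero)

lemma E_add: "x \<in> E j \<Longrightarrow> y \<in> E j \<Longrightarrow> x + y \<in> E j"
  by (simp add: E_def L_add scale_right_distrib)

lemma E_minus: "x \<in> E j \<Longrightarrow> - x \<in> E j"
  by (simp add: E_def L_minus)

lemma E_diff: "x \<in> E j \<Longrightarrow> y \<in> E j \<Longrightarrow> x - y \<in> E j"
  using E_add[of x j "- y"] E_minus by simp

lemma scale_mem_E: "sE (\<pi> ^ i) x \<in> E (j + i) \<longleftrightarrow> x \<in> E j"
  by (simp add: E_def power_add) (metis scale_inverse_cancel(2) scale_scale)

lemma E_eq_image: "E (j + i) = sE (\<pi> ^ i) ` E j"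
proof -
  have "x \<in> sE (\<pi> ^ i) ` E j" if "x \<in> E (j + i)" for x
  proof (rule image_eqI)
    show "x = sE (\<pi> ^ i) (sE (inverse \<pi> ^ i) x)"
      by (simp only: scale_inverse_cancel)
    then show "sE (inverse \<pi> ^ i) x \<in> E j"
      using that scale_mem_E by metis
  qed
  then show ?thesis
    using scale_mem_E by blast
qed

lemma E_antimono: "i \<le> j \<Longrightarrow> E j \<subseteq> E i"
proof (rule lift_Suc_antimono_le[of E])
  fix n
  show "E (Suc n) \<subseteq> E n"
  proof
    fix x assume "x \<in> E (Suc n)"
    then have "sE \<pi> (sE (inverse \<pi> ^ Suc n) x) \<in> L"
      using L_scale[of "sE (inverse \<pi> ^ Suc n) x"] unfolding E_def by blast
    moreover have "sE \<pi> (sE (inverse \<pi> ^ Suc n) x) = sE (inverse \<pi> ^ n) x"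
      using pi_nonzero by simp
    ultimately show "x \<in> E n"
      unfolding E_def by (metis mem_Collect_eq)
  qed
qed

lemma open_E: "open (E j)"
proof -
  have "open ((\<lambda>x. sE (inverse \<pi> ^ j) x) -` L)"
    by (rule open_vimage[OF open_L]) (intro continuous_intros)
  then show ?thesis
    by (simp add: E_def vimage_def)
qed

lemma compact_E: "compact (E j)"
proof -
  have "compact (sE (\<pi> ^ j) ` E 0)"
    by (rule compact_continuous_image) (auto intro!: continuous_intros simp: E_0 compact_L)
  then show ?thesis
    using E_eq_image[of 0 j] by simp
qed

text \<open>A tube lemma: the compact slice of D over x0 and 0 has a product neighbourhood inside D,
  given by some \<open>N J\<close> and by a tail of the null sequence of powers of \<pi>.\<close>

lemma compact_uniform:
  fixes N :: "nat \<Rightarrow> 'x::topological_space set" and Y :: "'y::topological_space set"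
  assumes N: "\<And>i j. i \<le> j \<Longrightarrow> N j \<subseteq> N i" "\<And>V. open V \<Longrightarrow> x0 \<in> V \<Longrightarrow> \<exists>j. N j \<subseteq> V"
    and Y: "compact Y" and D: "open D" "\<And>y. y \<in> Y \<Longrightarrow> (x0, y, 0) \<in> D"
  shows "\<exists>J. \<forall>j\<ge>J. \<forall>x\<in>N J. \<forall>y\<in>Y. (x, y, \<pi> ^ j) \<in> D"
proof -
  have "\<exists>J V. open V \<and> y \<in> V \<and> (\<forall>j\<ge>J. \<forall>x\<in>N J. \<forall>y\<in>V. (x, y, \<pi> ^ j) \<in> D)" if y: "y \<in> Y" for y
  proof -
    obtain A R where AR: "open A" "open R" "x0 \<in> A" "(y, 0) \<in> R" "A \<times> R \<subseteq> D"
      using open_prod_elim[OF D(1) D(2)[OF y]] by (metis SigmaE2)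
    obtain V C where VC: "open V" "open C" "y \<in> V" "0 \<in> C" "V \<times> C \<subseteq> R"
      using open_prod_elim[OF AR(2,4)] by (metis SigmaE2)
    obtain j1 where j1: "N j1 \<subseteq> A"
      using N(2) AR by blast
    obtain j2 where j2: "\<And>j. j \<ge> j2 \<Longrightarrow> \<pi> ^ j \<in> C"
      using topological_tendstoD[OF pi_limit VC(2,4)] unfolding eventually_sequentially by blast
    have "(x, y, \<pi> ^ j) \<in> D" if "j \<ge> max j1 j2" "x \<in> N (max j1 j2)" "y \<in> V" for j x y
    proof -
      have "x \<in> A"
        using that(2) N(1)[of j1 "max j1 j2"] j1 by auto
      moreover have "(y, \<pi> ^ j) \<in> R"
        using that j2[of j] VC(5) by auto
      ultimately show ?thesis
        using AR(5) by blast
    qed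
    then show ?thesis
      using VC by blast
  qed
  then obtain J V where JV: "\<And>y. y \<in> Y \<Longrightarrow> open (V y)" "\<And>y. y \<in> Y \<Longrightarrow> y \<in> V y"
      "\<And>y j x z. y \<in> Y \<Longrightarrow> j \<ge> J y \<Longrightarrow> x \<in> N (J y) \<Longrightarrow> z \<in> V y \<Longrightarrow> (x, z, \<pi> ^ j) \<in> D"
    by metis
  obtain Y' where Y': "Y' \<subseteq> Y" "finite Y'" "Y \<subseteq> (\<Union>y\<in>Y'. V y)"
    using compactE_image[OF Y, of Y V] JV by blast
  define M where "M = Max (insert 0 (J ` Y'))"
  have M: "J y \<le> M" if "y \<in> Y'" for y
    unfolding M_def using Y' that by (intro Max_ge) auto
  have "(x, y, \<pi> ^ j) \<in> D" if xy: "j \<ge> M" "x \<in> N M" "y \<in> Y" for j x y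
  proof -
    obtain z where z: "z \<in> Y'" "y \<in> V z"
      using Y' xy by blast
    have "x \<in> N (J z)"
      using N(1)[OF M[OF z(1)]] xy by blast
    then show ?thesis
      using JV(3)[of z j x y] z Y' M[OF z(1)] xy by auto
  qed
  then show ?thesis by blast
qed

text \<open>Scalar multiplication is continuous at (0, y), uniformly for y in the compact set L. The
  first coordinate in D is a dummy that fits \<open>compact_uniform\<close>.\<close>

lemma E_base:
  assumes V: "open V" "0 \<in> V"
  shows "\<exists>j. E j \<subseteq> V"
proof -
  define D where "D = (\<lambda>(x :: 'e, y, t). sE t y) -` V"
  have "open D"
    unfolding D_def case_prod_unfold
    by (rule open_vimage[OF V(1)]) (intro continuous_intros)
  moreover have "(0, y, 0) \<in> D" for y
    using V by (simp add: D_def)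
  ultimately obtain J where "\<forall>j\<ge>J. \<forall>x\<in>{0}. \<forall>y\<in>L. (x, y, \<pi> ^ j) \<in> D"
    using compact_uniform[of "\<lambda>_. {0}" 0 L D] compact_L by blast
  then have "sE (\<pi> ^ J) ` L \<subseteq> V"
    by (auto simp: D_def)
  then show ?thesis
    using E_eq_image[of 0 J] by (intro exI[of _ J]) (simp add: E_0)
qed

lemma E_base_at:
  assumes V: "open V" "x0 \<in> V"
  shows "\<exists>j. \<forall>v\<in>E j. x0 + v \<in> V"
proof -
  have "open ((\<lambda>v. x0 + v) -` V)"
    by (rule open_vimage[OF V(1)]) (intro continuous_intros)
  then show ?thesis
    using E_base[of "(\<lambda>v. x0 + v) -` V"] V(2) by auto
qed

text \<open>Here \<open>h\<close> is the derivative of \<open>f\<close> at \<open>x0\<close>, prescribed on the compact set \<open>Y\<close> of directions;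
  the estimate is strict differentiability of \<open>f\<close> at \<open>x0\<close>, uniformly in these directions.\<close>

lemma C1_on_uniform:
  fixes f :: "'x::{ab_group_add, topological_space} \<Rightarrow> 'e" and sX :: "'k \<Rightarrow> 'x \<Rightarrow> 'x"
  assumes f: "C1_on sX sE U f" and x0: "x0 \<in> U"
    and sX: "continuous_on UNIV (\<lambda>(t, x). sX t x)" "\<And>y. sX 0 y = 0"
    and plus: "continuous_on UNIV (\<lambda>z :: 'x \<times> 'x. fst z + snd z)"
    and N: "\<And>i j. i \<le> j \<Longrightarrow> N j \<subseteq> N i" "\<And>V. open V \<Longrightarrow> x0 \<in> V \<Longrightarrow> \<exists>j. N j \<subseteq> V"
    and Y: "compact Y" and h: "continuous_on UNIV h"
      "\<And>y. y \<in> Y \<Longrightarrow> \<exists>J. \<forall>j\<ge>J. f (x0 + sX (\<pi> ^ j) y) - f x0 = sE (\<pi> ^ j) (h y)"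
  shows "\<exists>J. \<forall>j\<ge>J. \<forall>x\<in>N J. \<forall>y\<in>Y. x \<in> U \<and> x + sX (\<pi> ^ j) y \<in> U \<and>
    f (x + sX (\<pi> ^ j) y) - f x - sE (\<pi> ^ j) (h y) \<in> E (j + m)"
proof -
  define D where "D = {(x, y, t). x \<in> U \<and> x + sX t y \<in> U}"
  obtain f1 where f1: "continuous_on D f1"
      "\<And>x y t. x \<in> U \<Longrightarrow> x + sX t y \<in> U \<Longrightarrow> t \<noteq> 0 \<Longrightarrow> f1 (x, y, t) = sE (1 / t) (f (x + sX t y) - f x)"
    using f unfolding C1_on_def D_def by blast
  have openU: "open U"
    using f by (simp add: C1_on_def)
  have cont_sX: "continuous_on UNIV (\<lambda>z :: 'x \<times> 'x \<times> 'k. sX (snd (snd z)) (fst (snd z)))"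
  proof -
    have "continuous_on UNIV ((\<lambda>(t, x). sX t x) \<circ> (\<lambda>z :: 'x \<times> 'x \<times> 'k. (snd (snd z), fst (snd z))))"
      by (intro continuous_on_compose continuous_on_subset[OF sX(1)] continuous_intros) auto
    then show ?thesis
      by (simp add: o_def)
  qed
  have cont_plus: "continuous_on UNIV (\<lambda>z :: 'x \<times> 'x \<times> 'k. fst z + sX (snd (snd z)) (fst (snd z)))"
  proof -
    have "continuous_on UNIV ((\<lambda>z. fst z + snd z) \<circ> (\<lambda>z :: 'x \<times> 'x \<times> 'k. (fst z, sX (snd (snd z)) (fst (snd z)))))"
      by (intro continuous_on_compose continuous_on_subset[OF plus] continuous_intros cont_sX) auto
    then show ?thesis
      by (simp add: o_def)
  qed
  have openD: "open D"
  proof -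
    have "open ((\<lambda>z :: 'x \<times> 'x \<times> 'k. fst z) -` U \<inter> (\<lambda>z. fst z + sX (snd (snd z)) (fst (snd z))) -` U)"
      by (intro open_Int open_vimage[OF openU] continuous_intros cont_plus)
    moreover have "(\<lambda>z :: 'x \<times> 'x \<times> 'k. fst z) -` U \<inter> (\<lambda>z. fst z + sX (snd (snd z)) (fst (snd z))) -` U = D"
      by (auto simp: D_def)
    ultimately show ?thesis by simp
  qed
  \<comment> \<open>The difference quotients along the powers of \<pi> tend to the value of
    \<open>f1\<close> at scalar 0 and are eventually equal to \<open>h y\<close>.\<close>
  have f1_x0: "f1 (x0, y, 0) = h y" if y: "y \<in> Y" for y
  proof -
    have D0: "(x0, y, 0) \<in> D"
      using x0 sX(2) by (simp add: D_def)
    have lim: "(\<lambda>j. (x0, y, \<pi> ^ j)) \<longlonglongrightarrow> (x0, y, 0)"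
      by (intro tendsto_intros pi_limit)
    have ev: "\<forall>\<^sub>F j in sequentially. (x0, y, \<pi> ^ j) \<in> D"
      using topological_tendstoD[OF lim openD D0] .
    have lim1: "(\<lambda>j. f1 (x0, y, \<pi> ^ j)) \<longlonglongrightarrow> f1 (x0, y, 0)"
      by (rule continuous_on_tendsto_compose[OF f1(1) lim D0 ev])
    obtain J where J: "\<And>j. j \<ge> J \<Longrightarrow> f (x0 + sX (\<pi> ^ j) y) - f x0 = sE (\<pi> ^ j) (h y)"
      using h(2)[OF y] by blast
    have "\<forall>\<^sub>F j in sequentially. f1 (x0, y, \<pi> ^ j) = h y"
      using ev eventually_ge_at_top[of J]
    proof eventually_elim
      case (elim j)
      then show ?case
        using f1(2)[of x0 "\<pi> ^ j" y] J[of j] pi_nonzero by (simp add: D_def)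
    qed
    then have "(\<lambda>j. f1 (x0, y, \<pi> ^ j)) \<longlonglongrightarrow> h y"
      by (rule tendsto_eventually)
    then show ?thesis
      using lim1 LIMSEQ_unique by blast
  qed
  \<comment> \<open>On W the extended difference quotient differs from h by an element of
    \<open>E m\<close>; multiplication by the j-th power of \<pi> turns this into an error in
    \<open>E (j + m)\<close>.\<close>
  define W where "W = {z \<in> D. f1 z - h (fst (snd z)) \<in> E m}"
  have "open W"
  proof -
    have "continuous_on D (\<lambda>z. f1 z - h (fst (snd z)))"
      by (intro continuous_intros f1(1) continuous_on_compose2[OF h(1)]) auto
    then have "open (D \<inter> (\<lambda>z. f1 z - h (fst (snd z))) -` E m)"
      using continuous_on_open_vimage[OF openD] open_E by (metis Int_commute)
    moreover have "D \<inter> (\<lambda>z. f1 z - h (fst (snd z))) -` E m = W"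
      by (auto simp: W_def)
    ultimately show ?thesis by simp
  qed
  moreover have "(x0, y, 0) \<in> W" if "y \<in> Y" for y
    using f1_x0[OF that] x0 sX(2) by (simp add: W_def D_def)
  ultimately obtain J where J: "\<forall>j\<ge>J. \<forall>x\<in>N J. \<forall>y\<in>Y. (x, y, \<pi> ^ j) \<in> W"
    using compact_uniform[OF N(1) N(2) Y, where D = W] by blast
  have "x \<in> U \<and> x + sX (\<pi> ^ j) y \<in> U \<and>
      f (x + sX (\<pi> ^ j) y) - f x - sE (\<pi> ^ j) (h y) \<in> E (j + m)"
    if "j \<ge> J" "x \<in> N J" "y \<in> Y" for j x y
  proof -
    have z: "(x, y, \<pi> ^ j) \<in> W"
      using J that by blast
    then have U: "x \<in> U" "x + sX (\<pi> ^ j) y \<in> U"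
      by (auto simp: W_def D_def)
    have "f (x + sX (\<pi> ^ j) y) - f x = sE (\<pi> ^ j) (f1 (x, y, \<pi> ^ j))"
      using f1(2)[OF U] pi_nonzero by simp
    then have "f (x + sX (\<pi> ^ j) y) - f x - sE (\<pi> ^ j) (h y) = sE (\<pi> ^ j) (f1 (x, y, \<pi> ^ j) - h y)"
      by (simp add: scale_right_diff_distrib)
    then show ?thesis
      using z U scale_mem_E[of j _ m] by (simp add: W_def add.commute)
  qed
  then show ?thesis by blast
qed

text \<open>The extended difference quotient vanishes at \<open>(x0, 0, 0)\<close>, so it takes
  values in L for small directions and small scalars. A vector in \<open>E (j + J)\<close> is the
  j-th power of \<pi> times a direction in \<open>E J\<close>, so the loss c is J.\<close>

lemma C1_on_Lipschitz:
  assumes f: "C1_on sE sE U f" and x0: "x0 \<in> U"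
  shows "\<exists>c J. \<forall>j\<ge>J. \<forall>v\<in>E (j + c). x0 + v \<in> U \<and> f (x0 + v) - f x0 \<in> E j"
proof -
  define D where "D = {(x, y, t). x \<in> U \<and> x + sE t y \<in> U}"
  obtain f1 where f1: "continuous_on D f1"
      "\<And>x y t. x \<in> U \<Longrightarrow> x + sE t y \<in> U \<Longrightarrow> t \<noteq> 0 \<Longrightarrow> f1 (x, y, t) = sE (1 / t) (f (x + sE t y) - f x)"
    using f unfolding C1_on_def D_def by blast
  have openU: "open U"
    using f by (simp add: C1_on_def)
  have openD: "open D"
  proof -
    have "open ((\<lambda>z :: 'e \<times> 'e \<times> 'k. fst z) -` U \<inter> (\<lambda>z. fst z + sE (snd (snd z)) (fst (snd z))) -` U)"
      by (intro open_Int open_vimage[OF openU] continuous_intros)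
    moreover have "(\<lambda>z :: 'e \<times> 'e \<times> 'k. fst z) -` U \<inter> (\<lambda>z. fst z + sE (snd (snd z)) (fst (snd z))) -` U = D"
      by (auto simp: D_def)
    ultimately show ?thesis by simp
  qed
  have D0: "(x0, 0, t) \<in> D" for t
    using x0 by (simp add: D_def)
  have lim: "(\<lambda>j. (x0, 0 :: 'e, \<pi> ^ j)) \<longlonglongrightarrow> (x0, 0, 0)"
    by (intro tendsto_intros pi_limit)
  have "(\<lambda>j. f1 (x0, 0, \<pi> ^ j)) \<longlonglongrightarrow> f1 (x0, 0, 0)"
    using D0 by (intro continuous_on_tendsto_compose[OF f1(1) lim]) auto
  moreover have "f1 (x0, 0, \<pi> ^ j) = 0" for j
    using f1(2)[of x0 "\<pi> ^ j" 0] x0 pi_nonzero by simp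
  ultimately have f1_0: "f1 (x0, 0, 0) = 0"
    by (simp add: LIMSEQ_const_iff)
  define W where "W = D \<inter> f1 -` E 0"
  have openW: "open W"
    unfolding W_def using continuous_on_open_vimage[OF openD] f1(1) open_E by (metis Int_commute)
  \<comment> \<open>Here the direction y is the shrinking variable of
    \<open>compact_uniform\<close>, and the compact set is a single dummy point.\<close>
  have "\<exists>J. \<forall>j\<ge>J. \<forall>y\<in>E J. \<forall>u\<in>{0}. (y, u, \<pi> ^ j) \<in> {(y, u :: nat, t). (x0, y, t) \<in> W}"
  proof (rule compact_uniform[of E 0])
    show "open {(y, u :: nat, t). (x0, y, t) \<in> W}"
    proof -
      have "open ((\<lambda>z :: 'e \<times> nat \<times> 'k. (x0, fst z, snd (snd z))) -` W)"
        by (rule open_vimage[OF openW]) (intro continuous_intros)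
      moreover have "(\<lambda>z :: 'e \<times> nat \<times> 'k. (x0, fst z, snd (snd z))) -` W =
          {(y, u :: nat, t). (x0, y, t) \<in> W}"
        by auto
      ultimately show ?thesis by simp
    qed
  qed (use f1_0 D0 E_antimono E_base in \<open>auto simp: W_def\<close>)
  then obtain J where J: "\<And>j y. j \<ge> J \<Longrightarrow> y \<in> E J \<Longrightarrow> (x0, y, \<pi> ^ j) \<in> W"
    by auto
  have "x0 + v \<in> U \<and> f (x0 + v) - f x0 \<in> E j" if j: "j \<ge> J" and v: "v \<in> E (j + J)" for j v
  proof -
    obtain y where y: "y \<in> E J" "v = sE (\<pi> ^ j) y"
      using v E_eq_image[of J j] by (auto simp: add.commute)
    have W: "(x0, y, \<pi> ^ j) \<in> W"
      using J[OF j y(1)] .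
    then have U: "x0 + v \<in> U"
      using y by (auto simp: W_def D_def)
    have "f (x0 + v) - f x0 = sE (\<pi> ^ j) (f1 (x0, y, \<pi> ^ j))"
      using f1(2)[OF x0, of "\<pi> ^ j" y] U y(2) pi_nonzero by simp
    then show ?thesis
      using U W scale_mem_E[of j _ 0] by (simp add: W_def)
  qed
  then show ?thesis by blast
qed

end

section \<open>Local fields and the openness of coordinate lattices\<close>

context local_field
begin

lemma absval_1 [simp]: "absval 1 = 1"
  using absval_mult[of 1 1] absval_eq_0_iff[of 1] by simp

lemma absval_0 [simp]: "absval 0 = 0"
  by (simp add: absval_eq_0_iff)

lemma absval_pos: "x \<noteq> 0 \<Longrightarrow> 0 < absval x"
  using absval_nonneg[of x] absval_eq_0_iff[of x] by linarith

lemma absval_minus [simp]: "absval (- x) = absval x"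
proof -
  have "absval (- 1) ^ 2 = 1"
    using absval_mult[of "- 1" "- 1"] by (simp add: power2_eq_square)
  then have "absval (- 1) = 1"
    using absval_nonneg[of "- 1"] by (simp add: power2_eq_1_iff)
  then show ?thesis
    using absval_mult[of "- 1" x] by simp
qed

lemma absval_power: "absval (x ^ n) = absval x ^ n"
  by (induction n) (simp_all add: absval_mult)

lemma absval_inverse: "absval (inverse x) = inverse (absval x)"
proof (cases "x = 0")
  case False
  then have "absval x * absval (inverse x) = 1"
    by (simp flip: absval_mult)
  then show ?thesis
    by (simp add: inverse_unique)
qed simp

lemma open_absval_less: "open {t. absval t < r}"
proof -
  have "absval y < r" if "absval x < r" "absval (y - x) < r" for x y
    using absval_ultrametric[of "y - x" x] that by simp
  moreover have "0 < r" if "absval x < r" for x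
    using that absval_nonneg[of x] by linarith
  ultimately show ?thesis
    unfolding open_iff_absval by blast
qed

lemma closed_absval_le:
  assumes "0 \<le> r"
  shows "closed {t. absval t \<le> r}"
proof -
  have "r < absval y" if "r < absval x" "absval (y - x) < absval x" for x y
    using absval_ultrametric[of y "x - y"] that absval_minus[of "y - x"] by simp
  moreover have "0 < absval x" if "r < absval x" for x
    using that assms by linarith
  ultimately have "open {t. r < absval t}"
    unfolding open_iff_absval by blast
  then show ?thesis
    by (simp add: closed_def Compl_eq not_le)
qed

lemma ex_small: "\<exists>t. t \<noteq> 0 \<and> absval t < 1"
proof -
  obtain S :: "'k set" where "\<not> open S"
    using non_discrete by blast
  then obtain x where x: "x \<in> S" "\<And>\<epsilon>. \<epsilon> > 0 \<Longrightarrow> \<exists>y. absval (y - x) < \<epsilon> \<and> y \<notin> S"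
    unfolding open_iff_absval by blast
  obtain y where "absval (y - x) < 1" "y \<notin> S"
    using x(2)[of 1] by auto
  then show ?thesis
    using x(1) by (intro exI[of _ "y - x"]) auto
qed

lemma power_tendsto_zero:
  assumes "absval t < 1"
  shows "(\<lambda>j. t ^ j) \<longlonglongrightarrow> 0"
proof (rule topological_tendstoI)
  fix S :: "'k set" assume "open S" "0 \<in> S"
  then obtain \<epsilon> where e: "\<epsilon> > 0" "\<And>y. absval y < \<epsilon> \<Longrightarrow> y \<in> S"
    unfolding open_iff_absval by (metis diff_zero)
  have "(\<lambda>j. absval t ^ j) \<longlonglongrightarrow> 0"
    using assms absval_nonneg by (intro LIMSEQ_realpow_zero) auto
  then have "\<forall>\<^sub>F j in sequentially. absval t ^ j < \<epsilon>"
    using e(1) by (rule order_tendstoD(2))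
  then show "\<forall>\<^sub>F j in sequentially. t ^ j \<in> S"
    by eventually_elim (simp add: e absval_power)
qed

text \<open>Local compactness gives a small closed ball inside a compact set, and division by a
  power of t enlarges it to the unit ball.\<close>

lemma compact_unit_ball: "compact {t. absval t \<le> 1}"
proof -
  obtain U K where UK: "open U" "compact K" "(0 :: 'k) \<in> U" "U \<subseteq> K"
  proof -
    have "\<exists>U K. open U \<and> compact K \<and> (0 :: 'k) \<in> U \<and> U \<subseteq> K"
      using locally_compact unfolding locally_compact_space_def by simp
    then show ?thesis
      using that by blast
  qed
  obtain t where t: "t \<noteq> 0" "absval t < 1"
    using ex_small by blast
  obtain \<epsilon> where e: "\<epsilon> > 0" "\<And>y. absval y < \<epsilon> \<Longrightarrow> y \<in> U"
    using UK(1,3) unfolding open_iff_absval by (metis diff_zero)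
  obtain k where k: "absval t ^ k < \<epsilon>"
    using real_arch_pow_inv[OF e(1) t(2)] by blast
  define D where "D = {y. absval y \<le> absval t ^ k}"
  have "D \<subseteq> K"
    using e k UK(4) by (auto simp: D_def)
  then have "compact D"
    using compact_Int_closed[OF UK(2) closed_absval_le[OF zero_le_power[OF absval_nonneg], of t k]]
    by (simp add: D_def Int_absorb1)
  then have "compact ((\<lambda>y. inverse (t ^ k) * y) ` D)"
    by (rule compact_continuous_image[rotated]) (intro continuous_intros)
  moreover have "(\<lambda>y. inverse (t ^ k) * y) ` D = {t. absval t \<le> 1}"
  proof
    have tk: "absval t ^ k > 0"
      by (intro zero_less_power absval_pos t)
    show "(\<lambda>y. inverse (t ^ k) * y) ` D \<subseteq> {t. absval t \<le> 1}"
    proof clarify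
      fix y assume "y \<in> D"
      moreover have "absval (inverse (t ^ k) * y) = absval y / absval t ^ k"
        by (simp add: absval_mult absval_inverse absval_power divide_inverse mult.commute
            del: power_inverse)
      ultimately show "absval (inverse (t ^ k) * y) \<le> 1"
        using tk by (simp add: D_def)
    qed
    show "{t. absval t \<le> 1} \<subseteq> (\<lambda>y. inverse (t ^ k) * y) ` D"
    proof
      fix s assume "s \<in> {t. absval t \<le> 1}"
      then have "t ^ k * s \<in> D"
        using tk by (simp add: D_def absval_mult absval_power)
      moreover have "s = inverse (t ^ k) * (t ^ k * s)"
        using t by simp
      ultimately show "s \<in> (\<lambda>y. inverse (t ^ k) * y) ` D"
        by blast
    qed
  qed
  ultimately show ?thesis by simp
qed

lemma compact_unit_sphere: "compact {t. absval t = 1}"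
proof -
  have "closed (- {t. absval t < 1})"
    using open_absval_less by (simp add: closed_Compl)
  then have "compact ({t. absval t \<le> 1} \<inter> - {t. absval t < 1})"
    by (rule compact_Int_closed[OF compact_unit_ball])
  moreover have "{t. absval t \<le> 1} \<inter> - {t. absval t < 1} = {t. absval t = 1}"
    by auto
  ultimately show ?thesis by simp
qed

text \<open>The crucial point is that the unit ball \<open>L\<close> of the maximum norm with respect to a basis is open:
  \<open>0\<close> has a neighbourhood avoiding all small multiples of the unit sphere, because the sphere is compact.\<close>

lemma ex_scaled_lattice:
  fixes sE :: "'k \<Rightarrow> 'e::{topological_ab_group_add, t2_space} \<Rightarrow> 'e"
  assumes "fin_dim_tvs sE"
  shows "\<exists>\<pi> L. scaled_lattice sE \<pi> L"
proof -
  obtain Bs where "finite_dimensional_vector_space sE Bs"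
    using assms by (auto simp: fin_dim_tvs_def)
  then interpret V: finite_dimensional_vector_space sE Bs .
  have cont: "continuous_on UNIV (\<lambda>(t, x). sE t x)"
    using assms by (simp add: fin_dim_tvs_def)
  have cont_scale: "continuous_on S (\<lambda>x. sE (f x) (g x))"
    if "continuous_on S f" "continuous_on S g" for S :: "'x::topological_space set" and f g
  proof -
    have "continuous_on S ((\<lambda>(t, x). sE t x) \<circ> (\<lambda>x. (f x, g x)))"
      using that by (intro continuous_on_compose continuous_on_Pair continuous_on_subset[OF cont]) auto
    then show ?thesis
      by (simp add: o_def)
  qed
  define lat where "lat S D = {\<Sum>b\<in>S. sE (c b) b | c. \<forall>b\<in>S. c b \<in> D b}" for S and D :: "'e \<Rightarrow> 'k set"
  have compact_lat: "compact (lat S D)" if "finite S" "\<And>b. compact (D b)" for S D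
    using that(1)
  proof induction
    case empty
    then show ?case by (simp add: lat_def)
  next
    case (insert b S)
    have "lat (insert b S) D = (\<lambda>(t, v). sE t b + v) ` (D b \<times> lat S D)"
    proof
      show "lat (insert b S) D \<subseteq> (\<lambda>(t, v). sE t b + v) ` (D b \<times> lat S D)"
        using insert unfolding lat_def by (auto simp: image_iff)
      show "(\<lambda>(t, v). sE t b + v) ` (D b \<times> lat S D) \<subseteq> lat (insert b S) D"
      proof clarify
        fix t v assume t: "t \<in> D b" and "v \<in> lat S D"
        then obtain c where c: "v = (\<Sum>b\<in>S. sE (c b) b)" "\<forall>b\<in>S. c b \<in> D b"
          unfolding lat_def by blast
        have "(\<Sum>b'\<in>S. sE ((c(b := t)) b') b') = v"
          unfolding c(1) by (rule sum.cong) (use insert in auto)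
        then have "sE t b + v = (\<Sum>b'\<in>insert b S. sE ((c(b := t)) b') b')"
          using insert by simp
        moreover have "\<forall>b'\<in>insert b S. (c(b := t)) b' \<in> D b'"
          using c t by auto
        ultimately show "sE t b + v \<in> lat (insert b S) D"
          unfolding lat_def by blast
      qed
    qed
    moreover have "compact ((\<lambda>(t, v). sE t b + v) ` (D b \<times> lat S D))"
      unfolding case_prod_unfold
      by (intro compact_continuous_image compact_Times insert that continuous_on_add cont_scale continuous_intros)
    ultimately show ?case by simp
  qed
  define O1 where "O1 = {t. absval t \<le> 1}"
  define L where "L = lat Bs (\<lambda>_. O1)"
  \<comment> \<open>The unit sphere of the maximum norm: all coordinates have absolute value at most
    1, and at least one has absolute value 1.\<close>
  define S where "S = (\<Union>b0\<in>Bs. lat Bs (\<lambda>b. if b = b0 then {t. absval t = 1} else O1))"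
  have L_I: "(\<Sum>b\<in>Bs. sE (c b) b) \<in> L" if "\<forall>b\<in>Bs. c b \<in> O1" for c
    unfolding L_def lat_def using that by blast
  have coords: "\<exists>c. v = (\<Sum>b\<in>Bs. sE (c b) b)" for v
    using V.span_Basis V.span_finite[OF V.finite_Basis] by blast
  have compL: "compact L"
    unfolding L_def O1_def by (intro compact_lat V.finite_Basis compact_unit_ball)
  have "compact S"
    unfolding S_def O1_def
    by (intro compact_UN compact_lat V.finite_Basis) (simp add: compact_unit_ball compact_unit_sphere)
  then have "open (- S)"
    by (simp add: compact_imp_closed open_Compl)
  moreover have "0 \<notin> S"
  proof
    assume "0 \<in> S"
    then obtain b0 c where bc: "b0 \<in> Bs" "0 = (\<Sum>b\<in>Bs. sE (c b) b)" "absval (c b0) = 1"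
      unfolding S_def lat_def by fastforce
    then have "c b0 = 0"
      using V.independentD[OF V.independent_Basis V.finite_Basis subset_refl, of c b0] by simp
    then show False
      using bc(3) by simp
  qed
  ultimately have "open ((\<lambda>(t, x). sE t x) -` (- S))" "(0, 0) \<in> (\<lambda>(t, x). sE t x) -` (- S)"
    using cont by (auto intro: open_vimage)
  then obtain C V where CV: "open C" "open V" "(0 :: 'k) \<in> C" "(0 :: 'e) \<in> V" 
      "C \<times> V \<subseteq> (\<lambda>(t, x). sE t x) -` (- S)"
    by (metis open_prod_elim SigmaE2)
  obtain \<pi> where \<pi>: "\<pi> \<noteq> 0" "absval \<pi> < 1"
    using ex_small by blast
  obtain \<epsilon> where e: "\<epsilon> > 0" "\<And>y. absval y < \<epsilon> \<Longrightarrow> y \<in> C"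
    using CV(1,3) unfolding open_iff_absval by (metis diff_zero)
  obtain k where k: "absval \<pi> ^ k < \<epsilon>"
    using real_arch_pow_inv[OF e(1) \<pi>(2)] by blast
  have pk: "absval \<pi> ^ k > 0"
    by (intro zero_less_power absval_pos \<pi>)
  have V_L: "sE (\<pi> ^ k) v \<in> L" if v: "v \<in> V" for v
  proof -
    obtain c where c: "v = (\<Sum>b\<in>Bs. sE (c b) b)"
      using coords by blast
    \<comment> \<open>Otherwise division by the coordinate of largest absolute value takes v into S,
      although the inverse of that coordinate is small enough to lie in C, and the products of C
      with V avoid S.\<close>
    have bound: "absval (c b) * absval \<pi> ^ k \<le> 1" if b: "b \<in> Bs" for b
    proof (rule ccontr)
      assume large: "\<not> absval (c b) * absval \<pi> ^ k \<le> 1"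
      define m where "m = Max ((\<lambda>b. absval (c b)) ` Bs)"
      have fin: "finite ((\<lambda>b. absval (c b)) ` Bs)" "(\<lambda>b. absval (c b)) ` Bs \<noteq> {}"
        using V.finite_Basis b by auto
      have "m \<in> (\<lambda>b. absval (c b)) ` Bs"
        unfolding m_def using fin by (rule Max_in)
      then obtain b0 where b0: "b0 \<in> Bs" "absval (c b0) = m"
        by auto
      have m_ge: "absval (c b') \<le> m" if "b' \<in> Bs" for b'
        unfolding m_def using fin that by (intro Max_ge) auto
      have big: "m * absval \<pi> ^ k > 1"
        using large mult_right_mono[OF m_ge[OF b], of "absval \<pi> ^ k"] pk by linarith
      then have m_pos: "m > 0"
        using pk by (smt (verit) zero_less_mult_pos2)
      then have c0: "c b0 \<noteq> 0"
        using b0 by auto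
      have "inverse m < absval \<pi> ^ k"
        using big m_pos by (simp add: field_simps)
      then have "inverse (c b0) \<in> C"
        using e k b0 by (simp add: absval_inverse)
      then have "sE (inverse (c b0)) v \<notin> S"
        using CV(5) v by auto
      have "sE (inverse (c b0)) v = (\<Sum>b\<in>Bs. sE (inverse (c b0) * c b) b)"
        unfolding c by (simp add: V.scale_sum_right)
      moreover have "absval (inverse (c b0) * c b') \<le> 1" if "b' \<in> Bs" for b'
        using m_ge[OF that] m_pos unfolding absval_mult absval_inverse b0(2)
        by (simp add: inverse_eq_divide field_simps)
      moreover have "absval (inverse (c b0) * c b0) = 1"
        using c0 by simp
      ultimately have "sE (inverse (c b0)) v \<in> lat Bs (\<lambda>b. if b = b0 then {t. absval t = 1} else O1)"
        unfolding lat_def O1_def by (intro CollectI exI[of _ "\<lambda>b. inverse (c b0) * c b"]) simp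
      then show False
        using \<open>sE (inverse (c b0)) v \<notin> S\<close> b0(1) unfolding S_def by blast
    qed
    have "sE (\<pi> ^ k) v = (\<Sum>b\<in>Bs. sE (\<pi> ^ k * c b) b)"
      unfolding c by (simp add: V.scale_sum_right)
    moreover have "\<forall>b\<in>Bs. \<pi> ^ k * c b \<in> O1"
      using bound by (simp add: O1_def absval_mult absval_power mult.commute)
    ultimately show ?thesis
      using L_I[of "\<lambda>b. \<pi> ^ k * c b"] by simp
  qed
  have L_add: "x + y \<in> L" if xy: "x \<in> L" "y \<in> L" for x y
  proof -
    obtain c d where cd: "x = (\<Sum>b\<in>Bs. sE (c b) b)" "\<forall>b\<in>Bs. c b \<in> O1"
        "y = (\<Sum>b\<in>Bs. sE (d b) b)" "\<forall>b\<in>Bs. d b \<in> O1"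
      using xy unfolding L_def lat_def by blast
    have "x + y = (\<Sum>b\<in>Bs. sE (c b + d b) b)"
      unfolding cd by (simp add: V.scale_left_distrib sum.distrib)
    moreover have "\<forall>b\<in>Bs. c b + d b \<in> O1"
      using cd absval_ultrametric unfolding O1_def by (smt (verit) mem_Collect_eq)
    ultimately show ?thesis
      using L_I[of "\<lambda>b. c b + d b"] by simp
  qed
  have L_scale: "sE t x \<in> L" if t: "absval t \<le> 1" and x: "x \<in> L" for t x
  proof -
    obtain c where c: "x = (\<Sum>b\<in>Bs. sE (c b) b)" "\<forall>b\<in>Bs. c b \<in> O1"
      using x unfolding L_def lat_def by blast
    have "sE t x = (\<Sum>b\<in>Bs. sE (t * c b) b)"
      unfolding c by (simp add: V.scale_sum_right)
    moreover have "\<forall>b\<in>Bs. t * c b \<in> O1"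
      using c(2) t absval_nonneg unfolding O1_def by (simp add: absval_mult mult_le_one)
    ultimately show ?thesis
      using L_I[of "\<lambda>b. t * c b"] by simp
  qed
  have "open L"
  proof (subst open_subopen, intro ballI)
    fix x assume x: "x \<in> L"
    define A where "A = (\<lambda>y. sE (inverse (\<pi> ^ k)) (y - x)) -` V"
    have "open A"
      unfolding A_def by (rule open_vimage[OF CV(2)]) (intro cont_scale continuous_intros)
    moreover have "x \<in> A"
      using CV(4) by (simp add: A_def)
    moreover have "A \<subseteq> L"
    proof
      fix y assume "y \<in> A"
      then have "sE (\<pi> ^ k) (sE (inverse (\<pi> ^ k)) (y - x)) \<in> L"
        unfolding A_def by (intro V_L) simp
      then have "y - x \<in> L"
        using \<pi>(1) by simp
      then show "y \<in> L"
        using L_add[of "y - x" x] x by simp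
    qed
    ultimately show "\<exists>T. open T \<and> x \<in> T \<and> T \<subseteq> L"
      by blast
  qed
  moreover have "0 \<in> L"
    unfolding L_def lat_def O1_def by (auto intro!: exI[of _ "\<lambda>_. 0"])
  moreover have "- x \<in> L" if "x \<in> L" for x
    using L_scale[of "- 1" x] that by simp
  ultimately have "scaled_lattice sE \<pi> L"
    using L_add L_scale[of \<pi>] \<pi> cont compL power_tendsto_zero[OF \<pi>(2)]
    by unfold_locales auto
  then show ?thesis by blast
qed

end

section \<open>Lie groups in a chart\<close>

text \<open>The product estimate is relative to c alone: b only has to stay in a fixed ball, while
  the error lies m levels beyond the level of c. This is strict differentiability in one factor at a
  time, and it is what commutators with g in a fixed ball require.\<close>

locale lattice_chart = scaled_lattice sE \<pi> L + G: group G
  for sE :: "'k::{field, topological_ab_group_add, topological_monoid_mult} \<Rightarrow> 'e::{topological_ab_group_add, t2_space} \<Rightarrow> 'e"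
    and \<pi> L and G :: "('g, 'm) monoid_scheme" (structure) +
  fixes U :: "'g set" and \<kappa> :: "'g \<Rightarrow> 'e"
  assumes U_carrier: "U \<subseteq> carrier G" and one_U: "\<one> \<in> U" and kappa_one: "\<kappa> \<one> = 0"
    and mult_estimate: "\<exists>J. \<forall>j\<ge>J. \<forall>b c. b \<in> U \<longrightarrow> c \<in> U \<longrightarrow> \<kappa> b \<in> E J \<longrightarrow> \<kappa> c \<in> E j \<longrightarrow>
      c \<otimes> b \<in> U \<and> b \<otimes> c \<in> U \<and> \<kappa> (c \<otimes> b) - \<kappa> b - \<kappa> c \<in> E (j + m) \<and> \<kappa> (b \<otimes> c) - \<kappa> b - \<kappa> c \<in> E (j + m)"
    and inverse_estimate: "\<exists>J'. \<forall>a\<in>U. \<kappa> a \<in> E J' \<longrightarrow> inv a \<in> U \<and> \<kappa> (inv a) \<in> E J"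
begin

definition ball :: "nat \<Rightarrow> 'g set" where
  "ball j = {a \<in> U. \<kappa> a \<in> E j}"

lemma ball_carrier: "a \<in> ball j \<Longrightarrow> a \<in> carrier G"
  using U_carrier by (auto simp: ball_def)

lemma ball_antimono: "i \<le> j \<Longrightarrow> ball j \<subseteq> ball i"
  using E_antimono[of i j] by (auto simp: ball_def)

lemma one_ball: "\<one> \<in> ball j"
  by (simp add: ball_def one_U kappa_one)

lemma ball_mult_estimate:
  "\<exists>J. \<forall>j\<ge>J. \<forall>b\<in>ball J. \<forall>c\<in>ball j. c \<otimes> b \<in> U \<and> b \<otimes> c \<in> U \<and>
    \<kappa> (c \<otimes> b) - \<kappa> b - \<kappa> c \<in> E (j + m) \<and> \<kappa> (b \<otimes> c) - \<kappa> b - \<kappa> c \<in> E (j + m)"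
  using mult_estimate[of m] unfolding ball_def by blast

lemma subgroup_ball: "\<exists>J. \<forall>j\<ge>J. subgroup (ball j) G"
proof -
  obtain J where J: "\<And>j b c. j \<ge> J \<Longrightarrow> b \<in> ball J \<Longrightarrow> c \<in> ball j \<Longrightarrow>
      c \<otimes> b \<in> U \<and> \<kappa> (c \<otimes> b) - \<kappa> b - \<kappa> c \<in> E (j + 1)"
    using ball_mult_estimate[of 1] by blast
  obtain J' where J': "\<And>a. a \<in> ball J' \<Longrightarrow> inv a \<in> ball J"
    using inverse_estimate[of J] unfolding ball_def by blast
  have "subgroup (ball j) G" if j: "j \<ge> max J J'" for j
  proof (rule G.subgroupI)
    show "ball j \<subseteq> carrier G"
      using ball_carrier by blast
    show "ball j \<noteq> {}"
      using one_ball by blast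
    show "inv a \<in> ball j" if a: "a \<in> ball j" for a
    proof -
      have aJ: "a \<in> ball J" "a \<in> ball J'"
        using a j ball_antimono[of J j] ball_antimono[of J' j] by auto
      \<comment> \<open>Continuity gives only the crude bound \<open>ball J\<close> for the inverse.
        Since the product of the inverse with a has coordinate 0, each use of the estimate improves
        the bound by one level, up to level j.\<close>
      have "J \<le> i \<Longrightarrow> i \<le> j \<Longrightarrow> inv a \<in> ball i" for i
      proof (induction i rule: dec_induct)
        case base
        then show ?case using J' aJ by blast
      next
        case (step i)
        then have i: "inv a \<in> ball i"
          by simp
        have "\<kappa> (inv a \<otimes> a) - \<kappa> a - \<kappa> (inv a) \<in> E (i + 1)"
          using J[OF step(1) aJ(1) i] by blast
        then have "- \<kappa> a - \<kappa> (inv a) \<in> E (Suc i)"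
          using ball_carrier[OF a] by (simp add: kappa_one)
        moreover have "\<kappa> a \<in> E (Suc i)"
          using a step.prems E_antimono[of "Suc i" j] by (auto simp: ball_def)
        ultimately have "- ((- \<kappa> a - \<kappa> (inv a)) + \<kappa> a) \<in> E (Suc i)"
          by (intro E_minus E_add)
        then show ?case
          using i by (simp add: ball_def)
      qed
      then show ?thesis
        using j by simp
    qed
    show "a \<otimes> b \<in> ball j" if ab: "a \<in> ball j" "b \<in> ball j" for a b
    proof -
      have bJ: "b \<in> ball J"
        using ab j ball_antimono[of J j] by auto
      have *: "a \<otimes> b \<in> U" "\<kappa> (a \<otimes> b) - \<kappa> b - \<kappa> a \<in> E (j + 1)"
        using J[OF _ bJ ab(1)] j by auto
      have "\<kappa> (a \<otimes> b) - \<kappa> b - \<kappa> a + \<kappa> b + \<kappa> a \<in> E j"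
        using *(2) ab E_antimono[of j "j + 1"] by (intro E_add) (auto simp: ball_def)
      then show ?thesis
        using * by (simp add: ball_def)
    qed
  qed
  then show ?thesis by blast
qed

text \<open>With c the commutator and w = x g, the product c w is g x, and the coordinates of x g
  and g x agree up to \<open>E (j + m)\<close>. So c changes the coordinate of w by at most that
  much; the product estimate, applied one level at a time, turns this into a bound for c
  itself.\<close>

lemma commutator_ball:
  "\<exists>J. \<forall>j\<ge>J. \<forall>g\<in>ball J. \<forall>x\<in>ball j. g \<otimes> x \<otimes> inv g \<otimes> inv x \<in> ball (j + m)"
proof -
  obtain J1 where J1: "\<And>j b c. j \<ge> J1 \<Longrightarrow> b \<in> ball J1 \<Longrightarrow> c \<in> ball j \<Longrightarrow>
      c \<otimes> b \<in> U \<and> \<kappa> (c \<otimes> b) - \<kappa> b - \<kappa> c \<in> E (j + 1)"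
    using ball_mult_estimate[of 1] by blast
  obtain Jm where Jm: "\<And>j b c. j \<ge> Jm \<Longrightarrow> b \<in> ball Jm \<Longrightarrow> c \<in> ball j \<Longrightarrow>
      \<kappa> (c \<otimes> b) - \<kappa> b - \<kappa> c \<in> E (j + m) \<and> \<kappa> (b \<otimes> c) - \<kappa> b - \<kappa> c \<in> E (j + m)"
    using ball_mult_estimate[of m] by blast
  obtain Js where Js: "\<And>j. j \<ge> Js \<Longrightarrow> subgroup (ball j) G"
    using subgroup_ball by blast
  define J where "J = max J1 (max Jm Js)"
  have "g \<otimes> x \<otimes> inv g \<otimes> inv x \<in> ball (j + m)" if j: "j \<ge> J" and g: "g \<in> ball J" and x: "x \<in> ball j" for j g x
  proof -
    have sub: "subgroup (ball J) G"
      by (rule Js) (simp add: J_def)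
    have gc: "g \<in> carrier G" and xc: "x \<in> carrier G"
      using g x ball_carrier by auto
    have xJ: "x \<in> ball J"
      using x ball_antimono[OF j] by blast
    define c where "c = g \<otimes> x \<otimes> inv g \<otimes> inv x"
    define w where "w = x \<otimes> g"
    have cw: "c \<otimes> w = g \<otimes> x"
      using gc xc by (simp add: c_def w_def G.group_normalize)
    have wJ: "w \<in> ball J"
      unfolding w_def by (rule subgroup.m_closed[OF sub xJ g])
    have cJ: "c \<in> ball J"
      unfolding c_def
      by (rule subgroup.m_closed[OF sub subgroup.m_closed[OF sub subgroup.m_closed[OF sub g xJ]
              subgroup.m_inv_closed[OF sub g]] subgroup.m_inv_closed[OF sub xJ]])
    have le: "J1 \<le> J" "Jm \<le> J"
      by (auto simp: J_def)
    have "\<kappa> (x \<otimes> g) - \<kappa> g - \<kappa> x \<in> E (j + m)" "\<kappa> (g \<otimes> x) - \<kappa> g - \<kappa> x \<in> E (j + m)"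
      using Jm[of j g x] j le g x ball_antimono[of Jm J] by auto
    then have "(\<kappa> (g \<otimes> x) - \<kappa> g - \<kappa> x) - (\<kappa> (x \<otimes> g) - \<kappa> g - \<kappa> x) \<in> E (j + m)"
      using E_diff by blast
    then have diff: "\<kappa> (c \<otimes> w) - \<kappa> w \<in> E (j + m)"
      unfolding cw unfolding w_def by simp
    have "J \<le> i \<Longrightarrow> i \<le> j + m \<Longrightarrow> c \<in> ball i" for i
    proof (induction i rule: dec_induct)
      case base
      then show ?case using cJ by simp
    next
      case (step i)
      then have i: "c \<in> ball i"
        by simp
      have "\<kappa> (c \<otimes> w) - \<kappa> w - \<kappa> c \<in> E (Suc i)"
        using J1[of i w c] i step(1) le wJ ball_antimono[of J1 J] by auto
      moreover have "\<kappa> (c \<otimes> w) - \<kappa> w \<in> E (Suc i)"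
        using diff step.prems E_antimono[of "Suc i" "j + m"] by auto
      ultimately have "(\<kappa> (c \<otimes> w) - \<kappa> w) - (\<kappa> (c \<otimes> w) - \<kappa> w - \<kappa> c) \<in> E (Suc i)"
        using E_diff by blast
      then show ?case
        using i by (simp add: ball_def)
    qed
    then show ?thesis
      using j unfolding c_def by simp
  qed
  then show ?thesis by blast
qed

text \<open>By induction the coordinate of the n-th power is n times that of x up to
  \<open>E (j + m)\<close>, and p is zero in the field.\<close>

lemma power_ball:
  assumes p: "of_nat p = (0 :: 'k)"
  shows "\<exists>J. \<forall>j\<ge>J. \<forall>x\<in>ball j. x [^] p \<in> ball (j + m)"
proof -
  obtain Jm where Jm: "\<And>j b c. j \<ge> Jm \<Longrightarrow> b \<in> ball Jm \<Longrightarrow> c \<in> ball j \<Longrightarrow>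
      \<kappa> (b \<otimes> c) - \<kappa> b - \<kappa> c \<in> E (j + m)"
    using ball_mult_estimate[of m] by blast
  obtain Js where Js: "\<And>j. j \<ge> Js \<Longrightarrow> subgroup (ball j) G"
    using subgroup_ball by blast
  have "x [^] p \<in> ball (j + m)" if j: "j \<ge> max Jm Js" and x: "x \<in> ball j" for j x
  proof -
    have sub: "subgroup (ball j) G"
      using Js j by simp
    have pow: "x [^] n \<in> ball j" for n :: nat
      by (induction n) (simp_all add: one_ball subgroup.m_closed[OF sub _ x])
    have "\<kappa> (x [^] n) - sE (of_nat n) (\<kappa> x) \<in> E (j + m)" for n :: nat
    proof (induction n)
      case 0
      then show ?case by (simp add: kappa_one)
    next
      case (Suc n)
      have "x [^] n \<in> ball Jm"
        using pow j ball_antimono[of Jm j] by auto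
      then have "\<kappa> (x [^] n \<otimes> x) - \<kappa> (x [^] n) - \<kappa> x \<in> E (j + m)"
        using Jm[of j "x [^] n" x] j x by simp
      then have "(\<kappa> (x [^] n \<otimes> x) - \<kappa> (x [^] n) - \<kappa> x) + (\<kappa> (x [^] n) - sE (of_nat n) (\<kappa> x)) \<in> E (j + m)"
        using Suc by (rule E_add)
      then show ?case
        by (simp add: scale_left_distrib algebra_simps)
    qed
    from this[of p] have "\<kappa> (x [^] p) \<in> E (j + m)"
      by (simp add: p)
    then show ?thesis
      using pow[of p] by (simp add: ball_def)
  qed
  then show ?thesis by blast
qed

end

text \<open>Compactness of the open subgroups yields the two algebraic conditions: finitely many
  cosets of \<open>B j\<close> cover \<open>B i\<close>, and nested compact cosets have a common
  point, which is completeness.\<close>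

lemma topologized_filtrationI:
  fixes G :: "('g, 'm) monoid_scheme" (structure)
  assumes top: "topological_group G T" and Hausdorff: "Hausdorff_space T"
    and iso: "\<alpha> \<in> iso G G" and cont: "continuous_map T T \<alpha>" and contr: "contractive G T \<alpha>"
    and p: "prime p"
    and sub: "\<And>j. subgroup (B j) G" and decreasing: "\<And>j. B (Suc j) \<subseteq> B j"
    and opn: "\<And>j. openin T (B j)" and comp: "\<And>j. compactin T (B j)"
    and base: "\<And>U. openin T U \<Longrightarrow> \<one> \<in> U \<Longrightarrow> \<exists>j. B j \<subseteq> U"
    and expansion: "\<exists>c J. \<forall>j\<ge>J. B (j + c) \<subseteq> \<alpha> ` B j"
    and commutator: "\<And>m. \<exists>J. \<forall>j\<ge>J. \<forall>g\<in>B J. \<forall>x\<in>B j. g \<otimes> x \<otimes> inv g \<otimes> inv x \<in> B (j + m)"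
    and power: "\<And>m. \<exists>J. \<forall>j\<ge>J. \<forall>x\<in>B j. x [^] p \<in> B (j + m)"
  shows "topologized_filtration G \<alpha> B p T"
proof -
  have grp: "group G" and topT: "topspace T = carrier G"
    and multT: "continuous_map (prod_topology T T) T (\<lambda>(x, y). x \<otimes> y)"
    using top by (auto simp: topological_group_def)
  interpret group G by (rule grp)
  have closedB: "closedin T (B j)" for j
    by (rule compactin_imp_closedin[OF Hausdorff comp])
  have Bc: "x \<in> carrier G" if "x \<in> B j" for x j
    using that subgroup.mem_carrier[OF sub] by blast
  have one_B: "\<one> \<in> B j" for j
    by (rule subgroup.one_closed[OF sub])
  have left: "continuous_map T T (\<lambda>x. g \<otimes> x)" if g: "g \<in> carrier G" for g
  proof -
    have "continuous_map T (prod_topology T T) (\<lambda>x. (g, x))"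
      using g topT by (intro continuous_map_pairedI) (simp_all add: continuous_map_id[unfolded id_def])
    from continuous_map_compose[OF this multT] show ?thesis
      by (simp add: o_def)
  qed
  have coset_open: "openin T {x \<in> carrier G. inv g \<otimes> x \<in> B j}" if "g \<in> carrier G" for g j
    using openin_continuous_map_preimage[OF left[of "inv g"] opn[of j]] that topT by simp
  have coset_closed: "closedin T {x \<in> carrier G. inv g \<otimes> x \<in> B j}" if "g \<in> carrier G" for g j
    using closedin_continuous_map_preimage[OF left[of "inv g"] closedB[of j]] that topT by simp
  have coset_compact: "compactin T {x \<in> carrier G. inv g \<otimes> x \<in> B j}" if g: "g \<in> carrier G" for g j
  proof -
    have "compactin T ((\<lambda>x. g \<otimes> x) ` B j)"
      by (rule image_compactin[OF comp left[OF g]])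
    moreover have "(\<lambda>x. g \<otimes> x) ` B j = {x \<in> carrier G. inv g \<otimes> x \<in> B j}"
    proof
      show "(\<lambda>x. g \<otimes> x) ` B j \<subseteq> {x \<in> carrier G. inv g \<otimes> x \<in> B j}"
        using g Bc by (auto simp: inv_mult_cancel)
      show "{x \<in> carrier G. inv g \<otimes> x \<in> B j} \<subseteq> (\<lambda>x. g \<otimes> x) ` B j"
      proof
        fix x assume "x \<in> {x \<in> carrier G. inv g \<otimes> x \<in> B j}"
        then show "x \<in> (\<lambda>x. g \<otimes> x) ` B j"
          using g by (intro image_eqI[of _ _ "inv g \<otimes> x"]) (auto simp: inv_mult_cancel)
      qed
    qed
    ultimately show ?thesis by simp
  qed
  have coset_self: "g \<in> {x \<in> carrier G. inv g \<otimes> x \<in> B j}" if "g \<in> carrier G" for g j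
    using that one_B by simp
  have finite_index: "\<exists>R. finite R \<and> R \<subseteq> carrier G \<and> (\<forall>x\<in>B i. \<exists>r\<in>R. inv r \<otimes> x \<in> B j)" for i j
  proof -
    define C where "C r = {x \<in> carrier G. inv r \<otimes> x \<in> B j}" for r
    have "\<exists>\<F>. finite \<F> \<and> \<F> \<subseteq> C ` B i \<and> B i \<subseteq> \<Union>\<F>"
    proof (rule compactinD[OF comp])
      show "openin T D" if "D \<in> C ` B i" for D
        using that coset_open Bc unfolding C_def by blast
      show "B i \<subseteq> \<Union>(C ` B i)"
        using coset_self Bc unfolding C_def by blast
    qed
    then obtain R where "finite R" "R \<subseteq> B i" "B i \<subseteq> \<Union>(C ` R)"
      by (metis finite_subset_image)
    then show ?thesis
      using Bc by (intro exI[of _ R]) (auto simp: C_def)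
  qed
  have complete: "\<exists>v\<in>carrier G. \<forall>n. inv (u n) \<otimes> v \<in> B n"
    if u: "\<And>n. u n \<in> carrier G" "\<And>n. inv (u n) \<otimes> u (Suc n) \<in> B n" for u
  proof -
    define C where "C n = {x \<in> carrier G. inv (u n) \<otimes> x \<in> B n}" for n
    have C_Suc: "C (Suc n) \<subseteq> C n" for n
    proof
      fix x assume "x \<in> C (Suc n)"
      then have x: "x \<in> carrier G" "inv (u (Suc n)) \<otimes> x \<in> B n"
        using decreasing[of n] by (auto simp: C_def)
      then show "x \<in> C n"
        using subgroup_inv_mult_trans[OF sub u(1) u(1) x(1) u(2)] by (simp add: C_def)
    qed
    have C0: "C n \<subseteq> C 0" for n
      by (rule lift_Suc_antimono_le[of C]) (simp_all add: C_Suc)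
    have "(\<Inter>n. C n) \<noteq> {}"
    proof (rule compact_space_imp_nest)
      show "compact_space (subtopology T (C 0))"
        unfolding C_def by (rule compact_space_subtopology[OF coset_compact[OF u(1)]])
      show "closedin (subtopology T (C 0)) (C n)" for n
        using coset_closed[OF u(1)[of n], of n] C0[of n] by (simp add: closedin_subset_topspace C_def)
      show "C n \<noteq> {}" for n
        using coset_self[OF u(1)] unfolding C_def by blast
      show "decseq C"
        using C_Suc by (simp add: decseq_Suc_iff)
    qed
    then show ?thesis
      unfolding C_def by blast
  qed
  have \<alpha>1: "\<alpha> \<one> = \<one>"
    using iso hom_one[OF _ grp grp] by (auto simp: iso_def)
  show ?thesis
  proof (intro topologized_filtration.intro contraction_filtration.intro
      contraction_filtration_axioms.intro topologized_filtration_axioms.intro grp)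
    show "prime p" "\<alpha> \<in> iso G G"
      by (fact p iso)+
    show "subgroup (B j) G" "B (Suc j) \<subseteq> B j" for j
      by (fact sub decreasing)+
    show "(\<Inter>j. B j) \<subseteq> {\<one>}"
    proof
      fix x assume x: "x \<in> (\<Inter>j. B j)"
      show "x \<in> {\<one>}"
      proof (rule ccontr)
        assume "x \<notin> {\<one>}"
        then obtain U V where "openin T U" "openin T V" "\<one> \<in> U" "x \<in> V" "disjnt U V"
          using Hausdorff x Bc unfolding Hausdorff_space_def topT by (metis INT_iff UNIV_I one_closed singletonI)
        then show False
          using base[of U] x unfolding disjnt_def by blast
      qed
    qed
    show "\<exists>n. \<forall>k\<ge>n. (\<alpha> ^^ k) x \<in> B j" if "x \<in> carrier G" for x j
      using contr that opn one_B unfolding contractive_def limitin_def eventually_sequentially by blast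
    show "\<exists>l. \<alpha> ` B l \<subseteq> B j" for j
    proof -
      have "openin T {x \<in> topspace T. \<alpha> x \<in> B j}"
        by (rule openin_continuous_map_preimage[OF cont opn])
      then show ?thesis
        using base[of "{x \<in> topspace T. \<alpha> x \<in> B j}"] \<alpha>1 one_B topT by auto
    qed
    show "openin T U \<longleftrightarrow> U \<subseteq> carrier G \<and> (\<forall>u\<in>U. \<exists>j. \<forall>b\<in>B j. u \<otimes> b \<in> U)" for U
    proof
      assume U: "openin T U"
      have "\<exists>j. \<forall>b\<in>B j. u \<otimes> b \<in> U" if u: "u \<in> U" for u
      proof -
        have uc: "u \<in> carrier G"
          using u openin_subset[OF U] topT by blast
        have "openin T {x \<in> topspace T. u \<otimes> x \<in> U}"
          by (rule openin_continuous_map_preimage[OF left[OF uc] U])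
        then show ?thesis
          using base[of "{x \<in> topspace T. u \<otimes> x \<in> U}"] u uc topT by auto
      qed
      then show "U \<subseteq> carrier G \<and> (\<forall>u\<in>U. \<exists>j. \<forall>b\<in>B j. u \<otimes> b \<in> U)"
        using openin_subset[OF U] topT by blast
    next
      assume U: "U \<subseteq> carrier G \<and> (\<forall>u\<in>U. \<exists>j. \<forall>b\<in>B j. u \<otimes> b \<in> U)"
      show "openin T U"
      proof (subst openin_subopen, intro ballI)
        fix u assume u: "u \<in> U"
        then obtain j where j: "\<forall>b\<in>B j. u \<otimes> b \<in> U" and uc: "u \<in> carrier G"
          using U by blast
        have "{x \<in> carrier G. inv u \<otimes> x \<in> B j} \<subseteq> U"
          using j uc by (auto dest!: bspec simp: inv_mult_cancel)
        then show "\<exists>V. openin T V \<and> u \<in> V \<and> V \<subseteq> U"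
          using coset_open[OF uc] coset_self[OF uc] by blast
      qed
    qed
  qed (fact finite_index complete expansion commutator power)+
qed

section \<open>From the Lie group to the filtration\<close>

lemma C1_map_chart:
  assumes "C1_map sE T A sF T' A' f" "(U, \<phi>) \<in> A" "(V, \<psi>) \<in> A'"
  shows "C1_on sE sF (\<phi> ` {x \<in> U. f x \<in> V}) (\<psi> \<circ> f \<circ> inv_into U \<phi>)"
  using bspec[OF bspec[OF conjunct2[OF assms(1)[unfolded C1_map_def]] assms(2), simplified] assms(3)]
  by simp

lemma Lie_group_filtration:
  fixes absval :: "'k::{field, topological_ab_group_add, topological_monoid_mult} \<Rightarrow> real"
    and sE :: "'k \<Rightarrow> 'e::{topological_ab_group_add, t2_space} \<Rightarrow> 'e"
    and G :: "('g, 'm) monoid_scheme" (structure)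
  assumes "local_field absval" and p: "of_nat p = (0 :: 'k)" "prime p"
    and Lie: "C1_Lie_group sE G T A" and aut: "C1_automorphism sE G T A \<alpha>"
    and contr: "contractive G T \<alpha>"
  shows "\<exists>B. topologized_filtration G \<alpha> B p T"
proof -
  have grp: "group G" and topT: "topspace T = carrier G" and mfd: "C1_manifold sE T A"
    and C1_mult: "C1_map (prod_scale sE sE) (prod_topology T T) (prod_atlas A A) sE T A (\<lambda>(x, y). x \<otimes> y)"
    and C1_inv: "C1_map sE T A sE T A (\<lambda>x. inv x)" and tvs: "fin_dim_tvs sE"
    using Lie by (auto simp: C1_Lie_group_def)
  interpret group G by (rule grp)
  obtain \<pi> L where "scaled_lattice sE \<pi> L"
    using local_field.ex_scaled_lattice[OF assms(1) tvs] by blast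
  then interpret scaled_lattice sE \<pi> L .
  have top: "topological_group G T"
    using grp topT C1_mult C1_inv by (simp add: topological_group_def C1_map_def)
  have Hausdorff: "Hausdorff_space T"
    using mfd by (simp add: C1_manifold_def)
  have "\<one> \<in> (\<Union>(U, \<phi>)\<in>A. U)"
    using mfd topT by (simp add: C1_manifold_def)
  then obtain U \<phi> where chart: "(U, \<phi>) \<in> A" "\<one> \<in> U"
    by auto
  have openU: "openin T U" and open\<phi>U: "open (\<phi> ` U)"
    and homeo: "homeomorphic_map (subtopology T U) (top_of_set (\<phi> ` U)) \<phi>"
    using mfd chart(1) by (auto simp: C1_manifold_def)
  have U_carrier: "U \<subseteq> carrier G"
    using openin_subset[OF openU] topT by simp
  have topU: "topspace (subtopology T U) = U"
    using U_carrier topT by (simp add: Int_absorb1)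
  have inj: "inj_on \<phi> U"
    using homeo topU by (simp add: homeomorphic_map_def)
  define e where "e = \<phi> \<one>"
  define \<kappa> where "\<kappa> a = \<phi> a - e" for a
  have e_U: "e \<in> \<phi> ` U"
    using chart by (simp add: e_def)
  \<comment> \<open>From \<open>j0\<close> on the translated lattices lie in the image of the chart,
    so their preimages are compact.\<close>
  obtain j0 where j0: "\<And>v. v \<in> E j0 \<Longrightarrow> e + v \<in> \<phi> ` U"
    using E_base_at[OF open\<phi>U e_U] by blast
  define B0 where "B0 j = {a \<in> U. \<kappa> a \<in> E j}" for j
  have B0_open: "openin T (B0 j)" for j
  proof -
    have cont: "continuous_map (subtopology T U) euclidean \<phi>"
      using homeomorphic_imp_continuous_map[OF homeo] by (simp add: continuous_map_in_subtopology)
    have "open ((\<lambda>v. v - e) -` E j)"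
      by (rule open_vimage[OF open_E]) (intro continuous_intros)
    then have "openin (subtopology T U) {a \<in> U. \<phi> a \<in> (\<lambda>v. v - e) -` E j}"
      using openin_continuous_map_preimage[OF cont, of "(\<lambda>v. v - e) -` E j"] unfolding topU by simp
    then have "openin T {a \<in> U. \<phi> a \<in> (\<lambda>v. v - e) -` E j}"
      using openin_open_subtopology[OF openU] by blast
    then show ?thesis
      by (simp add: B0_def \<kappa>_def)
  qed
  have B0_compact: "compactin T (B0 j)" if j: "j \<ge> j0" for j
  proof -
    obtain \<psi> where \<psi>: "homeomorphic_maps (subtopology T U) (top_of_set (\<phi> ` U)) \<phi> \<psi>"
      using homeo homeomorphic_map_maps by blast
    have sub: "(\<lambda>v. e + v) ` E j \<subseteq> \<phi> ` U"
      using j0 E_antimono[OF j] by auto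
    have "compact ((\<lambda>v. e + v) ` E j)"
      by (rule compact_continuous_image[OF _ compact_E]) (intro continuous_intros)
    then have "compactin (top_of_set (\<phi> ` U)) ((\<lambda>v. e + v) ` E j)"
      using sub by (simp add: compactin_subtopology)
    then have "compactin (subtopology T U) (\<psi> ` ((\<lambda>v. e + v) ` E j))"
      using \<psi> unfolding homeomorphic_maps_def by (blast intro: image_compactin)
    then have "compactin T (\<psi> ` ((\<lambda>v. e + v) ` E j))"
      by (simp add: compactin_subtopology)
    moreover have "\<psi> ` ((\<lambda>v. e + v) ` E j) = B0 j"
    proof
      show "B0 j \<subseteq> \<psi> ` ((\<lambda>v. e + v) ` E j)"
      proof
        fix a assume a: "a \<in> B0 j"
        then have "\<psi> (\<phi> a) = a"
          using \<psi> topU by (auto simp: homeomorphic_maps_def B0_def)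
        moreover have "\<phi> a = e + \<kappa> a"
          by (simp add: \<kappa>_def)
        ultimately show "a \<in> \<psi> ` ((\<lambda>v. e + v) ` E j)"
          using a unfolding B0_def by force
      qed
      show "\<psi> ` ((\<lambda>v. e + v) ` E j) \<subseteq> B0 j"
      proof clarify
        fix v assume v: "v \<in> E j"
        then obtain a where a: "a \<in> U" "e + v = \<phi> a"
          using sub by blast
        then have "\<psi> (e + v) = a"
          using \<psi> topU by (auto simp: homeomorphic_maps_def)
        moreover have "\<kappa> a = v"
          by (simp add: \<kappa>_def flip: a(2))
        ultimately show "\<psi> (e + v) \<in> B0 j"
          using a v by (simp add: B0_def)
      qed
    qed
    ultimately show ?thesis by simp
  qed
  have B0_base: "\<exists>j. B0 j \<subseteq> V" if V: "openin T V" "\<one> \<in> V" for V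
  proof -
    have "openin (subtopology T U) (V \<inter> U)"
      using V(1) by (auto simp: openin_subtopology)
    then have "openin (top_of_set (\<phi> ` U)) (\<phi> ` (V \<inter> U))"
      using homeomorphic_imp_open_map[OF homeo] unfolding open_map_def by blast
    then have "open (\<phi> ` (V \<inter> U))"
      using openin_open_eq[OF open\<phi>U] by blast
    moreover have "e \<in> \<phi> ` (V \<inter> U)"
      using V(2) chart(2) by (auto simp: e_def)
    ultimately obtain j where j: "\<And>v. v \<in> E j \<Longrightarrow> e + v \<in> \<phi> ` (V \<inter> U)"
      using E_base_at[of "\<phi> ` (V \<inter> U)" e] by blast
    have "a \<in> V" if a: "a \<in> B0 j" for a
    proof -
      have "e + \<kappa> a \<in> \<phi> ` (V \<inter> U)"
        using j a by (simp add: B0_def)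
      then obtain b where "b \<in> V" "b \<in> U" "\<phi> a = \<phi> b"
        by (auto simp: \<kappa>_def)
      then show ?thesis
        using inj a by (auto simp: B0_def dest: inj_onD)
    qed
    then show ?thesis by blast
  qed
  \<comment> \<open>Directions are taken in one factor at a time. Along these the increments at the
    identity are known exactly, because multiplication by the identity is trivial, so the derivative
    h is a coordinate projection.\<close>
  have mult_estimate: "\<exists>J. \<forall>j\<ge>J. \<forall>b c. b \<in> U \<longrightarrow> c \<in> U \<longrightarrow> \<kappa> b \<in> E J \<longrightarrow> \<kappa> c \<in> E j \<longrightarrow>
      c \<otimes> b \<in> U \<and> b \<otimes> c \<in> U \<and> \<kappa> (c \<otimes> b) - \<kappa> b - \<kappa> c \<in> E (j + m) \<and> \<kappa> (b \<otimes> c) - \<kappa> b - \<kappa> c \<in> E (j + m)" for m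
  proof -
    define D where "D = map_prod \<phi> \<phi> ` {x \<in> U \<times> U. (case x of (x, y) \<Rightarrow> x \<otimes> y) \<in> U}"
    define f where "f = \<phi> \<circ> (\<lambda>(x, y). x \<otimes> y) \<circ> inv_into (U \<times> U) (map_prod \<phi> \<phi>)"
    have "(U \<times> U, map_prod \<phi> \<phi>) \<in> prod_atlas A A"
      using chart(1) by (auto simp: prod_atlas_def)
    then have C1: "C1_on (prod_scale sE sE) sE D f"
      unfolding D_def f_def by (rule C1_map_chart[OF C1_mult _ chart(1)])
    have injp: "inj_on (map_prod \<phi> \<phi>) (U \<times> U)"
      using inj by (rule map_prod_inj_on) (rule inj)
    have f: "f (\<phi> a, \<phi> b) = \<phi> (a \<otimes> b)" if "a \<in> U" "b \<in> U" for a b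
      using inv_into_f_f[OF injp, of "(a, b)"] that by (simp add: f_def)
    have D: "a \<otimes> b \<in> U" if ab: "(\<phi> a, \<phi> b) \<in> D" "a \<in> U" "b \<in> U" for a b
    proof -
      obtain a' b' where "a' \<in> U" "b' \<in> U" "a' \<otimes> b' \<in> U" "\<phi> a = \<phi> a'" "\<phi> b = \<phi> b'"
        using ab(1) unfolding D_def by auto
      then show ?thesis
        using inj_onD[OF inj, of a a'] inj_onD[OF inj, of b b'] ab(2,3) by simp
    qed
    have eD: "(e, e) \<in> D"
      using chart(2) unfolding D_def e_def by (auto intro!: image_eqI[of _ _ "(\<one>, \<one>)"])
    define N where "N j = {z. fst z - e \<in> E j \<and> snd z - e \<in> E j}" for j
    have N_mono: "N j \<subseteq> N i" if "i \<le> j" for i j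
      using E_antimono[OF that] by (auto simp: N_def)
    have N_base: "\<exists>j. N j \<subseteq> V" if V: "open V" "(e, e) \<in> V" for V
    proof -
      obtain V1 V2 where V12: "open V1" "open V2" "e \<in> V1" "e \<in> V2" "V1 \<times> V2 \<subseteq> V"
        using open_prod_elim[OF V] by (metis SigmaE2)
      obtain j1 j2 where j: "\<And>v. v \<in> E j1 \<Longrightarrow> e + v \<in> V1" "\<And>v. v \<in> E j2 \<Longrightarrow> e + v \<in> V2"
        using E_base_at[OF V12(1,3)] E_base_at[OF V12(2,4)] by blast
      have "z \<in> V" if "z \<in> N (max j1 j2)" for z
      proof -
        have "fst z - e \<in> E j1" "snd z - e \<in> E j2"
          using that E_antimono[of j1 "max j1 j2"] E_antimono[of j2 "max j1 j2"] by (auto simp: N_def)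
        then have "fst z \<in> V1" "snd z \<in> V2"
          using j(1)[of "fst z - e"] j(2)[of "snd z - e"] by auto
        then show ?thesis
          using V12(5) by (metis SigmaI prod.collapse subsetD)
      qed
      then show ?thesis by blast
    qed
    have sX: "continuous_on UNIV (\<lambda>(t, x). prod_scale sE sE t x)" "prod_scale sE sE 0 y = 0" for y
    proof -
      have "(\<lambda>(t, x). prod_scale sE sE t x) = (\<lambda>z. (sE (fst z) (fst (snd z)), sE (fst z) (snd (snd z))))"
        by (auto simp: prod_scale_def)
      then show "continuous_on UNIV (\<lambda>(t, x). prod_scale sE sE t x)"
        by (auto intro!: continuous_intros)
      show "prod_scale sE sE 0 y = 0"
        by (cases y) (simp add: prod_scale_def zero_prod_def)
    qed
    have plus: "continuous_on UNIV (\<lambda>z :: ('e \<times> 'e) \<times> 'e \<times> 'e. fst z + snd z)"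
      unfolding plus_prod_def by (intro continuous_intros)
    have chart_point: "\<exists>a\<in>U. \<phi> a = e + sE (\<pi> ^ j) v" if "v \<in> E 0" "j \<ge> j0" for v j
    proof -
      have "sE (\<pi> ^ j) v \<in> E j0"
        using scale_mem_E[of j v 0] that E_antimono[of j0 j] by auto
      then show ?thesis
        using j0 by (metis imageE)
    qed
    have fe: "f (e, e) = e"
      using f[OF chart(2) chart(2)] by (simp add: e_def)
    have "\<exists>J. \<forall>j\<ge>J. \<forall>x\<in>N J. \<forall>y\<in>E 0 \<times> {0}. x \<in> D \<and> x + prod_scale sE sE (\<pi> ^ j) y \<in> D \<and>
        f (x + prod_scale sE sE (\<pi> ^ j) y) - f x - sE (\<pi> ^ j) (fst y) \<in> E (j + m)"
    proof (rule C1_on_uniform[OF C1 eD sX plus N_mono N_base])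
      show "compact (E 0 \<times> {0 :: 'e})"
        by (intro compact_Times compact_E) simp
      show "continuous_on UNIV (fst :: 'e \<times> 'e \<Rightarrow> 'e)"
        by (intro continuous_intros)
      show "\<exists>J. \<forall>j\<ge>J. f ((e, e) + prod_scale sE sE (\<pi> ^ j) y) - f (e, e) = sE (\<pi> ^ j) (fst y)"
        if y: "y \<in> E 0 \<times> {0}" for y
      proof (intro exI[of _ j0] allI impI)
        fix j assume j: "j \<ge> j0"
        obtain a where a: "a \<in> U" "\<phi> a = e + sE (\<pi> ^ j) (fst y)"
          using chart_point[of "fst y" j] y j by auto
        have "(e, e) + prod_scale sE sE (\<pi> ^ j) y = (\<phi> a, \<phi> \<one>)"
          using y a by (auto simp: prod_scale_def e_def)
        then show "f ((e, e) + prod_scale sE sE (\<pi> ^ j) y) - f (e, e) = sE (\<pi> ^ j) (fst y)"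
          using f[OF a(1) chart(2)] a U_carrier fe by auto
      qed
    qed
    then obtain J1 where J1: "\<And>j x y. j \<ge> J1 \<Longrightarrow> x \<in> N J1 \<Longrightarrow> y \<in> E 0 \<Longrightarrow>
        x + prod_scale sE sE (\<pi> ^ j) (y, 0) \<in> D \<and>
        f (x + prod_scale sE sE (\<pi> ^ j) (y, 0)) - f x - sE (\<pi> ^ j) y \<in> E (j + m)"
      by fastforce
    have "\<exists>J. \<forall>j\<ge>J. \<forall>x\<in>N J. \<forall>y\<in>{0} \<times> E 0. x \<in> D \<and> x + prod_scale sE sE (\<pi> ^ j) y \<in> D \<and>
        f (x + prod_scale sE sE (\<pi> ^ j) y) - f x - sE (\<pi> ^ j) (snd y) \<in> E (j + m)"
    proof (rule C1_on_uniform[OF C1 eD sX plus N_mono N_base])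
      show "compact ({0 :: 'e} \<times> E 0)"
        by (intro compact_Times compact_E) simp
      show "continuous_on UNIV (snd :: 'e \<times> 'e \<Rightarrow> 'e)"
        by (intro continuous_intros)
      show "\<exists>J. \<forall>j\<ge>J. f ((e, e) + prod_scale sE sE (\<pi> ^ j) y) - f (e, e) = sE (\<pi> ^ j) (snd y)"
        if y: "y \<in> {0} \<times> E 0" for y
      proof (intro exI[of _ j0] allI impI)
        fix j assume j: "j \<ge> j0"
        obtain a where a: "a \<in> U" "\<phi> a = e + sE (\<pi> ^ j) (snd y)"
          using chart_point[of "snd y" j] y j by auto
        have "(e, e) + prod_scale sE sE (\<pi> ^ j) y = (\<phi> \<one>, \<phi> a)"
          using y a by (auto simp: prod_scale_def e_def)
        then show "f ((e, e) + prod_scale sE sE (\<pi> ^ j) y) - f (e, e) = sE (\<pi> ^ j) (snd y)"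
          using f[OF chart(2) a(1)] a U_carrier fe by auto
      qed
    qed
    then obtain J2 where J2: "\<And>j x y. j \<ge> J2 \<Longrightarrow> x \<in> N J2 \<Longrightarrow> y \<in> E 0 \<Longrightarrow>
        x + prod_scale sE sE (\<pi> ^ j) (0, y) \<in> D \<and>
        f (x + prod_scale sE sE (\<pi> ^ j) (0, y)) - f x - sE (\<pi> ^ j) y \<in> E (j + m)"
      by fastforce
    have "c \<otimes> b \<in> U \<and> b \<otimes> c \<in> U \<and> \<kappa> (c \<otimes> b) - \<kappa> b - \<kappa> c \<in> E (j + m) \<and> \<kappa> (b \<otimes> c) - \<kappa> b - \<kappa> c \<in> E (j + m)"
      if j: "j \<ge> max J1 J2" and bc: "b \<in> U" "c \<in> U" "\<kappa> b \<in> E (max J1 J2)" "\<kappa> c \<in> E j" for j b c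
    proof -
      obtain y where y: "y \<in> E 0" "\<kappa> c = sE (\<pi> ^ j) y"
        using bc(4) E_eq_image[of 0 j] by auto
      have \<phi>c: "\<phi> c = e + sE (\<pi> ^ j) y"
        by (simp add: \<kappa>_def flip: y(2))
      have bJ: "\<phi> b - e \<in> E J1" "\<phi> b - e \<in> E J2"
        using bc(3) E_antimono[of J1 "max J1 J2"] E_antimono[of J2 "max J1 J2"] by (auto simp: \<kappa>_def)
      have b_car: "b \<in> carrier G"
        using bc U_carrier by blast
      have "(e, \<phi> b) + prod_scale sE sE (\<pi> ^ j) (y, 0) = (\<phi> c, \<phi> b)"
        by (simp add: prod_scale_def \<phi>c)
      then have 1: "(\<phi> c, \<phi> b) \<in> D" "f (\<phi> c, \<phi> b) - f (e, \<phi> b) - sE (\<pi> ^ j) y \<in> E (j + m)"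
        using J1[of j "(e, \<phi> b)" y] j y bJ by (auto simp: N_def)
      have "(\<phi> b, e) + prod_scale sE sE (\<pi> ^ j) (0, y) = (\<phi> b, \<phi> c)"
        by (simp add: prod_scale_def \<phi>c)
      then have 2: "(\<phi> b, \<phi> c) \<in> D" "f (\<phi> b, \<phi> c) - f (\<phi> b, e) - sE (\<pi> ^ j) y \<in> E (j + m)"
        using J2[of j "(\<phi> b, e)" y] j y bJ by (auto simp: N_def)
      have "f (e, \<phi> b) = \<phi> b" "f (\<phi> b, e) = \<phi> b"
        using f[OF chart(2) bc(1)] f[OF bc(1) chart(2)] b_car by (simp_all add: e_def)
      then show ?thesis
        using 1 2 D bc f[OF bc(1,2)] f[OF bc(2,1)] y by (simp add: \<kappa>_def)
    qed
    then show ?thesis by blast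
  qed
  have invT: "continuous_map T T (\<lambda>x. inv x)"
    using C1_inv by (simp add: C1_map_def)
  have inverse_estimate: "\<exists>J'. \<forall>a\<in>U. \<kappa> a \<in> E J' \<longrightarrow> inv a \<in> U \<and> \<kappa> (inv a) \<in> E J" for J
  proof -
    have "openin T {x \<in> topspace T. inv x \<in> B0 J}"
      by (rule openin_continuous_map_preimage[OF invT B0_open])
    moreover have "\<one> \<in> {x \<in> topspace T. inv x \<in> B0 J}"
      using topT chart(2) by (simp add: B0_def \<kappa>_def e_def)
    ultimately obtain J' where "B0 J' \<subseteq> {x \<in> topspace T. inv x \<in> B0 J}"
      using B0_base by blast
    then show ?thesis
      unfolding B0_def by blast
  qed
  interpret lattice_chart sE \<pi> L G U \<kappa>
    by unfold_locales
      (use U_carrier chart(2) mult_estimate inverse_estimate in \<open>auto simp: \<kappa>_def e_def\<close>)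
  have ball_B0: "ball = B0"
    by (simp add: fun_eq_iff ball_def B0_def)
  obtain Js where Js: "\<And>j. j \<ge> Js \<Longrightarrow> subgroup (B0 j) G"
    using subgroup_ball unfolding ball_B0 by blast
  \<comment> \<open>Shifting the index by J leaves only levels at which the balls are compact
    subgroups.\<close>
  define J where "J = max Js j0"
  define B where "B j = B0 (j + J)" for j
  have \<alpha>: "\<alpha> \<in> iso G G" "continuous_map T T \<alpha>"
    and C1_\<beta>: "C1_map sE T A sE T A (inv_into (carrier G) \<alpha>)"
    using aut by (auto simp: C1_automorphism_def C1_map_def)
  have "topologized_filtration G \<alpha> B p T"
  proof (rule topologized_filtrationI[OF top Hausdorff \<alpha> contr p(2)])
    show "subgroup (B j) G" for j
      unfolding B_def by (rule Js) (simp add: J_def)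
    show "B (Suc j) \<subseteq> B j" for j
      unfolding B_def ball_B0[symmetric] by (rule ball_antimono) simp
    show "openin T (B j)" for j
      unfolding B_def by (rule B0_open)
    show "compactin T (B j)" for j
      unfolding B_def by (rule B0_compact) (simp add: J_def)
    show "\<exists>j. B j \<subseteq> V" if V: "openin T V" "\<one> \<in> V" for V
    proof -
      obtain j where "B0 j \<subseteq> V"
        using B0_base[OF V] by blast
      then show ?thesis
        using ball_antimono[of j "j + J"] unfolding B_def ball_B0 by auto
    qed
    show "\<exists>K. \<forall>j\<ge>K. \<forall>g\<in>B K. \<forall>x\<in>B j. g \<otimes> x \<otimes> inv g \<otimes> inv x \<in> B (j + m)" for m
    proof -
      obtain K where K: "\<And>j g x. j \<ge> K \<Longrightarrow> g \<in> B0 K \<Longrightarrow> x \<in> B0 j \<Longrightarrow>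
          g \<otimes> x \<otimes> inv g \<otimes> inv x \<in> B0 (j + m)"
        using commutator_ball[of m] unfolding ball_B0 by blast
      have "g \<otimes> x \<otimes> inv g \<otimes> inv x \<in> B (j + m)" if "j \<ge> K" "g \<in> B K" "x \<in> B j" for j g x
        using K[of "j + J" g x] that ball_antimono[of K "K + J"] unfolding B_def ball_B0
        by (auto simp: algebra_simps)
      then show ?thesis by blast
    qed
    show "\<exists>K. \<forall>j\<ge>K. \<forall>x\<in>B j. x [^] p \<in> B (j + m)" for m
    proof -
      obtain K where K: "\<And>j x. j \<ge> K \<Longrightarrow> x \<in> B0 j \<Longrightarrow> x [^] p \<in> B0 (j + m)"
        using power_ball[OF p(1), of m] unfolding ball_B0 by blast
      have "x [^] p \<in> B (j + m)" if "j \<ge> K" "x \<in> B j" for j x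
        using K[of "j + J" x] that unfolding B_def by (auto simp: algebra_simps)
      then show ?thesis by blast
    qed
    \<comment> \<open>This is the Lipschitz estimate for the inverse of \<alpha> at the identity, c
      playing the role of the Lipschitz constant.\<close>
    show "\<exists>c K. \<forall>j\<ge>K. B (j + c) \<subseteq> \<alpha> ` B j"
    proof -
      define \<beta> where "\<beta> = inv_into (carrier G) \<alpha>"
      have bij: "bij_betw \<alpha> (carrier G) (carrier G)"
        using \<alpha>(1) by (simp add: iso_def)
      have \<beta>c: "\<beta> x \<in> carrier G" and \<alpha>\<beta>: "\<alpha> (\<beta> x) = x" if "x \<in> carrier G" for x
        using that bij unfolding \<beta>_def
        by (metis bij_betw_imp_surj_on inv_into_into, metis bij_betw_inv_into_right)
      have "\<alpha> \<one> = \<one>"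
        using \<alpha>(1) hom_one[OF _ grp grp] by (auto simp: iso_def)
      then have \<beta>1: "\<beta> \<one> = \<one>"
        using bij_betw_inv_into_left[OF bij one_closed] unfolding \<beta>_def by simp
      define D where "D = \<phi> ` {x \<in> U. \<beta> x \<in> U}"
      define f where "f = \<phi> \<circ> \<beta> \<circ> inv_into U \<phi>"
      have C1: "C1_on sE sE D f"
        unfolding D_def f_def \<beta>_def by (rule C1_map_chart[OF C1_\<beta> chart(1) chart(1)])
      have f: "f (\<phi> a) = \<phi> (\<beta> a)" if "a \<in> U" for a
        using that inj by (simp add: f_def)
      have eD: "e \<in> D"
        using chart(2) \<beta>1 unfolding D_def e_def by auto
      obtain c K where K: "\<And>j v. j \<ge> K \<Longrightarrow> v \<in> E (j + c) \<Longrightarrow> e + v \<in> D \<and> f (e + v) - f e \<in> E j"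
        using C1_on_Lipschitz[OF C1 eD] by blast
      have "x \<in> \<alpha> ` B j" if j: "j \<ge> K" and x: "x \<in> B (j + c)" for j x
      proof -
        have xU: "x \<in> U" "\<kappa> x \<in> E (j + J + c)"
          using x by (auto simp: B_def B0_def algebra_simps)
        have "\<phi> x \<in> D" "f (\<phi> x) - f e \<in> E (j + J)"
          using K[of "j + J" "\<kappa> x"] j xU(2) by (auto simp: \<kappa>_def)
        then have "\<beta> x \<in> U" "\<kappa> (\<beta> x) \<in> E (j + J)"
          using inj xU(1) f[OF xU(1)] f[OF chart(2)] \<beta>1
          by (auto simp: D_def \<kappa>_def e_def dest: inj_onD)
        then have "\<beta> x \<in> B j"
          by (simp add: B_def B0_def)
        moreover have "x = \<alpha> (\<beta> x)"
          using \<alpha>\<beta> xU(1) U_carrier by auto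
        ultimately show ?thesis by blast
      qed
      then show ?thesis by blast
    qed
  qed
  then show ?thesis by blast
qed

theorem theoremA:
  fixes absval :: "'k::{field, topological_ab_group_add, topological_monoid_mult} \<Rightarrow> real"
    and p :: nat
    and sE :: "'k \<Rightarrow> 'e::{topological_ab_group_add, t2_space} \<Rightarrow> 'e"
    and G :: "('g, 'm) monoid_scheme" (structure)
    and T :: "'g topology"
    and A :: "('g, 'e) chart set"
    and \<alpha> :: "'g \<Rightarrow> 'g"
  assumes local_field: "local_field absval"
    and char: "CHAR('k) = p" and p_pos: "p > 0"
    and Lie_group: "C1_Lie_group sE G T A"
    and automorphism: "C1_automorphism sE G T A \<alpha>"
    and contractive: "contractive G T \<alpha>"
  shows "torsion_group G \<and> finite_exponent G \<and> solvable G \<and>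
    (\<exists>(n::nat) (Gs :: nat \<Rightarrow> 'g set).
       Gs 0 = {\<one>} \<and> Gs n = carrier G \<and>
       (\<forall>j\<le>n. subgroup (Gs j) G \<and> closedin T (Gs j) \<and> \<alpha> ` Gs j = Gs j) \<and>
       (\<forall>j\<in>{1..n}.
          Gs (j - 1) \<lhd> G\<lparr>carrier := Gs j\<rparr> \<and>
          contraction_isomorphic
            (G\<lparr>carrier := Gs j\<rparr> Mod Gs (j - 1))
            (quotient_topology (subtopology T (Gs j)) (\<lambda>x. Gs (j - 1) #> x))
            (\<lambda>C. \<alpha> ` C)
            (shift_group (integer_mod_group p))
            (shift_topology (integer_mod_group p))
            right_shift))"
proof -
  have "of_nat p = (0 :: 'k)"
    unfolding char[symmetric] by (rule of_nat_CHAR)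
  moreover have "prime p"
    using prime_CHAR_semidom[where ?'a = 'k] p_pos char by simp
  ultimately obtain B where "topologized_filtration G \<alpha> B p T"
    using Lie_group_filtration[OF local_field _ _ Lie_group automorphism contractive] by blast
  then show ?thesis
    by (rule topologized_filtration.contraction_structure)
qed

end
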